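(* Let $A \subseteq \omega$ be a computably independent set. Then $$\mathrm{Th}\left(\mathcal{M} \big/ \left\{\, i^\frown f \;\middle|\; i \in \omega,\ f \in \omega^\omega,\ f \geq_T A^{[i]} \right\}\right) = \mathrm{IPC}.$$
   Context: Computably independent sets: fix a computable pairing function $\langle\cdot,\cdot\rangle:\omega^2\to\omega$. For $A \subseteq \omega$ (identified with its characteristic function) the $i$-th column $A^{[i]}$ is given by $A^{[i]}(n) = A(\langle i,n\rangle)$. $A$ is computably independent if for every $i \in \omega$ we have $\bigoplus_{j\neq i} A^{[j]} \not\geq_T A^{[i]}$. Concatenation: $i^\frown f$ is the function with first value $i$ followed by the values of $f$. Medvedev lattice: mass problems are subsets of $\omega^\omega$. $\mathcal{X} \leq_{\mathcal{M}} \mathcal{Y}$ iff there is a Turing functional $\Phi$ with $\Phi(\mathcal{Y}) \subseteq \mathcal{X}$ (i.e. for every $f\in\mathcal{Y}$, $\Phi(f)$ is total and belongs to $\mathcal{X}$). $\equiv_{\mathcal{M}}$ is the induced equivalence, its classes are the Medvedev degrees, and $\mathcal{M}$ is the ordered set of Medvedev degrees; a mass problem is also used to denote its degree. $\mathcal{M}$ is a bounded distributive lattice with join $\mathcal{X}\oplus\mathcal{Y} = \{f\oplus g \mid f\in\mathcal{X}, g\in\mathcal{Y}\}$, meet $\mathcal{X}\otimes\mathcal{Y} = \{0^\frown f\mid f\in\mathcal{X}\}\cup\{1^\frown g\mid g\in\mathcal{Y}\}$, bottom $0$ = degree of $\omega^\omega$, top $1$ = degree of $\emptyset$. Brouwer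 algebras: a Brouwer algebra is a bounded distributive lattice (join $\oplus$, meet $\otimes$) with a binary operation $\to$ such that $a\oplus c\geq b$ iff $c\geq a\to b$. $\mathcal{M}$ is a Brouwer algebra with $\mathcal{X}\to\mathcal{Y} = \{n^\frown f \mid \forall g\in\mathcal{X}\,(\Phi_n(f\oplus g)\in\mathcal{Y})\}$, where $\Phi_n$ is the $n$-th Turing functional. For a Brouwer algebra $\mathscr{B}$ and $x\in\mathscr{B}$, $\mathscr{B}/x$ denotes the quotient of $\mathscr{B}$ by the principal filter $\{z\mid z\geq x\}$; it is isomorphic to the interval $[0,x]_{\mathscr{B}}$ (with the operations $\oplus,\otimes,\to$ of $\mathscr{B}$, bottom $0$ and top $x$) and is a Brouwer algebra. Theories: a propositional formula $\varphi(x_1,\dots,x_n)$ is evaluated at $b_1,\dots,b_n$ in a Brouwer algebra $\mathscr{B}$ by interpreting $\vee$ as $\otimes$, $\wedge$ as $\oplus$, implication as $\to$, and $\bot$ as $1$ (with $\neg\alpha$ being $\alpha\to\bot$). $\mathrm{Th}(\mathscr{B})$ is the set of formulas evaluating to $0$ under all valuations. $\mathrm{IPC}$ is the set of formulas provable in intuitionistic propositional logic. *)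

theory Defs
  imports Complex_Main "HOL-Library.Nat_Bijection"
begin

section \<open>Turing functionals\<close>

text \<open>
  Programs for partial recursive functions relative to an oracle. All functions are unary;
  several arguments are passed through the Cantor pairing \<^const>\<open>prod_encode\<close>, which is also
  the pairing function used for columns below.
\<close>

datatype oprog =
    Zero | Succ | Left | Right | Oracle
  | Fork oprog oprog
  | Comp oprog oprog
  | Prec oprog oprog
  | Mu oprog

primrec run :: "(nat \<Rightarrow> nat) \<Rightarrow> oprog \<Rightarrow> nat \<rightharpoonup> nat" where
  "run g Zero = (\<lambda>x. Some 0)"
| "run g Succ = (\<lambda>x. Some (Suc x))"
| "run g Left = (\<lambda>x. Some (fst (prod_decode x)))"
| "run g Right = (\<lambda>x. Some (snd (prod_decode x)))"
| "run g Oracle = (\<lambda>x. Some (g x))"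
| "run g (Fork p q) =
     (\<lambda>x. Option.bind (run g p x) (\<lambda>a. Option.bind (run g q x) (\<lambda>b. Some (prod_encode (a, b)))))"
| "run g (Comp p q) = (\<lambda>x. Option.bind (run g q x) (run g p))"
| "run g (Prec p q) = (\<lambda>x. case prod_decode x of (a, n) \<Rightarrow>
     rec_nat (run g p a)
       (\<lambda>m r. Option.bind r (\<lambda>b. run g q (prod_encode (a, prod_encode (m, b))))) n)"
| "run g (Mu p) = (\<lambda>x.
     if \<exists>n. run g p (prod_encode (x, n)) = Some 0 \<and>
            (\<forall>m<n. \<exists>k. run g p (prod_encode (x, m)) = Some (Suc k))
     then Some (LEAST n. run g p (prod_encode (x, n)) = Some 0)
     else None)"

text \<open>An effective numbering of programs; it is a bijection between programs and \<open>nat\<close>.\<close>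

primrec prog_num :: "oprog \<Rightarrow> nat" where
  "prog_num Zero = 0"
| "prog_num Succ = 1"
| "prog_num Left = 2"
| "prog_num Right = 3"
| "prog_num Oracle = 4"
| "prog_num (Fork p q) = 5 + 4 * prod_encode (prog_num p, prog_num q)"
| "prog_num (Comp p q) = 6 + 4 * prod_encode (prog_num p, prog_num q)"
| "prog_num (Prec p q) = 7 + 4 * prod_encode (prog_num p, prog_num q)"
| "prog_num (Mu p) = 8 + 4 * prog_num p"

lemma inj_prog_num: "inj prog_num"
proof (rule injI)
  show "p = q" if "prog_num p = prog_num q" for p q
    using that
  proof (induction p arbitrary: q)
    case (Fork p1 p2)
    from Fork(3) show ?case by (cases q) (auto dest: Fork(1,2) | presburger)+
  next
    case (Comp p1 p2)
    from Comp(3) show ?case by (cases q) (auto dest: Comp(1,2) | presburger)+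
  next
    case (Prec p1 p2)
    from Prec(3) show ?case by (cases q) (auto dest: Prec(1,2) | presburger)+
  next
    case (Mu p)
    from Mu(2) show ?case by (cases q) (auto dest: Mu(1) | presburger)+
  qed (case_tac q; simp; presburger?)+
qed

lemma surj_prog_num: "\<exists>p. prog_num p = n"
proof (induction n rule: less_induct)
  case (less n)
  define m where "m = (n - 5) div 4"
  obtain a b where ab: "m = prod_encode (a, b)" by (metis prod_decode_inverse surj_pair)
  show ?case
  proof (cases "n < 5")
    case True
    then have "n = 0 \<or> n = 1 \<or> n = 2 \<or> n = 3 \<or> n = 4" by linarith
    then show ?thesis by (metis prog_num.simps(1-5))
  next
    case False
    then have "m < n" by (simp add: m_def)
    then have "a < n" "b < n"
      using ab le_prod_encode_1[of a b] le_prod_encode_2[of b a] by linarith+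
    then obtain p q r where pqr: "prog_num p = a" "prog_num q = b" "prog_num r = m"
      using less \<open>m < n\<close> by metis
    have "n - 5 = 4 * m + (n - 5) mod 4" by (simp add: m_def)
    moreover have "(n - 5) mod 4 < 4" by simp
    ultimately have "n = 5 + 4 * m \<or> n = 6 + 4 * m \<or> n = 7 + 4 * m \<or> n = 8 + 4 * m"
      using False by linarith
    then show ?thesis
      using pqr ab prog_num.simps(6-9) by metis
  qed
qed

lemma bij_prog_num: "bij prog_num"
  using inj_prog_num surj_prog_num by (metis bijI surjI)

definition Phi :: "nat \<Rightarrow> (nat \<Rightarrow> nat) \<Rightarrow> nat \<rightharpoonup> nat" where
  "Phi n g = run g (inv prog_num n)"

text \<open>\<open>\<Phi>\<^sub>n(g)\<close> is total and belongs to \<open>X\<close>.\<close>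

definition Phi_in :: "nat \<Rightarrow> (nat \<Rightarrow> nat) \<Rightarrow> (nat \<Rightarrow> nat) set \<Rightarrow> bool" where
  "Phi_in n g X \<longleftrightarrow> (\<exists>h\<in>X. \<forall>x. Phi n g x = Some (h x))"

definition turing_le :: "(nat \<Rightarrow> nat) \<Rightarrow> (nat \<Rightarrow> nat) \<Rightarrow> bool"  (infix "\<le>\<^sub>T" 50) where
  "f \<le>\<^sub>T g \<longleftrightarrow> (\<exists>n. \<forall>x. Phi n g x = Some (f x))"


section \<open>Computably independent sets\<close>

definition char_fun :: "nat set \<Rightarrow> nat \<Rightarrow> nat" where
  "char_fun A n = (if n \<in> A then 1 else 0)"

definition column :: "nat set \<Rightarrow> nat \<Rightarrow> nat \<Rightarrow> nat" where
  "column A i = (\<lambda>n. char_fun A (prod_encode (i, n)))"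

text \<open>
  \<open>\<Oplus>\<^bsub>j\<noteq>i\<^esub> A\<^sup>[\<^sup>j\<^sup>]\<close>: the columns with index \<open>j \<noteq> i\<close> are coded at the positions
  \<open>\<langle>j, n\<rangle>\<close>; the value at positions \<open>\<langle>i, n\<rangle>\<close> is \<open>0\<close>.
\<close>

definition other_columns :: "nat set \<Rightarrow> nat \<Rightarrow> nat \<Rightarrow> nat" where
  "other_columns A i =
     (\<lambda>m. case prod_decode m of (j, n) \<Rightarrow> if j \<noteq> i then column A j n else 0)"

definition computably_independent :: "nat set \<Rightarrow> bool" where
  "computably_independent A \<longleftrightarrow> (\<forall>i. \<not> column A i \<le>\<^sub>T other_columns A i)"


section \<open>Brouwer algebras and their theories\<close>

record 'a brouwer_struct =
  bcarrier :: "'a set"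
  bjoin :: "'a \<Rightarrow> 'a \<Rightarrow> 'a"
  bmeet :: "'a \<Rightarrow> 'a \<Rightarrow> 'a"
  bimp :: "'a \<Rightarrow> 'a \<Rightarrow> 'a"
  bbot :: 'a
  btop :: 'a

definition ble :: "('a, 'm) brouwer_struct_scheme \<Rightarrow> 'a \<Rightarrow> 'a \<Rightarrow> bool" where
  "ble B a b \<longleftrightarrow> bjoin B a b = b"

locale brouwer_algebra =
  fixes B :: "('a, 'm) brouwer_struct_scheme"
  assumes join_closed: "a \<in> bcarrier B \<Longrightarrow> b \<in> bcarrier B \<Longrightarrow> bjoin B a b \<in> bcarrier B"
    and meet_closed: "a \<in> bcarrier B \<Longrightarrow> b \<in> bcarrier B \<Longrightarrow> bmeet B a b \<in> bcarrier B"
    and imp_closed: "a \<in> bcarrier B \<Longrightarrow> b \<in> bcarrier B \<Longrightarrow> bimp B a b \<in> bcarrier B"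
    and bot_closed: "bbot B \<in> bcarrier B"
    and top_closed: "btop B \<in> bcarrier B"
    and join_commute: "a \<in> bcarrier B \<Longrightarrow> b \<in> bcarrier B \<Longrightarrow> bjoin B a b = bjoin B b a"
    and meet_commute: "a \<in> bcarrier B \<Longrightarrow> b \<in> bcarrier B \<Longrightarrow> bmeet B a b = bmeet B b a"
    and join_assoc: "a \<in> bcarrier B \<Longrightarrow> b \<in> bcarrier B \<Longrightarrow> c \<in> bcarrier B \<Longrightarrow>
          bjoin B (bjoin B a b) c = bjoin B a (bjoin B b c)"
    and meet_assoc: "a \<in> bcarrier B \<Longrightarrow> b \<in> bcarrier B \<Longrightarrow> c \<in> bcarrier B \<Longrightarrow>
          bmeet B (bmeet B a b) c = bmeet B a (bmeet B b c)"
    and join_meet_absorb: "a \<in> bcarrier B \<Longrightarrow> b \<in> bcarrier B \<Longrightarrow> bjoin B a (bmeet B a b) = a"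
    and meet_join_absorb: "a \<in> bcarrier B \<Longrightarrow> b \<in> bcarrier B \<Longrightarrow> bmeet B a (bjoin B a b) = a"
    and meet_join_distrib: "a \<in> bcarrier B \<Longrightarrow> b \<in> bcarrier B \<Longrightarrow> c \<in> bcarrier B \<Longrightarrow>
          bmeet B a (bjoin B b c) = bjoin B (bmeet B a b) (bmeet B a c)"
    and bot_least: "a \<in> bcarrier B \<Longrightarrow> ble B (bbot B) a"
    and top_greatest: "a \<in> bcarrier B \<Longrightarrow> ble B a (btop B)"
    and imp_adjoint: "a \<in> bcarrier B \<Longrightarrow> b \<in> bcarrier B \<Longrightarrow> c \<in> bcarrier B \<Longrightarrow>
          ble B b (bjoin B a c) \<longleftrightarrow> ble B (bimp B a b) c"

subsection \<open>Factors by principal filters\<close>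

text \<open>The lattice congruence induced by a filter \<open>F\<close>.\<close>

definition filter_cong :: "('a, 'm) brouwer_struct_scheme \<Rightarrow> 'a set \<Rightarrow> ('a \<times> 'a) set" where
  "filter_cong B F =
     {(a, b). a \<in> bcarrier B \<and> b \<in> bcarrier B \<and> (\<exists>z\<in>F. bmeet B a z = bmeet B b z)}"

definition principal_filter :: "('a, 'm) brouwer_struct_scheme \<Rightarrow> 'a \<Rightarrow> 'a set" where
  "principal_filter B x = {z \<in> bcarrier B. ble B x z}"

text \<open>
  The relation is in general a congruence only for the lattice operations. The implication of
  the factor is therefore the one determined by the quotient lattice, via the defining
  property of Brouwer algebras; it exists by \<open>factor_brouwer_algebra\<close> below.
\<close>

definition factor :: "('a, 'm) brouwer_struct_scheme \<Rightarrow> 'a \<Rightarrow> 'a set brouwer_struct" where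
  "factor B x =
    (let R = filter_cong B (principal_filter B x);
         C = bcarrier B // R;
         J = (\<lambda>X Y. R `` {bjoin B a b | a b. a \<in> X \<and> b \<in> Y});
         le = (\<lambda>X Y. J X Y = Y)
     in \<lparr> bcarrier = C,
          bjoin = J,
          bmeet = (\<lambda>X Y. R `` {bmeet B a b | a b. a \<in> X \<and> b \<in> Y}),
          bimp = (\<lambda>X Y. THE Z. Z \<in> C \<and> (\<forall>W\<in>C. le Y (J X W) \<longleftrightarrow> le Z W)),
          bbot = R `` {bbot B},
          btop = R `` {btop B} \<rparr>)"

context brouwer_algebra
begin

lemma ble_meet_iff:
  assumes "a \<in> bcarrier B" "b \<in> bcarrier B"
  shows "ble B a b \<longleftrightarrow> bmeet B a b = a"
  using join_meet_absorb[OF assms(2,1)] meet_join_absorb[OF assms]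
    join_commute[OF assms(2) meet_closed[OF assms(2,1)]] meet_commute[OF assms]
    join_commute[OF assms]
  unfolding ble_def by metis

lemma meet_idem: "a \<in> bcarrier B \<Longrightarrow> bmeet B a a = a"
  using meet_join_absorb[of a "bmeet B a a"] join_meet_absorb[of a a] meet_closed[of a a] by simp

lemma filter_cong_principal:
  assumes x: "x \<in> bcarrier B"
  shows "filter_cong B (principal_filter B x) =
    {(a, b). a \<in> bcarrier B \<and> b \<in> bcarrier B \<and> bmeet B a x = bmeet B b x}"
proof -
  have "bmeet B a x = bmeet B b x"
    if a: "a \<in> bcarrier B" and b: "b \<in> bcarrier B" and z: "z \<in> bcarrier B"
      and xz: "ble B x z" and eq: "bmeet B a z = bmeet B b z" for a b z
  proof -
    have zx: "bmeet B z x = x" using ble_meet_iff[OF x z] xz meet_commute[OF x z] by simp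
    have "bmeet B a x = bmeet B (bmeet B a z) x" using meet_assoc[OF a z x] zx by simp
    also have "\<dots> = bmeet B b x" using meet_assoc[OF b z x] zx eq by simp
    finally show ?thesis .
  qed
  moreover have "ble B x x" using ble_meet_iff[OF x x] meet_idem[OF x] by simp
  ultimately show ?thesis
    using x unfolding filter_cong_def principal_filter_def by blast
qed

definition fclass :: "'a \<Rightarrow> 'a \<Rightarrow> 'a set" where
  "fclass x a = {b \<in> bcarrier B. bmeet B b x = bmeet B a x}"

lemma meet_x_join:
  assumes "x \<in> bcarrier B" "a \<in> bcarrier B" "b \<in> bcarrier B"
  shows "bmeet B (bjoin B a b) x = bjoin B (bmeet B a x) (bmeet B b x)"
  using meet_join_distrib[OF assms] meet_commute[OF assms(1) join_closed[OF assms(2,3)]]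
    meet_commute[OF assms(1,2)] meet_commute[OF assms(1,3)] by simp

lemma meet_x_meet_right:
  assumes "x \<in> bcarrier B" "a \<in> bcarrier B" "b \<in> bcarrier B"
  shows "bmeet B (bmeet B a x) (bmeet B b x) = bmeet B (bmeet B a x) b"
proof -
  have "bmeet B (bmeet B a x) (bmeet B b x) = bmeet B a (bmeet B x (bmeet B x b))"
    using meet_assoc[OF assms(2,1) meet_closed[OF assms(3,1)]] meet_commute[OF assms(3,1)] by simp
  also have "bmeet B x (bmeet B x b) = bmeet B x b"
    using meet_assoc[OF assms(1,1,3)] meet_idem[OF assms(1)] by simp
  also have "bmeet B a (bmeet B x b) = bmeet B (bmeet B a x) b"
    using meet_assoc[OF assms(2,1,3)] by simp
  finally show ?thesis .
qed

lemma meet_x_meet: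
  assumes "x \<in> bcarrier B" "a \<in> bcarrier B" "b \<in> bcarrier B"
  shows "bmeet B (bmeet B a b) x = bmeet B (bmeet B a x) (bmeet B b x)"
  using meet_x_meet_right[OF assms] meet_assoc[OF assms(2,1,3)] meet_assoc[OF assms(2,3,1)]
    meet_commute[OF assms(1,3)] by simp

lemma factor_carrier:
  assumes "x \<in> bcarrier B"
  shows "bcarrier (factor B x) = fclass x ` bcarrier B"
proof -
  have "filter_cong B (principal_filter B x) `` {a} = fclass x a" if "a \<in> bcarrier B" for a
    unfolding filter_cong_principal[OF assms] fclass_def using that by auto
  then have "bcarrier B // filter_cong B (principal_filter B x) = fclass x ` bcarrier B"
    unfolding quotient_def by blast
  then show ?thesis by (simp add: factor_def Let_def)
qed

lemma fclass_eq_iff: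
  assumes "a \<in> bcarrier B" "b \<in> bcarrier B"
  shows "fclass x a = fclass x b \<longleftrightarrow> bmeet B a x = bmeet B b x"
  using assms by (auto simp: fclass_def)

lemma filter_cong_Image:
  assumes "x \<in> bcarrier B" "S \<subseteq> fclass x c" "c \<in> S"
  shows "filter_cong B (principal_filter B x) `` S = fclass x c"
  using assms(2,3) unfolding filter_cong_principal[OF assms(1)] fclass_def by force

lemma factor_join:
  assumes "x \<in> bcarrier B" "a \<in> bcarrier B" "b \<in> bcarrier B"
  shows "bjoin (factor B x) (fclass x a) (fclass x b) = fclass x (bjoin B a b)"
proof -
  let ?S = "{bjoin B c d | c d. c \<in> fclass x a \<and> d \<in> fclass x b}"
  have "?S \<subseteq> fclass x (bjoin B a b)"
  proof
    fix e assume "e \<in> ?S"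
    then obtain c d where e: "e = bjoin B c d" and cd: "c \<in> bcarrier B" "d \<in> bcarrier B"
      and eq: "bmeet B c x = bmeet B a x" "bmeet B d x = bmeet B b x"
      unfolding fclass_def by blast
    show "e \<in> fclass x (bjoin B a b)"
      using meet_x_join[OF assms(1) cd] meet_x_join[OF assms] join_closed[OF cd]
      unfolding e fclass_def eq by simp
  qed
  moreover have "bjoin B a b \<in> ?S" using assms(2,3) unfolding fclass_def by blast
  ultimately have "filter_cong B (principal_filter B x) `` ?S = fclass x (bjoin B a b)"
    by (rule filter_cong_Image[OF assms(1)])
  then show ?thesis by (simp add: factor_def Let_def)
qed

lemma factor_meet:
  assumes "x \<in> bcarrier B" "a \<in> bcarrier B" "b \<in> bcarrier B"
  shows "bmeet (factor B x) (fclass x a) (fclass x b) = fclass x (bmeet B a b)"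
proof -
  let ?S = "{bmeet B c d | c d. c \<in> fclass x a \<and> d \<in> fclass x b}"
  have "?S \<subseteq> fclass x (bmeet B a b)"
  proof
    fix e assume "e \<in> ?S"
    then obtain c d where e: "e = bmeet B c d" and cd: "c \<in> bcarrier B" "d \<in> bcarrier B"
      and eq: "bmeet B c x = bmeet B a x" "bmeet B d x = bmeet B b x"
      unfolding fclass_def by blast
    show "e \<in> fclass x (bmeet B a b)"
      using meet_x_meet[OF assms(1) cd] meet_x_meet[OF assms] meet_closed[OF cd]
      unfolding e fclass_def eq by simp
  qed
  moreover have "bmeet B a b \<in> ?S" using assms(2,3) unfolding fclass_def by blast
  ultimately have "filter_cong B (principal_filter B x) `` ?S = fclass x (bmeet B a b)"
    by (rule filter_cong_Image[OF assms(1)])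
  then show ?thesis by (simp add: factor_def Let_def)
qed

lemma factor_bot:
  assumes "x \<in> bcarrier B"
  shows "bbot (factor B x) = fclass x (bbot B)"
proof -
  have "filter_cong B (principal_filter B x) `` {bbot B} = fclass x (bbot B)"
    by (rule filter_cong_Image[OF assms]) (auto simp: fclass_def bot_closed)
  then show ?thesis by (simp add: factor_def Let_def)
qed

lemma factor_top:
  assumes "x \<in> bcarrier B"
  shows "btop (factor B x) = fclass x (btop B)"
proof -
  have "filter_cong B (principal_filter B x) `` {btop B} = fclass x (btop B)"
    by (rule filter_cong_Image[OF assms]) (auto simp: fclass_def top_closed)
  then show ?thesis by (simp add: factor_def Let_def)
qed

lemma factor_ble:
  assumes "x \<in> bcarrier B" "a \<in> bcarrier B" "b \<in> bcarrier B"
  shows "ble (factor B x) (fclass x a) (fclass x b) \<longleftrightarrow> ble B (bmeet B a x) b"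
proof -
  have "ble (factor B x) (fclass x a) (fclass x b) \<longleftrightarrow>
        ble B (bmeet B a x) (bmeet B b x)"
    using assms by (simp add: ble_def factor_join fclass_eq_iff join_closed meet_x_join)
  also have "\<dots> \<longleftrightarrow> bmeet B (bmeet B a x) (bmeet B b x) = bmeet B a x"
    using assms by (simp add: ble_meet_iff meet_closed)
  also have "bmeet B (bmeet B a x) (bmeet B b x) = bmeet B (bmeet B a x) b"
    using assms by (rule meet_x_meet_right)
  finally show ?thesis using assms by (simp add: ble_meet_iff meet_closed)
qed

lemma ble_refl: "a \<in> bcarrier B \<Longrightarrow> ble B a a"
  by (simp add: ble_meet_iff meet_idem)

lemma ble_antisym: "a \<in> bcarrier B \<Longrightarrow> b \<in> bcarrier B \<Longrightarrow> ble B a b \<Longrightarrow> ble B b a \<Longrightarrow> a = b"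
  by (simp add: ble_def join_commute)

lemma ble_trans:
  "a \<in> bcarrier B \<Longrightarrow> b \<in> bcarrier B \<Longrightarrow> c \<in> bcarrier B \<Longrightarrow> ble B a b \<Longrightarrow> ble B b c \<Longrightarrow> ble B a c"
  using join_assoc[of a b c] by (simp add: ble_def)

lemma factor_imp_aux:
  assumes "x \<in> bcarrier B" "a \<in> bcarrier B" "b \<in> bcarrier B" "c \<in> bcarrier B"
  shows "ble (factor B x) (fclass x b) (bjoin (factor B x) (fclass x a) (fclass x c)) \<longleftrightarrow>
         ble (factor B x) (fclass x (bimp B a (bmeet B b x))) (fclass x c)"
proof -
  let ?i = "bimp B a (bmeet B b x)"
  have i: "?i \<in> bcarrier B" using assms by (simp add: imp_closed meet_closed)
  have "ble B (bmeet B b x) (bjoin B a (bmeet B b x))"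
    using assms by (metis ble_meet_iff join_closed join_commute meet_closed meet_join_absorb)
  then have le1: "ble B ?i (bmeet B b x)" using assms by (simp add: imp_adjoint meet_closed)
  have "ble B (bmeet B b x) x"
    using assms by (metis ble_def join_commute join_meet_absorb meet_closed meet_commute)
  then have "ble B ?i x" using le1 ble_trans i assms by (meson meet_closed)
  then have "bmeet B ?i x = ?i" using i assms by (simp add: ble_meet_iff)
  then show ?thesis
    using assms i by (simp add: factor_join factor_ble join_closed imp_adjoint meet_closed)
qed

lemma factor_imp:
  assumes x: "x \<in> bcarrier B" and a: "a \<in> bcarrier B" and b: "b \<in> bcarrier B"
  shows "bimp (factor B x) (fclass x a) (fclass x b) = fclass x (bimp B a (bmeet B b x))"
proof -
  let ?Q = "factor B x" and ?i = "bimp B a (bmeet B b x)"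
  have i: "?i \<in> bcarrier B" using assms by (simp add: imp_closed meet_closed)
  have "bimp ?Q (fclass x a) (fclass x b) =
    (THE Z. Z \<in> bcarrier ?Q \<and> (\<forall>W\<in>bcarrier ?Q.
       ble ?Q (fclass x b) (bjoin ?Q (fclass x a) W) \<longleftrightarrow> ble ?Q Z W))"
    by (simp add: factor_def Let_def ble_def)
  also have "\<dots> = fclass x ?i"
  proof (rule the_equality)
    show "fclass x ?i \<in> bcarrier ?Q \<and> (\<forall>W\<in>bcarrier ?Q.
       ble ?Q (fclass x b) (bjoin ?Q (fclass x a) W) \<longleftrightarrow> ble ?Q (fclass x ?i) W)"
      using assms i factor_imp_aux by (auto simp: factor_carrier)
  next
    fix Z
    assume Z: "Z \<in> bcarrier ?Q \<and> (\<forall>W\<in>bcarrier ?Q.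
       ble ?Q (fclass x b) (bjoin ?Q (fclass x a) W) \<longleftrightarrow> ble ?Q Z W)"
    then obtain d where d: "d \<in> bcarrier B" "Z = fclass x d" using x by (auto simp: factor_carrier)
    have *: "ble ?Q (fclass x d) (fclass x c) \<longleftrightarrow> ble ?Q (fclass x ?i) (fclass x c)"
      if "c \<in> bcarrier B" for c
      using Z d x a b that factor_imp_aux by (auto simp: factor_carrier)
    have refl: "ble ?Q (fclass x c) (fclass x c)" if "c \<in> bcarrier B" for c
      using that x
      by (metis factor_ble ble_def join_commute join_meet_absorb meet_closed)
    have "ble ?Q (fclass x d) (fclass x ?i)" "ble ?Q (fclass x ?i) (fclass x d)"
      using * i d(1) refl by blast+
    then have "fclass x d = fclass x ?i"
      using x i d(1) by (simp add: ble_def factor_join join_commute)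
    then show "Z = fclass x ?i" using d(2) by simp
  qed
  finally show ?thesis .
qed

lemma factor_brouwer_algebra:
  assumes x: "x \<in> bcarrier B"
  shows "brouwer_algebra (factor B x)"
proof
  note ops = factor_carrier[OF x] factor_join[OF x] factor_meet[OF x] factor_imp[OF x]
    factor_bot[OF x] factor_top[OF x]
  note closed = x join_closed meet_closed imp_closed bot_closed top_closed
  show "bbot (factor B x) \<in> bcarrier (factor B x)" "btop (factor B x) \<in> bcarrier (factor B x)"
    by (auto simp: ops closed)
  fix X Y assume "X \<in> bcarrier (factor B x)" and Y: "Y \<in> bcarrier (factor B x)"
  then obtain a where a: "X = fclass x a" "a \<in> bcarrier B" by (auto simp: ops)
  obtain b where b: "Y = fclass x b" "b \<in> bcarrier B" using Y by (auto simp: ops)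
  note ab = a b
  show "bjoin (factor B x) X Y \<in> bcarrier (factor B x)"
    "bmeet (factor B x) X Y \<in> bcarrier (factor B x)"
    "bimp (factor B x) X Y \<in> bcarrier (factor B x)"
    by (auto simp: ops ab closed)
  show "bjoin (factor B x) X Y = bjoin (factor B x) Y X"
    "bmeet (factor B x) X Y = bmeet (factor B x) Y X"
    by (simp_all add: ops ab join_commute meet_commute)
  show "bjoin (factor B x) X (bmeet (factor B x) X Y) = X"
    "bmeet (factor B x) X (bjoin (factor B x) X Y) = X"
    by (simp_all add: ops ab closed join_meet_absorb meet_join_absorb)
  show "ble (factor B x) (bbot (factor B x)) X" "ble (factor B x) X (btop (factor B x))"
    using bot_least[OF a(2)] top_greatest[OF a(2)] by (simp_all add: ble_def ops ab closed)
  fix Z assume "Z \<in> bcarrier (factor B x)"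
  then obtain c where c: "Z = fclass x c" "c \<in> bcarrier B" by (auto simp: ops)
  note abc = ab c
  show "bjoin (factor B x) (bjoin (factor B x) X Y) Z = bjoin (factor B x) X (bjoin (factor B x) Y Z)"
    "bmeet (factor B x) (bmeet (factor B x) X Y) Z = bmeet (factor B x) X (bmeet (factor B x) Y Z)"
    by (simp_all add: ops abc closed join_assoc meet_assoc)
  show "bmeet (factor B x) X (bjoin (factor B x) Y Z) =
        bjoin (factor B x) (bmeet (factor B x) X Y) (bmeet (factor B x) X Z)"
    by (simp add: ops abc closed meet_join_distrib)
  show "ble (factor B x) Y (bjoin (factor B x) X Z) \<longleftrightarrow> ble (factor B x) (bimp (factor B x) X Y) Z"
    using factor_imp_aux[OF x a(2) b(2) c(2)] by (simp add: abc factor_imp[OF x a(2) b(2)])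
qed

text \<open>The factor is the interval \<open>[0, x]\<close> with the operations of \<open>B\<close> and top \<open>x\<close>.\<close>

lemma factor_interval_bij:
  assumes x: "x \<in> bcarrier B"
  shows "bij_betw (fclass x) {a \<in> bcarrier B. ble B a x} (bcarrier (factor B x))"
proof -
  let ?I = "{a \<in> bcarrier B. ble B a x}"
  have meet_x: "bmeet B a x = a" if "a \<in> ?I" for a
    using that ble_meet_iff[OF _ x] by blast
  have m: "bmeet B a x \<in> ?I" if a: "a \<in> bcarrier B" for a
  proof -
    have "bjoin B (bmeet B a x) x = bjoin B x (bmeet B x a)"
      using join_commute[OF meet_closed[OF a x] x] meet_commute[OF a x] by simp
    then show ?thesis using meet_closed[OF a x] join_meet_absorb[OF x a] by (simp add: ble_def)
  qed
  have "inj_on (fclass x) ?I"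
  proof (rule inj_onI)
    fix a b assume ab: "a \<in> ?I" "b \<in> ?I" "fclass x a = fclass x b"
    then have "bmeet B a x = bmeet B b x" using fclass_eq_iff by blast
    then show "a = b" using meet_x[OF ab(1)] meet_x[OF ab(2)] by simp
  qed
  moreover have "fclass x ` ?I = fclass x ` bcarrier B"
  proof
    show "fclass x ` bcarrier B \<subseteq> fclass x ` ?I"
    proof
      fix X assume "X \<in> fclass x ` bcarrier B"
      then obtain a where a: "a \<in> bcarrier B" "X = fclass x a" by blast
      have "X = fclass x (bmeet B a x)"
        using meet_x[OF m[OF a(1)]] unfolding a(2) fclass_def by simp
      then show "X \<in> fclass x ` ?I" using m[OF a(1)] by blast
    qed
  qed blast
  ultimately show ?thesis by (simp add: bij_betw_def factor_carrier[OF x])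
qed

lemma factor_interval_hom:
  assumes x: "x \<in> bcarrier B"
    and a: "a \<in> bcarrier B" "ble B a x" and b: "b \<in> bcarrier B" "ble B b x"
  shows "fclass x (bjoin B a b) = bjoin (factor B x) (fclass x a) (fclass x b)"
    and "fclass x (bmeet B a b) = bmeet (factor B x) (fclass x a) (fclass x b)"
    and "fclass x (bimp B a b) = bimp (factor B x) (fclass x a) (fclass x b)"
    and "fclass x (bbot B) = bbot (factor B x)"
    and "fclass x x = btop (factor B x)"
proof -
  have "bmeet B b x = b" using b x ble_meet_iff by blast
  then show "fclass x (bjoin B a b) = bjoin (factor B x) (fclass x a) (fclass x b)"
    and "fclass x (bmeet B a b) = bmeet (factor B x) (fclass x a) (fclass x b)"
    and "fclass x (bimp B a b) = bimp (factor B x) (fclass x a) (fclass x b)"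
    and "fclass x (bbot B) = bbot (factor B x)"
    using factor_join[OF x a(1) b(1)] factor_meet[OF x a(1) b(1)] factor_imp[OF x a(1) b(1)]
      factor_bot[OF x] by simp_all
  have "bmeet B x x = x" using ble_refl[OF x] ble_meet_iff[OF x x] by blast
  moreover have "bmeet B (btop B) x = x"
    using top_greatest[OF x] ble_meet_iff[OF x top_closed] meet_commute[OF x top_closed] by simp
  ultimately show "fclass x x = btop (factor B x)"
    by (simp add: factor_top[OF x] fclass_def)
qed

end

subsection \<open>Propositional formulas\<close>

datatype form =
    Var nat
  | Bot
  | And form form
  | Or form form
  | Imp form form

primrec bval :: "('a, 'm) brouwer_struct_scheme \<Rightarrow> (nat \<Rightarrow> 'a) \<Rightarrow> form \<Rightarrow> 'a" where
  "bval B v (Var p) = v p"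
| "bval B v Bot = btop B"
| "bval B v (And \<phi> \<psi>) = bjoin B (bval B v \<phi>) (bval B v \<psi>)"
| "bval B v (Or \<phi> \<psi>) = bmeet B (bval B v \<phi>) (bval B v \<psi>)"
| "bval B v (Imp \<phi> \<psi>) = bimp B (bval B v \<phi>) (bval B v \<psi>)"

definition Th :: "('a, 'm) brouwer_struct_scheme \<Rightarrow> form set" where
  "Th B = {\<phi>. \<forall>v. range v \<subseteq> bcarrier B \<longrightarrow> bval B v \<phi> = bbot B}"

text \<open>Intuitionistic natural deduction.\<close>

inductive int_entails :: "form set \<Rightarrow> form \<Rightarrow> bool"  (infix "\<turnstile>\<^sub>i" 50) where
  Hyp: "\<phi> \<in> \<Gamma> \<Longrightarrow> \<Gamma> \<turnstile>\<^sub>i \<phi>"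
| BotE: "\<Gamma> \<turnstile>\<^sub>i Bot \<Longrightarrow> \<Gamma> \<turnstile>\<^sub>i \<phi>"
| AndI: "\<Gamma> \<turnstile>\<^sub>i \<phi> \<Longrightarrow> \<Gamma> \<turnstile>\<^sub>i \<psi> \<Longrightarrow> \<Gamma> \<turnstile>\<^sub>i And \<phi> \<psi>"
| AndE1: "\<Gamma> \<turnstile>\<^sub>i And \<phi> \<psi> \<Longrightarrow> \<Gamma> \<turnstile>\<^sub>i \<phi>"
| AndE2: "\<Gamma> \<turnstile>\<^sub>i And \<phi> \<psi> \<Longrightarrow> \<Gamma> \<turnstile>\<^sub>i \<psi>"
| OrI1: "\<Gamma> \<turnstile>\<^sub>i \<phi> \<Longrightarrow> \<Gamma> \<turnstile>\<^sub>i Or \<phi> \<psi>"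
| OrI2: "\<Gamma> \<turnstile>\<^sub>i \<psi> \<Longrightarrow> \<Gamma> \<turnstile>\<^sub>i Or \<phi> \<psi>"
| OrE: "\<Gamma> \<turnstile>\<^sub>i Or \<phi> \<psi> \<Longrightarrow> insert \<phi> \<Gamma> \<turnstile>\<^sub>i \<chi> \<Longrightarrow> insert \<psi> \<Gamma> \<turnstile>\<^sub>i \<chi> \<Longrightarrow> \<Gamma> \<turnstile>\<^sub>i \<chi>"
| ImpI: "insert \<phi> \<Gamma> \<turnstile>\<^sub>i \<psi> \<Longrightarrow> \<Gamma> \<turnstile>\<^sub>i Imp \<phi> \<psi>"
| ImpE: "\<Gamma> \<turnstile>\<^sub>i Imp \<phi> \<psi> \<Longrightarrow> \<Gamma> \<turnstile>\<^sub>i \<phi> \<Longrightarrow> \<Gamma> \<turnstile>\<^sub>i \<psi>"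

definition IPC :: "form set" where
  "IPC = {\<phi>. {} \<turnstile>\<^sub>i \<phi>}"


section \<open>The Medvedev lattice\<close>

type_synonym mass_problem = "(nat \<Rightarrow> nat) set"

definition fcons :: "nat \<Rightarrow> (nat \<Rightarrow> nat) \<Rightarrow> nat \<Rightarrow> nat"  (infixr "\<frown>" 65) where
  "i \<frown> f = case_nat i f"

definition fjoin :: "(nat \<Rightarrow> nat) \<Rightarrow> (nat \<Rightarrow> nat) \<Rightarrow> nat \<Rightarrow> nat" where
  "fjoin f g = (\<lambda>n. if even n then f (n div 2) else g (n div 2))"

definition medvedev_le :: "mass_problem \<Rightarrow> mass_problem \<Rightarrow> bool" where
  "medvedev_le X Y \<longleftrightarrow> (\<exists>n. \<forall>f\<in>Y. Phi_in n f X)"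

definition medvedev_equiv :: "mass_problem \<Rightarrow> mass_problem \<Rightarrow> bool" where
  "medvedev_equiv X Y \<longleftrightarrow> medvedev_le X Y \<and> medvedev_le Y X"

definition mass_join :: "mass_problem \<Rightarrow> mass_problem \<Rightarrow> mass_problem" where
  "mass_join X Y = {fjoin f g | f g. f \<in> X \<and> g \<in> Y}"

definition mass_meet :: "mass_problem \<Rightarrow> mass_problem \<Rightarrow> mass_problem" where
  "mass_meet X Y = {0 \<frown> f | f. f \<in> X} \<union> {1 \<frown> g | g. g \<in> Y}"

definition mass_imp :: "mass_problem \<Rightarrow> mass_problem \<Rightarrow> mass_problem" where
  "mass_imp X Y = {n \<frown> f | n f. \<forall>g\<in>X. Phi_in n (fjoin f g) Y}"

primrec oracle_subst :: "oprog \<Rightarrow> oprog \<Rightarrow> oprog" where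
  "oracle_subst d Zero = Zero"
| "oracle_subst d Succ = Succ"
| "oracle_subst d Left = Left"
| "oracle_subst d Right = Right"
| "oracle_subst d Oracle = d"
| "oracle_subst d (Fork p q) = Fork (oracle_subst d p) (oracle_subst d q)"
| "oracle_subst d (Comp p q) = Comp (oracle_subst d p) (oracle_subst d q)"
| "oracle_subst d (Prec p q) = Prec (oracle_subst d p) (oracle_subst d q)"
| "oracle_subst d (Mu p) = Mu (oracle_subst d p)"

lemma run_oracle_subst:
  assumes "\<And>x. run g d x = Some (f x)"
  shows "run g (oracle_subst d p) = run f p"
proof -
  have "run g d = (\<lambda>x. Some (f x))" using assms by blast
  then show ?thesis by (induction p) (simp_all cong: if_cong)
qed

lemma Phi_prog_num: "Phi (prog_num p) g = run g p"
  by (simp add: Phi_def inj_prog_num)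

lemma medvedev_le_refl: "medvedev_le X X"
  unfolding medvedev_le_def Phi_in_def
  by (rule exI[of _ "prog_num Oracle"]) (auto simp: Phi_prog_num simp del: prog_num.simps)

lemma medvedev_le_trans:
  assumes "medvedev_le X Y" and "medvedev_le Y Z"
  shows "medvedev_le X Z"
proof -
  obtain m where m: "\<And>f. f \<in> Y \<Longrightarrow> Phi_in m f X" using assms(1) by (auto simp: medvedev_le_def)
  obtain n where n: "\<And>f. f \<in> Z \<Longrightarrow> Phi_in n f Y" using assms(2) by (auto simp: medvedev_le_def)
  let ?p = "oracle_subst (inv prog_num n) (inv prog_num m)"
  have "Phi_in (prog_num ?p) f X" if f: "f \<in> Z" for f
  proof -
    obtain h where h: "h \<in> Y" "\<And>x. run f (inv prog_num n) x = Some (h x)"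
      using n f unfolding Phi_in_def Phi_def by blast
    have "run f ?p = run h (inv prog_num m)" by (rule run_oracle_subst) (rule h(2))
    then show ?thesis using m[OF h(1)] unfolding Phi_in_def Phi_prog_num by (simp add: Phi_def)
  qed
  then show ?thesis unfolding medvedev_le_def by blast
qed

quotient_type mdegree = mass_problem / medvedev_equiv
  morphisms rep_mdegree mdeg
  by (rule equivpI; unfold reflp_def symp_def transp_def medvedev_equiv_def)
    (blast intro: medvedev_le_refl medvedev_le_trans)+

text \<open>
  The operations on degrees are computed on representatives; the resulting degrees do not
  depend on the choice of these.
\<close>

definition medvedev :: "mdegree brouwer_struct" where
  "medvedev =
     \<lparr> bcarrier = UNIV,
       bjoin = (\<lambda>a b. mdeg (mass_join (rep_mdegree a) (rep_mdegree b))),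
       bmeet = (\<lambda>a b. mdeg (mass_meet (rep_mdegree a) (rep_mdegree b))),
       bimp = (\<lambda>a b. mdeg (mass_imp (rep_mdegree a) (rep_mdegree b))),
       bbot = mdeg UNIV,
       btop = mdeg {} \<rparr>"

end

theory Submission
  imports Defs
begin

text \<open>
  The factor is a Brouwer algebra, so it validates intuitionistic logic. Conversely, a formula that
  is not derivable fails in a finite Kripke model, hence also on the simplicial complex of the chains
  of that model, since mapping a chain to its greatest element is a p-morphism. This complex is
  embedded as follows. Every column \<open>A\<^sup>[\<^sup>i\<^sup>]\<close> is assigned a set \<open>H i\<close> of vertices so that the sets
  \<open>H i\<close> generate the non-faces. By a join theorem of Posner-Robinson type, independence yields for
  every vertex \<open>v\<close> a function \<open>g v\<close> that computes exactly the columns \<open>i\<close> with \<open>v \<notin> H i\<close> and that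
  computes all columns as soon as it is joined with one of the others. The sets
  \<open>r v = {f. f \<oplus> g v computes all columns}\<close> satisfy \<open>r w \<rightarrow> r v = r v\<close> for \<open>v \<noteq> w\<close>, so that finite
  joins of them behave like the simplices of the full simplex. There is an upwards closed set \<open>Y\<close>
  containing all \<open>g v\<close> such that, above \<open>Y\<close>, the cone of column \<open>i\<close> becomes the join of the
  \<open>r v\<close> with \<open>v \<in> H i\<close>. In the interval above \<open>Y\<close> the top element is therefore the meet of the
  non-faces, and upwards closed sets of faces, interpreted as meets of joins of the \<open>r v\<close>, are
  evaluated by Kripke forcing. Meets in the Medvedev lattice are disjoint unions, which makes
  sets closed under prepending finite sequences meet-irreducible.
\<close>

section \<open>Uniformly computable functionals\<close>

text \<open>The top of the factor is prescribed, so its elements cannot be chosen freely; moreover,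
  independence compares whole columns and does not say how a single cone could be the join of
  smaller pieces. The functions \<open>g v\<close> supply such pieces. Each \<open>g v\<close> is
  also a test point: it belongs to \<open>r w\<close> for every other vertex \<open>w\<close> but
  not to \<open>r v\<close>, and this one point both determines the residuals of the pieces and
  keeps distinct faces apart. \<open>Y\<close> is the largest set of oracles that pushes the cones
  down to the joins of pieces. Passing to the elements above \<open>Y\<close> is harmless, since
  joining with \<open>Y\<close> respects all operations, implication included, and the test points
  lie in \<open>Y\<close>. The second obstacle is uniformity: reductions have to output names of
  vertex sets. As there are finitely many faces and every vertex lies in finitely many sets
  \<open>H i\<close>, each operation on names agrees with an evidently computable one up to finitely
  many exceptions, which are stored in the program. As the top contains the cones of all columns,
  every column has to receive a set \<open>H i\<close>, also those that the complex does not call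
  for.\<close>

definition comp_on :: "(nat \<Rightarrow> nat) set \<Rightarrow> ((nat \<Rightarrow> nat) \<Rightarrow> nat \<Rightarrow> nat) \<Rightarrow> bool" where
  "comp_on D F \<longleftrightarrow> (\<exists>p. \<forall>g\<in>D. \<forall>x. run g p x = Some (F g x))"

definition dec_on :: "(nat \<Rightarrow> nat) set \<Rightarrow> ((nat \<Rightarrow> nat) \<Rightarrow> nat \<Rightarrow> bool) \<Rightarrow> bool" where
  "dec_on D P \<longleftrightarrow> comp_on D (\<lambda>g x. if P g x then 1 else 0)"

abbreviation pfst :: "nat \<Rightarrow> nat" where "pfst z \<equiv> fst (prod_decode z)"
abbreviation psnd :: "nat \<Rightarrow> nat" where "psnd z \<equiv> snd (prod_decode z)"
abbreviation npair :: "nat \<Rightarrow> nat \<Rightarrow> nat" where "npair a b \<equiv> prod_encode (a, b)"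

named_theorems comp_intros

lemma comp_on_cong:
  "(\<And>g x. g \<in> D \<Longrightarrow> F g x = G g x) \<Longrightarrow> comp_on D F \<longleftrightarrow> comp_on D G"
  unfolding comp_on_def by simp

lemma dec_on_cong:
  "(\<And>g x. g \<in> D \<Longrightarrow> P g x = Q g x) \<Longrightarrow> dec_on D P \<longleftrightarrow> dec_on D Q"
  unfolding dec_on_def by (rule comp_on_cong) simp

lemma comp_on_id [comp_intros]: "comp_on D (\<lambda>g x. x)"
  unfolding comp_on_def by (rule exI[of _ "Fork Left Right"]) simp

lemma comp_on_comp:
  assumes "comp_on D F" "comp_on D G" shows "comp_on D (\<lambda>g x. F g (G g x))"
proof -
  obtain p q where "\<forall>g\<in>D. \<forall>x. run g p x = Some (F g x)" "\<forall>g\<in>D. \<forall>x. run g q x = Some (G g x)"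
    using assms unfolding comp_on_def by blast
  then show ?thesis unfolding comp_on_def by (intro exI[of _ "Comp p q"]) simp
qed

lemma comp_on_pair [comp_intros]:
  assumes "comp_on D F" "comp_on D G" shows "comp_on D (\<lambda>g x. npair (F g x) (G g x))"
proof -
  obtain p q where "\<forall>g\<in>D. \<forall>x. run g p x = Some (F g x)" "\<forall>g\<in>D. \<forall>x. run g q x = Some (G g x)"
    using assms unfolding comp_on_def by blast
  then show ?thesis unfolding comp_on_def by (intro exI[of _ "Fork p q"]) simp
qed

lemma comp_on_pfst [comp_intros]: "comp_on D F \<Longrightarrow> comp_on D (\<lambda>g x. pfst (F g x))"
  by (rule comp_on_comp[where F = "\<lambda>g x. pfst x"]) (auto simp: comp_on_def intro: exI[of _ Left])

lemma comp_on_psnd [comp_intros]: "comp_on D F \<Longrightarrow> comp_on D (\<lambda>g x. psnd (F g x))"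
  by (rule comp_on_comp[where F = "\<lambda>g x. psnd x"]) (auto simp: comp_on_def intro: exI[of _ Right])

lemma comp_on_Suc [comp_intros]: "comp_on D F \<Longrightarrow> comp_on D (\<lambda>g x. Suc (F g x))"
  by (rule comp_on_comp[where F = "\<lambda>g x. Suc x"]) (auto simp: comp_on_def intro: exI[of _ Succ])

lemma comp_on_oracle [comp_intros]: "comp_on D F \<Longrightarrow> comp_on D (\<lambda>g x. g (F g x))"
  by (rule comp_on_comp[where F = "\<lambda>g x. g x"]) (auto simp: comp_on_def intro: exI[of _ Oracle])

lemma comp_on_const [comp_intros]: "comp_on D (\<lambda>g x. c)"
proof (induction c)
  case 0
  show ?case by (auto simp: comp_on_def intro: exI[of _ Zero])
next
  case (Suc c)
  then show ?case by (rule comp_on_Suc)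
qed

text \<open>Programs are unary, so the bound variables of the step function are packed into one
  argument \<open>z\<close> and read off by projections. The rules for the other binders have the
  same shape, which lets \<open>comp_intros\<close> descend through nested binders.\<close>

lemma comp_on_rec_nat [comp_intros]:
  assumes "comp_on D A" "comp_on D (\<lambda>g z. S g (pfst z) (pfst (psnd z)) (psnd (psnd z)))" "comp_on D N"
  shows "comp_on D (\<lambda>g x. rec_nat (A g x) (S g x) (N g x))"
proof -
  obtain p q where p: "\<forall>g\<in>D. \<forall>x. run g p x = Some (A g x)"
    and q: "\<forall>g\<in>D. \<forall>x. run g q x = Some (S g (pfst x) (pfst (psnd x)) (psnd (psnd x)))"
    using assms unfolding comp_on_def by blast
  have "rec_nat (run g p x) (\<lambda>m r. Option.bind r (\<lambda>b. run g q (npair x (npair m b)))) n =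
        Some (rec_nat (A g x) (S g x) n)" if "g \<in> D" for g x n
    by (induction n) (use that p q in simp_all)
  then have "\<forall>g\<in>D. \<forall>z. run g (Prec p q) z = Some (rec_nat (A g (pfst z)) (S g (pfst z)) (psnd z))"
    by (simp add: case_prod_beta)
  then have "comp_on D (\<lambda>g z. rec_nat (A g (pfst z)) (S g (pfst z)) (psnd z))"
    unfolding comp_on_def by blast
  from comp_on_comp[OF this comp_on_pair[OF comp_on_id assms(3)]] show ?thesis by simp
qed

lemma comp_on_case_nat [comp_intros]:
  assumes "comp_on D A" "comp_on D (\<lambda>g z. S g (pfst z) (psnd z))" "comp_on D N"
  shows "comp_on D (\<lambda>g x. case_nat (A g x) (S g x) (N g x))"
proof -
  have "comp_on D (\<lambda>g x. rec_nat (A g x) (\<lambda>m r. S g x m) (N g x))"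
    using comp_on_comp[OF assms(2) comp_on_pair[OF comp_on_pfst[OF comp_on_id]
        comp_on_pfst[OF comp_on_psnd[OF comp_on_id]]]]
    by (intro comp_on_rec_nat assms(1,3)) simp
  moreover have "rec_nat a (\<lambda>m r. s m) n = case_nat a s n" for a :: nat and s n
    by (cases n) simp_all
  ultimately show ?thesis by simp
qed

lemma comp_on_pred: "comp_on D F \<Longrightarrow> comp_on D (\<lambda>g x. F g x - 1)"
proof -
  assume F: "comp_on D F"
  have "comp_on D (\<lambda>g x. case_nat 0 (\<lambda>m. m) (F g x))" by (intro comp_intros F)
  moreover have "case_nat 0 (\<lambda>m. m) n = n - 1" for n by (cases n) simp_all
  ultimately show ?thesis by simp
qed

lemma comp_on_plus [comp_intros]:
  assumes "comp_on D F" "comp_on D G" shows "comp_on D (\<lambda>g x. F g x + G g x)"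
proof -
  have "comp_on D (\<lambda>g x. rec_nat (F g x) (\<lambda>m r. Suc r) (G g x))" by (intro comp_intros assms)
  moreover have "rec_nat a (\<lambda>m r. Suc r) n = a + n" for a n by (induction n) simp_all
  ultimately show ?thesis by simp
qed

lemma comp_on_minus [comp_intros]:
  assumes "comp_on D F" "comp_on D G" shows "comp_on D (\<lambda>g x. F g x - G g x)"
proof -
  have "comp_on D (\<lambda>g x. rec_nat (F g x) (\<lambda>m r. r - 1) (G g x))"
    by (intro comp_intros comp_on_pred assms)
  moreover have "rec_nat a (\<lambda>m r. r - 1) n = a - n" for a n by (induction n) simp_all
  ultimately show ?thesis by simp
qed

lemma comp_on_times [comp_intros]:
  assumes "comp_on D F" "comp_on D G" shows "comp_on D (\<lambda>g x. F g x * G g x)"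
proof -
  have "comp_on D (\<lambda>g x. rec_nat 0 (\<lambda>m r. r + F g x) (G g x))"
    using comp_on_comp[OF assms(1) comp_on_pfst[OF comp_on_id]] by (intro comp_intros assms)
  moreover have "rec_nat 0 (\<lambda>m r. r + a) n = a * n" for a n :: nat by (induction n) simp_all
  ultimately show ?thesis by simp
qed

text \<open>The recursion runs for zero or one step, according to the characteristic value. Both
  branches have to be total on \<open>D\<close>; where each one is total only in its own case,
  \<open>universal_functional\<close> does the branching instead.\<close>

lemma comp_on_if [comp_intros]:
  assumes "dec_on D P" "comp_on D F" "comp_on D G"
  shows "comp_on D (\<lambda>g x. if P g x then F g x else G g x)"
proof -
  have "comp_on D (\<lambda>g x. rec_nat (G g x) (\<lambda>m r. F g x) (if P g x then 1 else 0))"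
    using comp_on_comp[OF assms(2) comp_on_pfst[OF comp_on_id]] assms(1)
    by (intro comp_on_rec_nat assms(3)) (simp_all add: dec_on_def)
  moreover have "rec_nat b (\<lambda>m r. a) (if P g x then 1 else 0) = (if P g x then a else b)"
    for a b :: nat and g x by simp
  ultimately show ?thesis by simp
qed

section \<open>Decidable predicates, bounded quantifiers and unbounded search\<close>

lemma dec_on_comp: "dec_on D P \<Longrightarrow> comp_on D G \<Longrightarrow> dec_on D (\<lambda>g x. P g (G g x))"
  unfolding dec_on_def by (rule comp_on_comp)

lemma dec_on_eq_0: "comp_on D F \<Longrightarrow> dec_on D (\<lambda>g x. F g x = 0)"
proof -
  assume F: "comp_on D F"
  have "comp_on D (\<lambda>g x. 1 - F g x)" by (intro comp_intros F)
  moreover have "1 - n = (if n = 0 then 1 else 0)" for n :: nat by simp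
  ultimately show ?thesis unfolding dec_on_def by simp
qed

lemma dec_on_const [comp_intros]: "dec_on D (\<lambda>g x. b)"
  unfolding dec_on_def by (rule comp_on_const)

lemma dec_on_not [comp_intros]: "dec_on D P \<Longrightarrow> dec_on D (\<lambda>g x. \<not> P g x)"
proof -
  assume "dec_on D P"
  then have "dec_on D (\<lambda>g x. (if P g x then 1 else 0 :: nat) = 0)"
    unfolding dec_on_def[of D P] by (rule dec_on_eq_0)
  then show ?thesis by (rule dec_on_cong[THEN iffD1, rotated]) simp
qed

lemma dec_on_conj [comp_intros]:
  assumes "dec_on D P" "dec_on D Q" shows "dec_on D (\<lambda>g x. P g x \<and> Q g x)"
proof -
  have "comp_on D (\<lambda>g x. if P g x then (if Q g x then 1 else 0) else 0)"
    by (intro comp_intros assms)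
  then show ?thesis unfolding dec_on_def by (rule comp_on_cong[THEN iffD1, rotated]) simp
qed

lemma dec_on_disj [comp_intros]:
  assumes "dec_on D P" "dec_on D Q" shows "dec_on D (\<lambda>g x. P g x \<or> Q g x)"
proof -
  have "dec_on D (\<lambda>g x. \<not> (\<not> P g x \<and> \<not> Q g x))" by (intro comp_intros assms)
  then show ?thesis by simp
qed

lemma dec_on_imp [comp_intros]:
  assumes "dec_on D P" "dec_on D Q" shows "dec_on D (\<lambda>g x. P g x \<longrightarrow> Q g x)"
proof -
  have "dec_on D (\<lambda>g x. \<not> P g x \<or> Q g x)" by (intro comp_intros assms)
  then show ?thesis by (rule dec_on_cong[THEN iffD1, rotated]) blast
qed

lemma dec_on_le [comp_intros]:
  assumes "comp_on D F" "comp_on D G" shows "dec_on D (\<lambda>g x. F g x \<le> G g x)"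
proof -
  have "dec_on D (\<lambda>g x. F g x - G g x = 0)" by (intro comp_intros dec_on_eq_0 assms)
  then show ?thesis by simp
qed

lemma dec_on_less [comp_intros]:
  assumes "comp_on D F" "comp_on D G" shows "dec_on D (\<lambda>g x. F g x < G g x)"
proof -
  have "dec_on D (\<lambda>g x. \<not> G g x \<le> F g x)" by (intro comp_intros assms)
  then show ?thesis by (simp add: not_le)
qed

lemma dec_on_eq [comp_intros]:
  assumes "comp_on D F" "comp_on D G" shows "dec_on D (\<lambda>g x. F g x = G g x)"
proof -
  have "dec_on D (\<lambda>g x. F g x \<le> G g x \<and> G g x \<le> F g x)" by (intro comp_intros assms)
  then show ?thesis by (simp add: order_eq_iff)
qed

lemma dec_on_Bex [comp_intros]:
  assumes "dec_on D (\<lambda>g z. P g (pfst z) (psnd z))" "comp_on D N"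
  shows "dec_on D (\<lambda>g x. \<exists>i<N g x. P g x i)"
proof -
  have "comp_on D (\<lambda>g x. rec_nat 0 (\<lambda>m r. if P g x m then 1 else r) (N g x))"
    using dec_on_comp[OF assms(1) comp_on_pair[OF comp_on_pfst[OF comp_on_id]
        comp_on_pfst[OF comp_on_psnd[OF comp_on_id]]]]
    by (intro comp_intros assms(2)) simp
  moreover have "rec_nat 0 (\<lambda>m r. if Q m then 1 else r) n = (if \<exists>i<n. Q i then 1 else 0 :: nat)"
    for Q and n :: nat
    by (induction n) (auto simp: less_Suc_eq)
  ultimately show ?thesis unfolding dec_on_def by simp
qed

lemma dec_on_Ball [comp_intros]:
  assumes "dec_on D (\<lambda>g z. P g (pfst z) (psnd z))" "comp_on D N"
  shows "dec_on D (\<lambda>g x. \<forall>i<N g x. P g x i)"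
proof -
  have "dec_on D (\<lambda>g x. \<not> (\<exists>i<N g x. \<not> P g x i))" by (intro comp_intros assms)
  then show ?thesis by simp
qed

lemma dec_on_Bex_le [comp_intros]:
  assumes "dec_on D (\<lambda>g z. P g (pfst z) (psnd z))" "comp_on D N"
  shows "dec_on D (\<lambda>g x. \<exists>i\<le>N g x. P g x i)"
proof -
  have "dec_on D (\<lambda>g x. \<exists>i<Suc (N g x). P g x i)" by (intro comp_intros assms)
  then show ?thesis by (simp add: less_Suc_eq_le)
qed

lemma comp_on_Least [comp_intros]:
  assumes "dec_on D (\<lambda>g z. P g (pfst z) (psnd z))" "\<And>g x. g \<in> D \<Longrightarrow> \<exists>n. P g x n"
  shows "comp_on D (\<lambda>g x. LEAST n. P g x n)"
proof -
  \<comment> \<open>\<open>Mu\<close> looks for the value 0 and needs defined positive values before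
    it, hence the inverted characteristic function.\<close>
  have "comp_on D (\<lambda>g z. if P g (pfst z) (psnd z) then 0 else Suc 0)" by (intro comp_intros assms)
  then obtain p where p: "\<forall>g\<in>D. \<forall>z. run g p z = Some (if P g (pfst z) (psnd z) then 0 else Suc 0)"
    unfolding comp_on_def by blast
  have "run g (Mu p) x = Some (LEAST n. P g x n)" if g: "g \<in> D" for g x
  proof -
    let ?n = "LEAST n. P g x n"
    have run_p: "run g p (npair x n) = Some (if P g x n then 0 else Suc 0)" for n
      using p g by simp
    have "P g x ?n" using assms(2)[OF g] by (rule LeastI_ex)
    then have "run g p (npair x ?n) = Some 0" using run_p by simp
    moreover have "\<exists>k. run g p (npair x m) = Some (Suc k)" if "m < ?n" for m
      using run_p[of m] not_less_Least[OF that] by simp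
    ultimately have "\<exists>n. run g p (npair x n) = Some 0 \<and>
      (\<forall>m<n. \<exists>k. run g p (npair x m) = Some (Suc k))"
      by blast
    moreover have "run g p (npair x n) = Some 0 \<longleftrightarrow> P g x n" for n using run_p by simp
    ultimately show ?thesis by simp
  qed
  then show ?thesis unfolding comp_on_def by blast
qed

section \<open>Replacing the oracle and patching finitely many values\<close>

lemma comp_on_subst:
  assumes F: "comp_on E F" and H: "comp_on D H" and DE: "\<And>g. g \<in> D \<Longrightarrow> H g \<in> E"
    and G: "comp_on D G"
  shows "comp_on D (\<lambda>g x. F (H g) (G g x))"
proof -
  obtain p d where p: "\<forall>g\<in>E. \<forall>x. run g p x = Some (F g x)"
    and d: "\<forall>g\<in>D. \<forall>x. run g d x = Some (H g x)"
    using F H unfolding comp_on_def by blast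
  have "run g (oracle_subst d p) = run (H g) p" if "g \<in> D" for g
    using d that by (intro run_oracle_subst) blast
  then have "comp_on D (\<lambda>g x. F (H g) x)"
    unfolding comp_on_def using p DE by (intro exI[of _ "oracle_subst d p"]) simp
  from comp_on_comp[OF this G] show ?thesis .
qed

lemma comp_on_fun_upd:
  assumes "comp_on D (\<lambda>g. f)" shows "comp_on D (\<lambda>g. f(a := b))"
proof -
  have "comp_on D (\<lambda>g x. if x = a then b else f x)"
    using comp_on_comp[OF assms comp_on_id] by (intro comp_intros)
  then show ?thesis by (simp add: fun_upd_def)
qed

text \<open>The finite table of new values is built into the program. No effective access to
  \<open>f'\<close> is involved, so index functions obtained by mere choice will still be
  computable.\<close>

lemma comp_on_finite_change:
  assumes "comp_on D (\<lambda>g. f)" "finite {x. f' x \<noteq> f x}" shows "comp_on D (\<lambda>g. f')"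
proof -
  have "finite S \<Longrightarrow> comp_on D (\<lambda>g x. if x \<in> S then f' x else f x)" for S
  proof (induction S rule: finite_induct)
    case empty
    then show ?case using assms(1) by simp
  next
    case (insert a S)
    have "(\<lambda>x. if x \<in> insert a S then f' x else f x) = (\<lambda>x. if x \<in> S then f' x else f x)(a := f' a)"
      by auto
    then show ?case using comp_on_fun_upd[OF insert.IH] by metis
  qed
  from this[OF assms(2)] show ?thesis by (rule comp_on_cong[THEN iffD1, rotated]) simp
qed

lemma comp_on_finite_support:
  assumes "finite {x. f x \<noteq> c}" shows "comp_on D (\<lambda>g. f)"
  by (rule comp_on_finite_change[OF comp_on_const assms])

lemma dec_on_finite:
  assumes "finite S" shows "dec_on D (\<lambda>g x. x \<in> S)"
  unfolding dec_on_def by (rule comp_on_finite_support[of _ 0]) (simp add: assms)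

lemma dec_on_cofinite:
  assumes "finite {x. \<not> P x}" shows "dec_on D (\<lambda>g. P)"
  unfolding dec_on_def by (rule comp_on_finite_support[of _ 1]) (simp add: assms)

lemma comp_on_div2 [comp_intros]:
  assumes "comp_on D F" shows "comp_on D (\<lambda>g x. F g x div 2)"
proof -
  have "comp_on D (\<lambda>g x. LEAST m. F g x < 2 * m + 2)"
    using comp_on_comp[OF assms comp_on_pfst[OF comp_on_id]]
    by (intro comp_intros) (simp, presburger)
  moreover have "(LEAST m. n < 2 * m + 2) = n div 2" for n :: nat
    by (rule Least_equality) auto
  ultimately show ?thesis by simp
qed

lemma dec_on_even [comp_intros]:
  assumes "comp_on D F" shows "dec_on D (\<lambda>g x. even (F g x))"
proof -
  have "dec_on D (\<lambda>g x. F g x = 2 * (F g x div 2))" by (intro comp_intros assms)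
  moreover have "n = 2 * (n div 2) \<longleftrightarrow> even n" for n :: nat by presburger
  ultimately show ?thesis by simp
qed

lemma comp_on_fcons [comp_intros]:
  assumes "comp_on D I" "comp_on D (\<lambda>g z. F g (pfst z) (psnd z))" "comp_on D N"
  shows "comp_on D (\<lambda>g x. (I g x \<frown> F g x) (N g x))"
  unfolding fcons_def by (intro comp_intros assms)

lemma comp_on_fjoin [comp_intros]:
  assumes F: "comp_on D (\<lambda>g z. F g (pfst z) (psnd z))" and G: "comp_on D (\<lambda>g z. G g (pfst z) (psnd z))"
    and N: "comp_on D N"
  shows "comp_on D (\<lambda>g x. fjoin (F g x) (G g x) (N g x))"
proof -
  have H: "comp_on D (\<lambda>g x. npair x (N g x div 2))" by (intro comp_intros N)
  show ?thesis unfolding fjoin_def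
    using comp_on_comp[OF F H] comp_on_comp[OF G H] by (intro comp_intros N) simp_all
qed

lemma fcons_simps [simp]: "(i \<frown> f) 0 = i" "(i \<frown> f) (Suc n) = f n"
  by (simp_all add: fcons_def)

lemma fjoin_simps [simp]: "fjoin f g (2 * n) = f n" "fjoin f g (Suc (2 * n)) = g n"
  by (simp_all add: fjoin_def)

subsection \<open>Reducibilities\<close>

lemma run_eq_Phi: "run g p = Phi (prog_num p) g"
  by (simp add: Phi_prog_num)

lemma turing_le_iff: "f \<le>\<^sub>T g \<longleftrightarrow> comp_on {g} (\<lambda>_. f)"
proof
  assume "f \<le>\<^sub>T g"
  then show "comp_on {g} (\<lambda>_. f)" unfolding turing_le_def comp_on_def Phi_def by blast
next
  assume "comp_on {g} (\<lambda>_. f)"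
  then obtain p where "\<forall>x. run g p x = Some (f x)" unfolding comp_on_def by blast
  then show "f \<le>\<^sub>T g" unfolding turing_le_def run_eq_Phi by blast
qed

lemma turing_leI: "comp_on D F \<Longrightarrow> g \<in> D \<Longrightarrow> F g = f \<Longrightarrow> f \<le>\<^sub>T g"
  unfolding turing_le_iff by (auto simp: comp_on_def)

lemma turing_refl: "f \<le>\<^sub>T f"
  by (rule turing_leI[where F = "\<lambda>g x. g x" and D = UNIV], intro comp_intros) simp_all

lemma turing_trans:
  assumes "f \<le>\<^sub>T g" "g \<le>\<^sub>T h" shows "f \<le>\<^sub>T h"
  using comp_on_subst[of "{g}" "\<lambda>_. f" "{h}" "\<lambda>_. g" "\<lambda>_ x. x"] assms
  unfolding turing_le_iff by (simp add: comp_on_id)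

lemma turing_join1: "f \<le>\<^sub>T fjoin f g"
  by (rule turing_leI[where F = "\<lambda>g x. g (2 * x)" and D = UNIV], intro comp_intros) simp_all

lemma turing_join2: "g \<le>\<^sub>T fjoin f g"
  by (rule turing_leI[where F = "\<lambda>g x. g (Suc (2 * x))" and D = UNIV], intro comp_intros) simp_all

lemma turing_join_least:
  assumes "f \<le>\<^sub>T h" "g \<le>\<^sub>T h" shows "fjoin f g \<le>\<^sub>T h"
proof -
  have c: "comp_on {h} (\<lambda>_. f)" "comp_on {h} (\<lambda>_. g)" using assms by (simp_all add: turing_le_iff)
  have "comp_on {h} (\<lambda>_ x. fjoin f g x)"
    using comp_on_comp[OF c(1) comp_on_psnd[OF comp_on_id]]
      comp_on_comp[OF c(2) comp_on_psnd[OF comp_on_id]] by (intro comp_intros)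
  then show ?thesis by (simp add: turing_le_iff)
qed

lemma turing_join_iff: "fjoin f g \<le>\<^sub>T h \<longleftrightarrow> f \<le>\<^sub>T h \<and> g \<le>\<^sub>T h"
proof
  assume "fjoin f g \<le>\<^sub>T h"
  then show "f \<le>\<^sub>T h \<and> g \<le>\<^sub>T h"
    using turing_trans[OF turing_join1[of f g], of h] turing_trans[OF turing_join2[of g f], of h] by blast
next
  assume "f \<le>\<^sub>T h \<and> g \<le>\<^sub>T h"
  then show "fjoin f g \<le>\<^sub>T h" using turing_join_least by blast
qed

text \<open>\<open>comp_on\<close> asks for one program for all oracles in its domain and leaves
  \<open>F\<close> free outside, which is exactly the uniformity of a Medvedev reduction; Turing
  reducibility is the case of a singleton domain.\<close>

lemma medvedev_le_iff: "medvedev_le X Y \<longleftrightarrow> (\<exists>F. comp_on Y F \<and> (\<forall>f\<in>Y. F f \<in> X))"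
proof
  assume "medvedev_le X Y"
  then obtain n where "\<forall>f\<in>Y. \<exists>h\<in>X. \<forall>x. run f (inv prog_num n) x = Some (h x)"
    unfolding medvedev_le_def Phi_in_def Phi_def by blast
  then obtain F where "\<forall>f\<in>Y. F f \<in> X \<and> (\<forall>x. run f (inv prog_num n) x = Some (F f x))" by metis
  then show "\<exists>F. comp_on Y F \<and> (\<forall>f\<in>Y. F f \<in> X)" unfolding comp_on_def by blast
next
  assume "\<exists>F. comp_on Y F \<and> (\<forall>f\<in>Y. F f \<in> X)"
  then obtain F p where F: "\<And>f. f \<in> Y \<Longrightarrow> F f \<in> X"
    and p: "\<And>f x. f \<in> Y \<Longrightarrow> run f p x = Some (F f x)"
    unfolding comp_on_def by blast
  have "\<forall>f\<in>Y. Phi_in (prog_num p) f X"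
  proof
    fix f assume f: "f \<in> Y"
    show "Phi_in (prog_num p) f X"
      unfolding Phi_in_def Phi_prog_num using p[OF f] F[OF f] by (intro bexI[of _ "F f"]) simp_all
  qed
  then show "medvedev_le X Y" unfolding medvedev_le_def by (rule exI)
qed

lemma medvedev_leI: "comp_on Y F \<Longrightarrow> (\<And>f. f \<in> Y \<Longrightarrow> F f \<in> X) \<Longrightarrow> medvedev_le X Y"
  unfolding medvedev_le_iff by (intro exI[of _ F]) simp

section \<open>Certificates of computations and a universal functional\<close>

text \<open>
  A fact \<open>R e x y\<close> says that program number \<open>e\<close> maps \<open>x\<close> to \<open>y\<close>. As every rule of the following
  definition refers to smaller programs, or to the same program and a smaller argument, a set of
  facts that justify each other can only contain true facts; no ordering has to be recorded.
\<close>

definition justifies ::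
  "(nat \<Rightarrow> nat \<Rightarrow> nat \<Rightarrow> bool) \<Rightarrow> (nat \<Rightarrow> nat) \<Rightarrow> nat \<Rightarrow> nat \<Rightarrow> nat \<Rightarrow> bool" where
  "justifies R g e x y \<longleftrightarrow>
     e = 0 \<and> y = 0 \<or> e = 1 \<and> y = Suc x \<or> e = 2 \<and> y = pfst x \<or> e = 3 \<and> y = psnd x \<or>
     e = 4 \<and> y = g x \<or>
     (\<exists>p q. e = 5 + 4 * npair p q \<and> (\<exists>a b. R p x a \<and> R q x b \<and> y = npair a b)) \<or>
     (\<exists>p q. e = 6 + 4 * npair p q \<and> (\<exists>a. R q x a \<and> R p a y)) \<or>
     (\<exists>p q. e = 7 + 4 * npair p q \<and>
        (psnd x = 0 \<and> R p (pfst x) y \<or>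
         (\<exists>b. psnd x \<noteq> 0 \<and> R e (npair (pfst x) (psnd x - 1)) b \<and>
              R q (npair (pfst x) (npair (psnd x - 1) b)) y))) \<or>
     (\<exists>p. e = 8 + 4 * p \<and> R p (npair x y) 0 \<and> (\<forall>m<y. \<exists>k. R p (npair x m) (Suc k)))"

lemma justifies_mono:
  assumes "justifies R g e x y" "\<And>e x y. R e x y \<Longrightarrow> R' e x y"
  shows "justifies R' g e x y"
proof -
  have "R e x y \<longrightarrow> R' e x y" for e x y using assms(2) by blast
  then have "justifies R g e x y \<longrightarrow> justifies R' g e x y"
    unfolding justifies_def by (intro imp_refl disj_mono ex_mono conj_mono all_mono imp_mono)
  then show ?thesis using assms(1) by blast
qed

lemma mult4_neq:
  "4 * a \<noteq> Suc (4 * b)" "4 * a \<noteq> Suc (Suc (4 * b))" "4 * a \<noteq> 3 + 4 * b"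
  "Suc (4 * b) \<noteq> 4 * a" "Suc (Suc (4 * b)) \<noteq> 4 * a" "3 + 4 * b \<noteq> 4 * a"
  for a b :: nat
  by presburger+

lemma justifies_Fork: "justifies R g (prog_num (Fork p q)) x y \<longleftrightarrow>
    (\<exists>a b. R (prog_num p) x a \<and> R (prog_num q) x b \<and> y = npair a b)"
  unfolding justifies_def by (auto simp: mult4_neq)

lemma justifies_Comp: "justifies R g (prog_num (Comp p q)) x y \<longleftrightarrow>
    (\<exists>a. R (prog_num q) x a \<and> R (prog_num p) a y)"
  unfolding justifies_def by (auto simp: mult4_neq)

lemma justifies_Prec: "justifies R g (prog_num (Prec p q)) x y \<longleftrightarrow>
    psnd x = 0 \<and> R (prog_num p) (pfst x) y \<or>
    (\<exists>b. psnd x \<noteq> 0 \<and> R (prog_num (Prec p q)) (npair (pfst x) (psnd x - 1)) b \<and>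
         R (prog_num q) (npair (pfst x) (npair (psnd x - 1) b)) y)"
  unfolding justifies_def by (auto simp: mult4_neq)

lemma justifies_Mu: "justifies R g (prog_num (Mu p)) x y \<longleftrightarrow>
    R (prog_num p) (npair x y) 0 \<and> (\<forall>m<y. \<exists>k. R (prog_num p) (npair x m) (Suc k))"
  unfolding justifies_def by (auto simp: mult4_neq)

lemmas justifies_prog = justifies_Fork justifies_Comp justifies_Prec justifies_Mu

lemma justified_sound:
  assumes R: "\<And>e x y. R e x y \<Longrightarrow> justifies R g e x y"
  shows "R (prog_num p) x y \<Longrightarrow> run g p x = Some y"
proof (induction p arbitrary: x y)
  case (Fork p q)
  then show ?case using R[OF Fork.prems] unfolding justifies_prog by auto
next
  case (Comp p q)
  then show ?case using R[OF Comp.prems] unfolding justifies_prog by auto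
next
  case (Prec p q)
  have "R (prog_num (Prec p q)) (npair a n) y \<Longrightarrow>
      rec_nat (run g p a) (\<lambda>m r. Option.bind r (\<lambda>b. run g q (npair a (npair m b)))) n = Some y"
    for a n y
  proof (induction n arbitrary: y)
    case 0
    then show ?case using R[OF 0] Prec.IH unfolding justifies_prog by simp
  next
    case (Suc n)
    then show ?case using R[OF Suc.prems] Prec.IH Suc.IH unfolding justifies_prog by auto
  qed
  from this[of "pfst x" "psnd x" y] show ?case using Prec.prems by (simp add: case_prod_beta)
next
  case (Mu p)
  have R0: "R (prog_num p) (npair x y) 0" and RS: "\<And>m. m < y \<Longrightarrow> \<exists>k. R (prog_num p) (npair x m) (Suc k)"
    using R[OF Mu.prems] unfolding justifies_prog by blast+
  have y0: "run g p (npair x y) = Some 0" using Mu.IH R0 by blast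
  have yS: "\<exists>k. run g p (npair x m) = Some (Suc k)" if "m < y" for m
    using Mu.IH RS[OF that] by blast
  have "(LEAST n. run g p (npair x n) = Some 0) = y"
  proof (rule Least_equality)
    fix n assume "run g p (npair x n) = Some 0"
    then show "y \<le> n" using yS[of n] by (cases "n < y") auto
  qed (rule y0)
  moreover have "\<exists>n. run g p (npair x n) = Some 0 \<and> (\<forall>m<n. \<exists>k. run g p (npair x m) = Some (Suc k))"
    using y0 yS by blast
  ultimately show ?case by simp
qed (use R in \<open>fastforce simp: justifies_def\<close>)+

definition justified_set :: "(nat \<Rightarrow> nat) \<Rightarrow> (nat \<times> nat \<times> nat) set \<Rightarrow> bool" where
  "justified_set g S \<longleftrightarrow>
     (\<forall>e x y. (e, x, y) \<in> S \<longrightarrow> justifies (\<lambda>e x y. (e, x, y) \<in> S) g e x y)"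

lemma justified_set_Union:
  assumes "\<And>S. S \<in> \<S> \<Longrightarrow> justified_set g S" shows "justified_set g (\<Union>\<S>)"
  unfolding justified_set_def
proof (intro allI impI)
  fix e x y assume "(e, x, y) \<in> \<Union>\<S>"
  then obtain S where S: "S \<in> \<S>" "(e, x, y) \<in> S" by blast
  then have "justifies (\<lambda>e x y. (e, x, y) \<in> S) g e x y"
    using assms unfolding justified_set_def by blast
  then show "justifies (\<lambda>e x y. (e, x, y) \<in> \<Union>\<S>) g e x y"
    by (rule justifies_mono) (use S in blast)
qed

lemma justified_set_Un:
  "justified_set g S \<Longrightarrow> justified_set g T \<Longrightarrow> justified_set g (S \<union> T)"
  using justified_set_Union[of "{S, T}" g] by auto

lemma justified_set_insert:
  assumes "justified_set g S" "justifies (\<lambda>e x y. (e, x, y) \<in> S) g e x y"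
  shows "justified_set g (insert (e, x, y) S)"
  unfolding justified_set_def
proof (intro allI impI)
  fix e' x' y' assume "(e', x', y') \<in> insert (e, x, y) S"
  then have "justifies (\<lambda>e x y. (e, x, y) \<in> S) g e' x' y'"
    using assms unfolding justified_set_def by blast
  then show "justifies (\<lambda>e' x' y'. (e', x', y') \<in> insert (e, x, y) S) g e' x' y'"
    by (rule justifies_mono) simp
qed

text \<open>Facts stay justified in larger sets, so the union of the sets for the subcomputations
  can be extended by the new fact. \<open>Mu\<close> needs one such set for every tested
  argument.\<close>

lemma justified_set_complete:
  "run g p x = Some y \<Longrightarrow> \<exists>S. finite S \<and> justified_set g S \<and> (prog_num p, x, y) \<in> S"
proof (induction p arbitrary: x y)
  case (Fork p q)
  from Fork.prems obtain a b where ab: "run g p x = Some a" "run g q x = Some b" "y = npair a b"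
    by (auto simp: bind_eq_Some_conv)
  obtain S T where S: "finite S" "justified_set g S" "(prog_num p, x, a) \<in> S"
    and T: "finite T" "justified_set g T" "(prog_num q, x, b) \<in> T"
    using Fork.IH(1)[OF ab(1)] Fork.IH(2)[OF ab(2)] by blast
  have "justified_set g (insert (prog_num (Fork p q), x, y) (S \<union> T))"
  proof (rule justified_set_insert[OF justified_set_Un[OF S(2) T(2)]])
    show "justifies (\<lambda>e x y. (e, x, y) \<in> S \<union> T) g (prog_num (Fork p q)) x y"
      unfolding justifies_prog using ab S T by (intro exI[of _ a] exI[of _ b]) simp
  qed
  then show ?case
    using S(1) T(1) by (intro exI[of _ "insert (prog_num (Fork p q), x, y) (S \<union> T)"]) simp
next
  case (Comp p q)
  from Comp.prems obtain a where ab: "run g q x = Some a" "run g p a = Some y"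
    by (auto simp: bind_eq_Some_conv)
  obtain S T where S: "finite S" "justified_set g S" "(prog_num p, a, y) \<in> S"
    and T: "finite T" "justified_set g T" "(prog_num q, x, a) \<in> T"
    using Comp.IH(1)[OF ab(2)] Comp.IH(2)[OF ab(1)] by blast
  have "justified_set g (insert (prog_num (Comp p q), x, y) (S \<union> T))"
  proof (rule justified_set_insert[OF justified_set_Un[OF S(2) T(2)]])
    show "justifies (\<lambda>e x y. (e, x, y) \<in> S \<union> T) g (prog_num (Comp p q)) x y"
      unfolding justifies_prog using ab S T by (intro exI[of _ a]) simp
  qed
  then show ?case
    using S(1) T(1) by (intro exI[of _ "insert (prog_num (Comp p q), x, y) (S \<union> T)"]) simp
next
  case (Prec p q)
  have "rec_nat (run g p a) (\<lambda>m r. Option.bind r (\<lambda>b. run g q (npair a (npair m b)))) n = Some y \<Longrightarrow>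
      \<exists>S. finite S \<and> justified_set g S \<and> (prog_num (Prec p q), npair a n, y) \<in> S" for a n y
  proof (induction n arbitrary: y)
    case 0
    then obtain S where S: "finite S" "justified_set g S" "(prog_num p, a, y) \<in> S"
      using Prec.IH(1)[of a y] by auto
    have "justified_set g (insert (prog_num (Prec p q), npair a 0, y) S)"
    proof (rule justified_set_insert[OF S(2)])
      show "justifies (\<lambda>e x y. (e, x, y) \<in> S) g (prog_num (Prec p q)) (npair a 0) y"
        unfolding justifies_prog using S by simp
    qed
    then show ?case
      using S(1) by (intro exI[of _ "insert (prog_num (Prec p q), npair a 0, y) S"]) simp
  next
    case (Suc n)
    from Suc.prems obtain b where
      b: "rec_nat (run g p a) (\<lambda>m r. Option.bind r (\<lambda>b. run g q (npair a (npair m b)))) n = Some b"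
        "run g q (npair a (npair n b)) = Some y"
      by (auto simp: bind_eq_Some_conv)
    obtain S T where S: "finite S" "justified_set g S" "(prog_num (Prec p q), npair a n, b) \<in> S"
      and T: "finite T" "justified_set g T" "(prog_num q, npair a (npair n b), y) \<in> T"
      using Suc.IH[OF b(1)] Prec.IH(2)[OF b(2)] by blast
    have "justified_set g (insert (prog_num (Prec p q), npair a (Suc n), y) (S \<union> T))"
    proof (rule justified_set_insert[OF justified_set_Un[OF S(2) T(2)]])
      show "justifies (\<lambda>e x y. (e, x, y) \<in> S \<union> T) g (prog_num (Prec p q)) (npair a (Suc n)) y"
        unfolding justifies_prog using S T by (intro disjI2 exI[of _ b]) (simp del: prog_num.simps)
    qed
    then show ?case
      using S(1) T(1)
      by (intro exI[of _ "insert (prog_num (Prec p q), npair a (Suc n), y) (S \<union> T)"]) simp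
  qed
  from this[of "pfst x" "psnd x" y] show ?case using Prec.prems by (simp add: case_prod_beta)
next
  case (Mu p)
  let ?P = "\<lambda>n. run g p (npair x n) = Some 0 \<and> (\<forall>m<n. \<exists>k. run g p (npair x m) = Some (Suc k))"
  from Mu.prems obtain n where n: "?P n" and y: "y = (LEAST n. run g p (npair x n) = Some 0)"
    by (auto split: if_splits)
  have "y = n" unfolding y
  proof (rule Least_equality)
    fix m assume "run g p (npair x m) = Some 0"
    then show "n \<le> m" using n by (cases "m < n") auto
  qed (use n in simp)
  with n have n: "?P y" by simp
  have "\<exists>S. finite S \<and> justified_set g S \<and> (\<exists>k. (prog_num p, npair x m, Suc k) \<in> S)" if m: "m < y" for m
  proof -
    obtain k where "run g p (npair x m) = Some (Suc k)" using n m by blast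
    from Mu.IH[OF this] show ?thesis by blast
  qed
  then have "\<exists>S. \<forall>m<y. finite (S m) \<and> justified_set g (S m) \<and> (\<exists>k. (prog_num p, npair x m, Suc k) \<in> S m)"
    by (intro choice) blast
  then obtain S where S: "\<And>m. m < y \<Longrightarrow> finite (S m) \<and> justified_set g (S m) \<and>
      (\<exists>k. (prog_num p, npair x m, Suc k) \<in> S m)"
    by blast
  obtain T where T: "finite T" "justified_set g T" "(prog_num p, npair x y, 0) \<in> T"
    using Mu.IH[of "npair x y" 0] n by blast
  let ?U = "\<Union>(insert T (S ` {..<y}))"
  have fin: "finite ?U" using T(1) S by auto
  have "justified_set g ?U" by (rule justified_set_Union) (use T S in auto)
  then have "justified_set g (insert (prog_num (Mu p), x, y) ?U)"
  proof (rule justified_set_insert)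
    have "\<exists>k. (prog_num p, npair x m, Suc k) \<in> ?U" if "m < y" for m
      using S[OF that] that by blast
    then show "justifies (\<lambda>e x y. (e, x, y) \<in> ?U) g (prog_num (Mu p)) x y"
      unfolding justifies_prog using T(3) by blast
  qed
  then show ?case
    using fin by (intro exI[of _ "insert (prog_num (Mu p), x, y) ?U"]) simp
next
  case Zero
  then show ?case
    by (intro exI[of _ "{(prog_num Zero, x, y)}"]) (auto simp: justified_set_def justifies_def)
next
  case Succ
  then show ?case
    by (intro exI[of _ "{(prog_num Succ, x, y)}"]) (auto simp: justified_set_def justifies_def)
next
  case Left
  then show ?case
    by (intro exI[of _ "{(prog_num Left, x, y)}"]) (auto simp: justified_set_def justifies_def)
next
  case Right
  then show ?case
    by (intro exI[of _ "{(prog_num Right, x, y)}"]) (auto simp: justified_set_def justifies_def)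
next
  case Oracle
  then show ?case
    by (intro exI[of _ "{(prog_num Oracle, x, y)}"]) (auto simp: justified_set_def justifies_def)
qed

subsection \<open>Numerical codes of certificates\<close>

text \<open>Lists are coded by pairs nested to the right. The code has no end marker; where a length
  matters it is stored next to it.\<close>

definition snth :: "nat \<Rightarrow> nat \<Rightarrow> nat" where
  "snth s i = pfst (rec_nat s (\<lambda>m r. psnd r) i)"

lemma comp_on_snth [comp_intros]:
  assumes "comp_on D F" "comp_on D G" shows "comp_on D (\<lambda>g x. snth (F g x) (G g x))"
  unfolding snth_def by (intro comp_intros assms)

lemma snth_le: "snth s i \<le> s"
proof -
  have *: "pfst z \<le> z" "psnd z \<le> z" for z
    using le_prod_encode_1[of "pfst z" "psnd z"] le_prod_encode_2[of "psnd z" "pfst z"] by simp_all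
  have "rec_nat s (\<lambda>m r. psnd r) i \<le> s"
  proof (induction i)
    case (Suc i)
    then show ?case using *(2)[of "rec_nat s (\<lambda>m r. psnd r) i"] by simp
  qed simp
  then show ?thesis unfolding snth_def using *(1) le_trans by blast
qed

lemma snth_exists: "\<exists>s. \<forall>i<length xs. snth s i = xs ! i"
proof (induction xs)
  case (Cons x xs)
  then obtain s where s: "\<And>i. i < length xs \<Longrightarrow> snth s i = xs ! i" by blast
  have shift: "rec_nat (npair x s) (\<lambda>m r. psnd r) (Suc i) = rec_nat s (\<lambda>m r. psnd r) i" for i
    by (induction i) simp_all
  have "snth (npair x s) i = (x # xs) ! i" if "i < length (x # xs)" for i
  proof (cases i)
    case (Suc j)
    have "snth (npair x s) (Suc j) = snth s j" unfolding snth_def shift ..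
    then show ?thesis using s[of j] that Suc by simp
  qed (simp add: snth_def)
  then show ?case by blast
qed simp

definition fact_in :: "nat \<Rightarrow> nat \<Rightarrow> nat \<Rightarrow> nat \<Rightarrow> bool" where
  "fact_in c e x y \<longleftrightarrow> (\<exists>i<pfst c. snth (psnd c) i = npair e (npair x y))"

text \<open>A list entry does not exceed the code of its list. This supplies the bounds that make
  the check of a certificate decidable, and the bound on the oracle queries made by it.\<close>

lemma fact_in_le: assumes "fact_in c e x y" shows "e \<le> c" "x \<le> c" "y \<le> c"
proof -
  have "psnd c \<le> c" using le_prod_encode_2[of "psnd c" "pfst c"] by simp
  moreover obtain i where "snth (psnd c) i = npair e (npair x y)"
    using assms unfolding fact_in_def by blast
  ultimately have c: "npair e (npair x y) \<le> c" using snth_le[of "psnd c" i] by simp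
  show "e \<le> c" using c le_prod_encode_1[of e "npair x y"] by linarith
  have "npair x y \<le> c" using c le_prod_encode_2[of "npair x y" e] by linarith
  then show "x \<le> c" "y \<le> c"
    using le_prod_encode_1[of x y] le_prod_encode_2[of y x] by linarith+
qed

lemma fact_in_exists:
  assumes "finite S" shows "\<exists>c. \<forall>e x y. fact_in c e x y \<longleftrightarrow> (e, x, y) \<in> S"
proof -
  obtain xs where xs: "set xs = (\<lambda>(e, x, y). npair e (npair x y)) ` S"
    by (rule exE[OF finite_list[OF finite_imageI[OF assms]]])
  obtain s where s: "\<forall>i<length xs. snth s i = xs ! i" using snth_exists by blast
  have "fact_in (npair (length xs) s) e x y \<longleftrightarrow> npair e (npair x y) \<in> set xs" for e x y
    unfolding fact_in_def by (auto simp: in_set_conv_nth s)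
  moreover have "npair e (npair x y) \<in> set xs \<longleftrightarrow> (e, x, y) \<in> S" for e x y
    unfolding xs by (force simp: image_iff)
  ultimately show ?thesis by blast
qed

definition cert :: "(nat \<Rightarrow> nat) \<Rightarrow> nat \<Rightarrow> bool" where
  "cert g c \<longleftrightarrow> (\<forall>e x y. fact_in c e x y \<longrightarrow> justifies (fact_in c) g e x y)"

lemma cert_sound: "cert g c \<Longrightarrow> fact_in c (prog_num p) x y \<Longrightarrow> run g p x = Some y"
  by (rule justified_sound[of "fact_in c"]) (simp_all add: cert_def)

lemma cert_complete:
  assumes "run g p x = Some y" shows "\<exists>c. cert g c \<and> fact_in c (prog_num p) x y"
proof -
  obtain S where S: "finite S" "justified_set g S" "(prog_num p, x, y) \<in> S"
    using justified_set_complete[OF assms] by blast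
  obtain c where c: "\<And>e x y. fact_in c e x y \<longleftrightarrow> (e, x, y) \<in> S" using fact_in_exists[OF S(1)] by blast
  have "fact_in c = (\<lambda>e x y. (e, x, y) \<in> S)" using c by blast
  then show ?thesis using S(2,3) unfolding cert_def justified_set_def by (intro exI[of _ c]) simp
qed

text \<open>The use principle: an oracle query at \<open>x\<close> is itself a fact in
  \<open>c\<close>, so \<open>x \<le> c\<close>.\<close>

lemma cert_use:
  assumes "cert g c" "\<And>x. x \<le> c \<Longrightarrow> g' x = g x" shows "cert g' c"
  unfolding cert_def
proof (intro allI impI)
  fix e x y assume c: "fact_in c e x y"
  have "justifies (fact_in c) g e x y" using assms(1) c unfolding cert_def by blast
  then show "justifies (fact_in c) g' e x y"
    unfolding justifies_def using assms(2)[OF fact_in_le(2)[OF c]] by simp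
qed

lemma justifies_bounded:
  "justifies (fact_in c) g e x y \<longleftrightarrow>
     e = 0 \<and> y = 0 \<or> e = 1 \<and> y = Suc x \<or> e = 2 \<and> y = pfst x \<or> e = 3 \<and> y = psnd x \<or>
     e = 4 \<and> y = g x \<or>
     (\<exists>p\<le>c. \<exists>q\<le>c. e = 5 + 4 * npair p q \<and>
        (\<exists>a\<le>c. \<exists>b\<le>c. fact_in c p x a \<and> fact_in c q x b \<and> y = npair a b)) \<or>
     (\<exists>p\<le>c. \<exists>q\<le>c. e = 6 + 4 * npair p q \<and> (\<exists>a\<le>c. fact_in c q x a \<and> fact_in c p a y)) \<or>
     (\<exists>p\<le>e. \<exists>q\<le>e. e = 7 + 4 * npair p q \<and>
        (psnd x = 0 \<and> fact_in c p (pfst x) y \<or>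
         (\<exists>b\<le>c. psnd x \<noteq> 0 \<and> fact_in c e (npair (pfst x) (psnd x - 1)) b \<and>
              fact_in c q (npair (pfst x) (npair (psnd x - 1) b)) y))) \<or>
     (\<exists>p\<le>c. e = 8 + 4 * p \<and> fact_in c p (npair x y) 0 \<and>
        (\<forall>m<y. \<exists>k\<le>c. fact_in c p (npair x m) (Suc k)))"
proof -
  have 1: "(\<exists>p q. e = 5 + 4 * npair p q \<and> (\<exists>a b. fact_in c p x a \<and> fact_in c q x b \<and> y = npair a b)) \<longleftrightarrow>
    (\<exists>p\<le>c. \<exists>q\<le>c. e = 5 + 4 * npair p q \<and>
        (\<exists>a\<le>c. \<exists>b\<le>c. fact_in c p x a \<and> fact_in c q x b \<and> y = npair a b))"
    using fact_in_le by blast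
  have 2: "(\<exists>p q. e = 6 + 4 * npair p q \<and> (\<exists>a. fact_in c q x a \<and> fact_in c p a y)) \<longleftrightarrow>
    (\<exists>p\<le>c. \<exists>q\<le>c. e = 6 + 4 * npair p q \<and> (\<exists>a\<le>c. fact_in c q x a \<and> fact_in c p a y))"
    using fact_in_le by blast
  \<comment> \<open>Depending on whether the counter is zero, only one of the two subprograms occurs
    in a fact; their numbers are therefore bounded through \<open>e\<close> instead of
    \<open>c\<close>.\<close>
  have le: "p \<le> e \<and> q \<le> e" if "e = 7 + 4 * npair p q" for p q
    using that le_prod_encode_1[of p q] le_prod_encode_2[of q p] by linarith
  have 3: "(\<exists>p q. e = 7 + 4 * npair p q \<and>
        (psnd x = 0 \<and> fact_in c p (pfst x) y \<or>
         (\<exists>b. psnd x \<noteq> 0 \<and> fact_in c e (npair (pfst x) (psnd x - 1)) b \<and>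
              fact_in c q (npair (pfst x) (npair (psnd x - 1) b)) y))) \<longleftrightarrow>
    (\<exists>p\<le>e. \<exists>q\<le>e. e = 7 + 4 * npair p q \<and>
        (psnd x = 0 \<and> fact_in c p (pfst x) y \<or>
         (\<exists>b\<le>c. psnd x \<noteq> 0 \<and> fact_in c e (npair (pfst x) (psnd x - 1)) b \<and>
              fact_in c q (npair (pfst x) (npair (psnd x - 1) b)) y)))"
    using fact_in_le(3) le by blast
  have 4: "(\<exists>k. fact_in c p z (Suc k)) \<longleftrightarrow> (\<exists>k\<le>c. fact_in c p z (Suc k))" for p z
    using fact_in_le(3) Suc_leD by blast
  have 5: "(\<exists>p. e = 8 + 4 * p \<and> fact_in c p (npair x y) 0 \<and> (\<forall>m<y. \<exists>k. fact_in c p (npair x m) (Suc k))) \<longleftrightarrow>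
    (\<exists>p\<le>c. e = 8 + 4 * p \<and> fact_in c p (npair x y) 0 \<and>
        (\<forall>m<y. \<exists>k\<le>c. fact_in c p (npair x m) (Suc k)))"
    unfolding 4 using fact_in_le(1) by blast
  show ?thesis unfolding justifies_def 1 2 3 5 ..
qed

lemma dec_on_fact_in [comp_intros]:
  assumes "comp_on D C" "comp_on D E" "comp_on D X" "comp_on D Y"
  shows "dec_on D (\<lambda>g x. fact_in (C g x) (E g x) (X g x) (Y g x))"
proof -
  note sub = comp_on_comp[OF _ comp_on_pfst[OF comp_on_id]]
  show ?thesis unfolding fact_in_def
    by (intro comp_intros assms sub[OF assms(1)] sub[OF assms(2)] sub[OF assms(3)] sub[OF assms(4)])
qed

text \<open>Running through the positions of the list turns the three unbounded quantifiers of
  \<open>cert\<close> into one bounded quantifier.\<close>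

lemma cert_bounded:
  "cert g c \<longleftrightarrow> (\<forall>i<pfst c. justifies (fact_in c) g (pfst (snth (psnd c) i))
     (pfst (psnd (snth (psnd c) i))) (psnd (psnd (snth (psnd c) i))))"
proof -
  define t where "t i = snth (psnd c) i" for i
  have t: "fact_in c e x y \<longleftrightarrow> (\<exists>i<pfst c. t i = npair e (npair x y))" for e x y
    unfolding fact_in_def t_def ..
  have "(\<forall>e x y. fact_in c e x y \<longrightarrow> J e x y) \<longleftrightarrow>
      (\<forall>i<pfst c. J (pfst (t i)) (pfst (psnd (t i))) (psnd (psnd (t i))))" for J
  proof (intro iffI allI impI)
    fix i assume J: "\<forall>e x y. fact_in c e x y \<longrightarrow> J e x y" and i: "i < pfst c"
    have "fact_in c (pfst (t i)) (pfst (psnd (t i))) (psnd (psnd (t i)))"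
      unfolding t using i by auto
    then show "J (pfst (t i)) (pfst (psnd (t i))) (psnd (psnd (t i)))" using J by blast
  next
    fix e x y assume J: "\<forall>i<pfst c. J (pfst (t i)) (pfst (psnd (t i))) (psnd (psnd (t i)))"
      and "fact_in c e x y"
    then obtain i where i: "i < pfst c" "t i = npair e (npair x y)" unfolding t by blast
    show "J e x y" using J[rule_format, OF i(1)] i(2) by simp
  qed
  then show ?thesis unfolding cert_def t_def by blast
qed

lemma dec_on_cert [comp_intros]:
  assumes H: "comp_on D (\<lambda>g z. H g (pfst z) (psnd z))" and C: "comp_on D C"
  shows "dec_on D (\<lambda>g x. cert (H g x) (C g x))"
proof -
  have H': "comp_on D (\<lambda>g z. H g (A g z) (B g z))" if "comp_on D A" "comp_on D B" for A B
    using comp_on_comp[OF H comp_on_pair[OF that]] by simp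
  note C' = comp_on_comp[OF C]
  show ?thesis unfolding cert_bounded justifies_bounded
    by (intro comp_intros C C' H')
qed

section \<open>Evaluation of a program given by its number\<close>

definition total_fun :: "nat \<Rightarrow> (nat \<Rightarrow> nat) \<Rightarrow> bool" where
  "total_fun n g \<longleftrightarrow> (\<forall>x. \<exists>y. Phi n g x = Some y)"

lemma Phi_cert: "Phi n g x = Some y \<longleftrightarrow> (\<exists>c. cert g c \<and> fact_in c n x y)"
proof -
  have "prog_num (inv prog_num n) = n" using surj_prog_num by (metis f_inv_into_f rangeI)
  then show ?thesis
    using cert_sound[of g _ "inv prog_num n" x y] cert_complete[of g "inv prog_num n" x y]
    unfolding Phi_def by auto
qed

text \<open>The oracle \<open>u\<close> carries a program number in front of the actual oracle. One
  search finds a certificate with an output for \<open>x\<close>; a second search extracts this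
  output.\<close>

theorem universal_functional:
  "comp_on {u. total_fun (u 0) (\<lambda>i. u (Suc i))} (\<lambda>u x. the (Phi (u 0) (\<lambda>i. u (Suc i)) x))"
proof -
  let ?D = "{u. total_fun (u 0) (\<lambda>i. u (Suc i))}"
  let ?P = "\<lambda>u x c. cert (\<lambda>i. u (Suc i)) c \<and> (\<exists>y\<le>c. fact_in c (u 0) x y)"
  have ex: "\<exists>c. ?P u x c" if u: "u \<in> ?D" for u x
  proof -
    obtain y where "Phi (u 0) (\<lambda>i. u (Suc i)) x = Some y" using u unfolding total_fun_def by blast
    then show ?thesis unfolding Phi_cert using fact_in_le(3) by blast
  qed
  have ex2: "\<exists>y. fact_in (LEAST c. ?P u x c) (u 0) x y" if "u \<in> ?D" for u x
    using LeastI_ex[OF ex[OF that]] by blast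
  have "comp_on ?D (\<lambda>u x. LEAST y. fact_in (LEAST c. ?P u x c) (u 0) x y)"
    by (intro comp_intros ex ex2)
  moreover have "the (Phi (u 0) (\<lambda>i. u (Suc i)) x) = (LEAST y. fact_in (LEAST c. ?P u x c) (u 0) x y)"
    if "u \<in> ?D" for u x
  proof -
    have "cert (\<lambda>i. u (Suc i)) (LEAST c. ?P u x c)" using LeastI_ex[OF ex[OF that]] by blast
    moreover have "fact_in (LEAST c. ?P u x c) (u 0) x (LEAST y. fact_in (LEAST c. ?P u x c) (u 0) x y)"
      using LeastI_ex[OF ex2[OF that]] .
    ultimately have "Phi (u 0) (\<lambda>i. u (Suc i)) x = Some (LEAST y. fact_in (LEAST c. ?P u x c) (u 0) x y)"
      unfolding Phi_cert by blast
    then show ?thesis by simp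
  qed
  ultimately show ?thesis using comp_on_cong by (metis (no_types, lifting))
qed

section \<open>The Medvedev lattice is a Brouwer algebra\<close>

lemma fun_of_fcons: "f = f 0 \<frown> (\<lambda>n. f (Suc n))"
  by (rule ext) (simp add: fcons_def split: nat.split)

lemma mass_join_least:
  assumes "medvedev_le X Z" "medvedev_le Y Z" shows "medvedev_le (mass_join X Y) Z"
proof -
  obtain F G where F: "comp_on Z F" "\<forall>f\<in>Z. F f \<in> X" and G: "comp_on Z G" "\<forall>f\<in>Z. G f \<in> Y"
    using assms unfolding medvedev_le_iff by blast
  show ?thesis
  proof (rule medvedev_leI)
    note c = comp_on_comp[OF _ comp_on_psnd[OF comp_on_id]]
    show "comp_on Z (\<lambda>f x. fjoin (F f) (G f) x)" by (intro comp_intros c F G)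
    show "fjoin (F f) (G f) \<in> mass_join X Y" if "f \<in> Z" for f
      unfolding mass_join_def using F G that by blast
  qed
qed

lemma mass_join_upper1: "medvedev_le X (mass_join X Y)"
proof (rule medvedev_leI)
  show "comp_on (mass_join X Y) (\<lambda>f x. f (2 * x))" by (intro comp_intros)
qed (auto simp: mass_join_def)

lemma mass_join_upper2: "medvedev_le Y (mass_join X Y)"
proof (rule medvedev_leI)
  show "comp_on (mass_join X Y) (\<lambda>f x. f (Suc (2 * x)))" by (intro comp_intros)
qed (auto simp: mass_join_def)

lemma mass_join_le_iff:
  "medvedev_le (mass_join X Y) Z \<longleftrightarrow> medvedev_le X Z \<and> medvedev_le Y Z"
  using mass_join_least mass_join_upper1 mass_join_upper2 medvedev_le_trans by metis

lemma mass_meet_greatest: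
  assumes "medvedev_le Z X" "medvedev_le Z Y" shows "medvedev_le Z (mass_meet X Y)"
proof -
  obtain F G where F: "comp_on X F" "\<forall>f\<in>X. F f \<in> Z" and G: "comp_on Y G" "\<forall>f\<in>Y. G f \<in> Z"
    using assms unfolding medvedev_le_iff by blast
  obtain p q where p: "\<And>f x. f \<in> X \<Longrightarrow> run f p x = Some (F f x)"
    and q: "\<And>f x. f \<in> Y \<Longrightarrow> run f q x = Some (G f x)"
    using F(1) G(1) unfolding comp_on_def by blast
  \<comment> \<open>The universal functional turns the selection of a program by the first value of the oracle
    into the selection of a number.\<close>
  let ?n = "\<lambda>f::nat \<Rightarrow> nat. if f 0 = 0 then prog_num p else prog_num q"
  let ?F = "\<lambda>u::nat \<Rightarrow> nat. (\<lambda>x. the (Phi (u 0) (\<lambda>i. u (Suc i)) x))"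
  have run: "Phi (?n h) (\<lambda>i. h (Suc i)) = (\<lambda>x. Some (if h 0 = 0 then F (\<lambda>i. h (Suc i)) x else G (\<lambda>i. h (Suc i)) x))"
    if "h \<in> mass_meet X Y" for h
    using that p q unfolding mass_meet_def by (auto simp: Phi_prog_num)
  show ?thesis
  proof (rule medvedev_leI)
    let ?H = "\<lambda>h::nat \<Rightarrow> nat. ?n h \<frown> (\<lambda>i. h (Suc i))"
    show "comp_on (mass_meet X Y) (\<lambda>h x. ?F (?H h) x)"
    proof (rule comp_on_subst[OF universal_functional])
      show "comp_on (mass_meet X Y) ?H" by (intro comp_intros)
      show "?H h \<in> {u. total_fun (u 0) (\<lambda>i. u (Suc i))}" if "h \<in> mass_meet X Y" for h
        using run[OF that] unfolding total_fun_def by simp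
    qed (intro comp_intros)
    show "?F (?H h) \<in> Z" if "h \<in> mass_meet X Y" for h
      using run[OF that] that F(2) G(2) unfolding mass_meet_def by auto
  qed
qed

lemma mass_meet_lower1: "medvedev_le (mass_meet X Y) X"
proof (rule medvedev_leI)
  show "comp_on X (\<lambda>f x. (0 \<frown> f) x)" by (intro comp_intros)
qed (auto simp: mass_meet_def)

lemma mass_meet_lower2: "medvedev_le (mass_meet X Y) Y"
proof (rule medvedev_leI)
  show "comp_on Y (\<lambda>f x. (1 \<frown> f) x)" by (intro comp_intros)
qed (auto simp: mass_meet_def)

lemma le_mass_meet_iff:
  "medvedev_le Z (mass_meet X Y) \<longleftrightarrow> medvedev_le Z X \<and> medvedev_le Z Y"
  using mass_meet_greatest mass_meet_lower1 mass_meet_lower2 medvedev_le_trans by metis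

lemma mass_imp_le:
  assumes "medvedev_le Y (mass_join X Z)" shows "medvedev_le (mass_imp X Y) Z"
proof -
  obtain F where F: "comp_on (mass_join X Z) F" "\<forall>f\<in>mass_join X Z. F f \<in> Y"
    using assms unfolding medvedev_le_iff by blast
  \<comment> \<open>\<open>mass_imp\<close> puts the argument from \<open>X\<close> second,
    \<open>mass_join X Z\<close> puts it first; \<open>?S\<close> exchanges the two halves.\<close>
  let ?S = "\<lambda>h x. (fjoin (\<lambda>i. h (Suc (2 * i))) (\<lambda>i. h (2 * i)) x :: nat)"
  have S: "?S (fjoin f g) = fjoin g f" for f g by simp
  have "comp_on {fjoin z x | z x. z \<in> Z \<and> x \<in> X} (\<lambda>h x. F (?S h) x)"
  proof (rule comp_on_subst[OF F(1)])
    show "comp_on {fjoin z x | z x. z \<in> Z \<and> x \<in> X} (\<lambda>h x. ?S h x)" by (intro comp_intros)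
    show "?S h \<in> mass_join X Z" if h: "h \<in> {fjoin z x | z x. z \<in> Z \<and> x \<in> X}" for h
    proof -
      obtain z x where "h = fjoin z x" "z \<in> Z" "x \<in> X" using h by blast
      then show ?thesis unfolding mass_join_def using S[of z x] by blast
    qed
  qed (rule comp_on_id)
  then obtain p where "\<forall>h\<in>{fjoin z x | z x. z \<in> Z \<and> x \<in> X}. \<forall>y. run h p y = Some (F (?S h) y)"
    unfolding comp_on_def by blast
  then have p: "run (fjoin z x) p y = Some (F (fjoin x z) y)" if "z \<in> Z" "x \<in> X" for z x y
    using that S[of z x] by fastforce
  have FY: "F (fjoin x z) \<in> Y" if "z \<in> Z" "x \<in> X" for z x
    using F(2) that unfolding mass_join_def by blast
  show ?thesis
  proof (rule medvedev_leI)
    show "comp_on Z (\<lambda>f x. (prog_num p \<frown> f) x)" by (intro comp_intros)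
    show "prog_num p \<frown> z \<in> mass_imp X Y" if z: "z \<in> Z" for z
    proof -
      have "Phi_in (prog_num p) (fjoin z x) Y" if "x \<in> X" for x
        unfolding Phi_in_def Phi_prog_num using p[OF z that] FY[OF z that]
        by (intro bexI[of _ "F (fjoin x z)"]) simp_all
      then show ?thesis unfolding mass_imp_def by blast
    qed
  qed
qed

lemma le_join_mass_imp: "medvedev_le Y (mass_join X (mass_imp X Y))"
proof (rule medvedev_leI)
  let ?F = "\<lambda>u::nat \<Rightarrow> nat. (\<lambda>x. the (Phi (u 0) (\<lambda>i. u (Suc i)) x))"
  \<comment> \<open>The oracle joins some x with n followed by f: position 1 holds n, the later odd
    positions hold f and the even ones x. The result has the input format of the universal
    functional, with the halves in the order used by \<open>mass_imp\<close>.\<close>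
  let ?H = "\<lambda>h::nat \<Rightarrow> nat. h 1 \<frown> fjoin (\<lambda>i. h (Suc (2 * Suc i))) (\<lambda>i. h (2 * i))"
  have H: "\<exists>g\<in>Y. \<forall>x. Phi (?H h 0) (\<lambda>i. ?H h (Suc i)) x = Some (g x)"
    if h: "h \<in> mass_join X (mass_imp X Y)" for h
  proof -
    obtain x n f where h: "h = fjoin x (n \<frown> f)" "x \<in> X" "Phi_in n (fjoin f x) Y"
      using h unfolding mass_join_def mass_imp_def by blast
    have "h 1 = n" using fjoin_simps(2)[of x "n \<frown> f" 0] unfolding h(1) by simp
    moreover have "(\<lambda>i. h (Suc (2 * Suc i))) = f" unfolding h(1) fjoin_simps by simp
    moreover have "(\<lambda>i. h (2 * i)) = x" unfolding h(1) fjoin_simps by simp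
    ultimately show ?thesis using h(3) unfolding Phi_in_def by simp
  qed
  show "comp_on (mass_join X (mass_imp X Y)) (\<lambda>h x. ?F (?H h) x)"
  proof (rule comp_on_subst[OF universal_functional])
    show "comp_on (mass_join X (mass_imp X Y)) (\<lambda>h x. ?H h x)" by (intro comp_intros)
    show "?H h \<in> {u. total_fun (u 0) (\<lambda>i. u (Suc i))}" if "h \<in> mass_join X (mass_imp X Y)" for h
      using H[OF that] unfolding total_fun_def by blast
  qed (rule comp_on_id)
  show "?F (?H h) \<in> Y" if "h \<in> mass_join X (mass_imp X Y)" for h
  proof -
    obtain g where "g \<in> Y" "\<forall>x. Phi (?H h 0) (\<lambda>i. ?H h (Suc i)) x = Some (g x)"
      using H[OF \<open>h \<in> _\<close>] by blast
    moreover from this have "?F (?H h) = g" by (intro ext) simp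
    ultimately show ?thesis by simp
  qed
qed

lemma mass_join_mono:
  "medvedev_le X X' \<Longrightarrow> medvedev_le Y Y' \<Longrightarrow> medvedev_le (mass_join X Y) (mass_join X' Y')"
  unfolding mass_join_le_iff using mass_join_upper1 mass_join_upper2 medvedev_le_trans by metis

lemma mass_meet_mono:
  "medvedev_le X X' \<Longrightarrow> medvedev_le Y Y' \<Longrightarrow> medvedev_le (mass_meet X Y) (mass_meet X' Y')"
  unfolding le_mass_meet_iff using mass_meet_lower1 mass_meet_lower2 medvedev_le_trans by metis

lemma mass_imp_le_iff: "medvedev_le (mass_imp X Y) Z \<longleftrightarrow> medvedev_le Y (mass_join X Z)"
proof
  assume "medvedev_le (mass_imp X Y) Z"
  then have "medvedev_le (mass_join X (mass_imp X Y)) (mass_join X Z)"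
    by (intro mass_join_mono medvedev_le_refl)
  then show "medvedev_le Y (mass_join X Z)" using le_join_mass_imp medvedev_le_trans by metis
qed (rule mass_imp_le)

lemma medvedev_le_bot: "medvedev_le UNIV X"
  by (rule medvedev_leI[where F = "\<lambda>f x. f x"], intro comp_intros) simp

lemma medvedev_le_top: "medvedev_le X {}"
  by (rule medvedev_leI[where F = "\<lambda>f x. f x"], intro comp_intros) simp

section \<open>Passage from mass problems to degrees\<close>

lemma mdeg_eq_iff: "mdeg X = mdeg Y \<longleftrightarrow> medvedev_le X Y \<and> medvedev_le Y X"
  using mdegree.abs_eq_iff unfolding medvedev_equiv_def by blast

lemma rep_mdeg: "medvedev_le (rep_mdegree (mdeg X)) X" "medvedev_le X (rep_mdegree (mdeg X))"
proof -
  have "mdeg (rep_mdegree (mdeg X)) = mdeg X" by (rule Quotient3_abs_rep[OF Quotient3_mdegree])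
  then show "medvedev_le (rep_mdegree (mdeg X)) X" "medvedev_le X (rep_mdegree (mdeg X))"
    unfolding mdeg_eq_iff by simp_all
qed

lemma medvedev_ops:
  "bcarrier medvedev = UNIV" "bbot medvedev = mdeg UNIV" "btop medvedev = mdeg {}"
  "bjoin medvedev (mdeg X) (mdeg Y) = mdeg (mass_join X Y)"
  "bmeet medvedev (mdeg X) (mdeg Y) = mdeg (mass_meet X Y)"
proof -
  show "bjoin medvedev (mdeg X) (mdeg Y) = mdeg (mass_join X Y)"
    by (simp add: medvedev_def mdeg_eq_iff mass_join_mono rep_mdeg)
  show "bmeet medvedev (mdeg X) (mdeg Y) = mdeg (mass_meet X Y)"
    by (simp add: medvedev_def mdeg_eq_iff mass_meet_mono rep_mdeg)
qed (simp_all add: medvedev_def)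

lemma medvedev_imp: "bimp medvedev (mdeg X) (mdeg Y) = mdeg (mass_imp X Y)"
proof -
  have "medvedev_le (mass_imp X Y) (mass_imp X' Y')"
    if "medvedev_le X' X" "medvedev_le Y Y'" for X Y X' Y'
    unfolding mass_imp_le_iff
    using medvedev_le_trans[OF that(2) medvedev_le_trans[OF le_join_mass_imp mass_join_mono[OF that(1) medvedev_le_refl]]] .
  then show ?thesis by (simp add: medvedev_def mdeg_eq_iff rep_mdeg)
qed

lemma mdeg_cases: obtains X where "a = mdeg X"
  using mdegree.abs_induct[of "\<lambda>a. \<exists>X. a = mdeg X" a] by blast

lemma ble_mdeg: "ble medvedev (mdeg X) (mdeg Y) \<longleftrightarrow> medvedev_le X Y"
  unfolding ble_def medvedev_ops mdeg_eq_iff mass_join_le_iff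
  using mass_join_upper2 medvedev_le_refl by metis

text \<open>Joining with a fixed problem has a residual as adjoint and therefore preserves meets.
  The nontrivial inequality follows by splitting the two meets on the right one after the
  other.\<close>

lemma meet_join_distrib_le:
  "medvedev_le (mass_meet X (mass_join Y Z)) (mass_join (mass_meet X Y) (mass_meet X Z))"
  "medvedev_le (mass_join (mass_meet X Y) (mass_meet X Z)) (mass_meet X (mass_join Y Z))"
proof -
  let ?L = "mass_meet X (mass_join Y Z)"
  have flip: "medvedev_le A (mass_join B C) \<longleftrightarrow> medvedev_le A (mass_join C B)" for A B C
    using mass_join_least mass_join_upper1 mass_join_upper2 medvedev_le_trans by metis
  have step: "medvedev_le A (mass_join (mass_meet B C) D)"
    if "medvedev_le A (mass_join B D)" "medvedev_le A (mass_join C D)" for A B C D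
  proof -
    have "medvedev_le (mass_imp D A) (mass_meet B C)"
      unfolding le_mass_meet_iff mass_imp_le_iff using that flip by blast
    then show ?thesis unfolding mass_imp_le_iff using flip by blast
  qed
  show "medvedev_le ?L (mass_join (mass_meet X Y) (mass_meet X Z))"
  proof (rule step)
    show "medvedev_le ?L (mass_join X (mass_meet X Z))"
      using mass_meet_lower1 mass_join_upper1 medvedev_le_trans by metis
    have "medvedev_le ?L (mass_join (mass_meet X Z) Y)"
    proof (rule step)
      show "medvedev_le ?L (mass_join X Y)"
        using mass_meet_lower1 mass_join_upper1 medvedev_le_trans by metis
      show "medvedev_le ?L (mass_join Z Y)"
        using mass_meet_lower2 flip by blast
    qed
    then show "medvedev_le ?L (mass_join Y (mass_meet X Z))" using flip by blast
  qed
  show "medvedev_le (mass_join (mass_meet X Y) (mass_meet X Z)) ?L"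
    unfolding mass_join_le_iff by (intro conjI mass_meet_mono medvedev_le_refl mass_join_upper1 mass_join_upper2)
qed

lemma brouwer_algebra_medvedev: "brouwer_algebra medvedev"
proof
  note le = mass_join_le_iff le_mass_meet_iff medvedev_le_refl
  note bnd = mass_join_upper1 mass_join_upper2 mass_meet_lower1 mass_meet_lower2
  note trans = medvedev_le_trans[OF bnd(1) bnd(1)] medvedev_le_trans[OF bnd(1) bnd(2)]
    medvedev_le_trans[OF bnd(2) bnd(1)] medvedev_le_trans[OF bnd(2) bnd(2)]
    medvedev_le_trans[OF bnd(3) bnd(3)] medvedev_le_trans[OF bnd(3) bnd(4)]
    medvedev_le_trans[OF bnd(4) bnd(3)] medvedev_le_trans[OF bnd(4) bnd(4)]
  fix a b c :: mdegree
  obtain X where a: "a = mdeg X" by (rule mdeg_cases)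
  obtain Y where b: "b = mdeg Y" by (rule mdeg_cases)
  obtain Z where c: "c = mdeg Z" by (rule mdeg_cases)
  show "bjoin medvedev a b = bjoin medvedev b a" "bmeet medvedev a b = bmeet medvedev b a"
    unfolding a b medvedev_ops mdeg_eq_iff le by (simp_all add: bnd)
  show "bjoin medvedev (bjoin medvedev a b) c = bjoin medvedev a (bjoin medvedev b c)"
    "bmeet medvedev (bmeet medvedev a b) c = bmeet medvedev a (bmeet medvedev b c)"
    unfolding a b c medvedev_ops mdeg_eq_iff le by (simp_all add: bnd trans)
  show "bjoin medvedev a (bmeet medvedev a b) = a" "bmeet medvedev a (bjoin medvedev a b) = a"
    unfolding a b medvedev_ops mdeg_eq_iff le by (simp_all add: bnd le)
  show "bmeet medvedev a (bjoin medvedev b c) = bjoin medvedev (bmeet medvedev a b) (bmeet medvedev a c)"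
    unfolding a b c medvedev_ops mdeg_eq_iff using meet_join_distrib_le by blast
  show "ble medvedev (bbot medvedev) a" "ble medvedev a (btop medvedev)"
    unfolding a medvedev_ops ble_mdeg by (simp_all add: medvedev_le_bot medvedev_le_top)
  show "ble medvedev b (bjoin medvedev a c) \<longleftrightarrow> ble medvedev (bimp medvedev a b) c"
    unfolding a b c medvedev_ops medvedev_imp ble_mdeg mass_imp_le_iff ..
qed (simp_all add: medvedev_ops)

section \<open>Soundness of intuitionistic logic\<close>

context brouwer_algebra
begin

lemma join_upper1: "a \<in> bcarrier B \<Longrightarrow> b \<in> bcarrier B \<Longrightarrow> ble B a (bjoin B a b)"
  by (metis ble_meet_iff join_closed meet_join_absorb)

lemma join_upper2: "a \<in> bcarrier B \<Longrightarrow> b \<in> bcarrier B \<Longrightarrow> ble B b (bjoin B a b)"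
  by (metis join_upper1 join_commute)

lemma join_least:
  "a \<in> bcarrier B \<Longrightarrow> b \<in> bcarrier B \<Longrightarrow> c \<in> bcarrier B \<Longrightarrow> ble B a c \<Longrightarrow> ble B b c \<Longrightarrow> ble B (bjoin B a b) c"
  by (simp add: ble_def join_assoc)

lemma meet_lower1: "a \<in> bcarrier B \<Longrightarrow> b \<in> bcarrier B \<Longrightarrow> ble B (bmeet B a b) a"
  by (metis ble_def join_commute join_meet_absorb meet_closed)

lemma meet_lower2: "a \<in> bcarrier B \<Longrightarrow> b \<in> bcarrier B \<Longrightarrow> ble B (bmeet B a b) b"
  by (metis meet_lower1 meet_commute)

lemma meet_greatest:
  "a \<in> bcarrier B \<Longrightarrow> b \<in> bcarrier B \<Longrightarrow> c \<in> bcarrier B \<Longrightarrow> ble B c a \<Longrightarrow> ble B c b \<Longrightarrow> ble B c (bmeet B a b)"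
  by (simp add: ble_meet_iff meet_closed flip: meet_assoc)

lemma join_meet_distrib:
  assumes a: "a \<in> bcarrier B" and b: "b \<in> bcarrier B" and c: "c \<in> bcarrier B"
  shows "bmeet B (bjoin B a b) (bjoin B a c) = bjoin B a (bmeet B b c)"
proof -
  have ab: "bjoin B a b \<in> bcarrier B" using a b by (rule join_closed)
  have "bmeet B (bjoin B a b) (bjoin B a c) = bjoin B (bmeet B (bjoin B a b) a) (bmeet B (bjoin B a b) c)"
    by (rule meet_join_distrib[OF ab a c])
  also have "bmeet B (bjoin B a b) a = a"
    using meet_join_absorb[OF a b] meet_commute[OF a ab] by simp
  also have "bmeet B (bjoin B a b) c = bjoin B (bmeet B a c) (bmeet B b c)"
    using meet_join_distrib[OF c a b] meet_commute[OF c ab] meet_commute[OF c a] meet_commute[OF c b]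
    by simp
  also have "bjoin B a (bjoin B (bmeet B a c) (bmeet B b c)) = bjoin B (bjoin B a (bmeet B a c)) (bmeet B b c)"
    by (rule join_assoc[symmetric, OF a meet_closed[OF a c] meet_closed[OF b c]])
  also have "bjoin B a (bmeet B a c) = a" by (rule join_meet_absorb[OF a c])
  finally show ?thesis .
qed

lemma bval_closed: "range v \<subseteq> bcarrier B \<Longrightarrow> bval B v \<phi> \<in> bcarrier B"
  by (induction \<phi>) (auto simp: join_closed meet_closed imp_closed top_closed)

text \<open>Small values are true here, and \<open>a\<close> plays the role of a context. Letting it
  vary carries the induction through the discharge of a hypothesis, which is absorbed by joining its
  value to \<open>a\<close>.\<close>

lemma int_entails_sound:
  assumes v: "range v \<subseteq> bcarrier B"
  shows "\<Gamma> \<turnstile>\<^sub>i \<phi> \<Longrightarrow> a \<in> bcarrier B \<Longrightarrow> (\<And>\<psi>. \<psi> \<in> \<Gamma> \<Longrightarrow> ble B (bval B v \<psi>) a) \<Longrightarrow> ble B (bval B v \<phi>) a"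
proof (induction arbitrary: a rule: int_entails.induct)
  case (BotE \<Gamma> \<phi>)
  have "ble B (btop B) a" using BotE by simp
  then show ?case using bval_closed[OF v, of \<phi>] top_greatest BotE.prems(1) ble_trans top_closed by blast
next
  case (AndI \<Gamma> \<phi> \<psi>)
  then show ?case using bval_closed[OF v] by (simp add: join_least)
next
  case (AndE1 \<Gamma> \<phi> \<psi>)
  then show ?case
    using bval_closed[OF v] join_upper1 ble_trans[OF _ join_closed] by (metis bval.simps(3))
next
  case (AndE2 \<Gamma> \<phi> \<psi>)
  then show ?case
    using bval_closed[OF v] join_upper2 ble_trans[OF _ join_closed] by (metis bval.simps(3))
next
  case (OrI1 \<Gamma> \<phi> \<psi>)
  then show ?case
    using bval_closed[OF v] meet_lower1 ble_trans[OF meet_closed] by (metis bval.simps(4))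
next
  case (OrI2 \<Gamma> \<psi> \<phi>)
  then show ?case
    using bval_closed[OF v] meet_lower2 ble_trans[OF meet_closed] by (metis bval.simps(4))
next
  case (OrE \<Gamma> \<phi> \<psi> \<chi>)
  let ?v = "bval B v"
  note cl = bval_closed[OF v] OrE.prems(1) join_closed meet_closed
  have bound: "ble B (?v \<chi>) (bjoin B (?v \<theta>) a)"
    if IH: "\<And>b. b \<in> bcarrier B \<Longrightarrow> (\<And>\<xi>. \<xi> \<in> insert \<theta> \<Gamma> \<Longrightarrow> ble B (?v \<xi>) b) \<Longrightarrow> ble B (?v \<chi>) b" for \<theta>
  proof (rule IH)
    fix \<xi> assume \<xi>: "\<xi> \<in> insert \<theta> \<Gamma>"
    show "ble B (?v \<xi>) (bjoin B (?v \<theta>) a)"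
    proof (cases "\<xi> = \<theta>")
      case True
      then show ?thesis using join_upper1 cl by simp
    next
      case False
      then have "ble B (?v \<xi>) a" using \<xi> OrE.prems(2) by blast
      then show ?thesis using ble_trans[OF cl(1,2) _ _ join_upper2] cl by blast
    qed
  qed (simp add: cl)
  have "ble B (?v \<chi>) (bjoin B a (?v \<phi>))" "ble B (?v \<chi>) (bjoin B a (?v \<psi>))"
    using bound[OF OrE.IH(2)] bound[OF OrE.IH(3)]
    unfolding join_commute[OF cl(1) cl(2)] by blast+
  then have "ble B (?v \<chi>) (bmeet B (bjoin B a (?v \<phi>)) (bjoin B a (?v \<psi>)))"
    by (rule meet_greatest[rotated 3]) (simp_all add: cl)
  \<comment> \<open>Distributivity reunites the two cases into the disjunction, whose value is
    already below \<open>a\<close>.\<close>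
  also have "bmeet B (bjoin B a (?v \<phi>)) (bjoin B a (?v \<psi>)) = bjoin B a (bmeet B (?v \<phi>) (?v \<psi>))"
    by (rule join_meet_distrib) (simp_all add: cl)
  also have "bjoin B a (bmeet B (?v \<phi>) (?v \<psi>)) = a"
    using OrE.IH(1)[OF OrE.prems] join_commute[of a "bmeet B (?v \<phi>) (?v \<psi>)"] cl by (simp add: ble_def)
  finally show ?case .
next
  case (ImpI \<phi> \<Gamma> \<psi>)
  note cl = bval_closed[OF v] ImpI.prems(1) join_closed
  have "ble B (bval B v \<psi>) (bjoin B (bval B v \<phi>) a)"
  proof (rule ImpI.IH)
    fix \<xi> assume \<xi>: "\<xi> \<in> insert \<phi> \<Gamma>"
    show "ble B (bval B v \<xi>) (bjoin B (bval B v \<phi>) a)"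
    proof (cases "\<xi> = \<phi>")
      case True
      then show ?thesis using join_upper1 cl by simp
    next
      case False
      then have "ble B (bval B v \<xi>) a" using \<xi> ImpI.prems(2) by blast
      then show ?thesis using ble_trans[OF cl(1,2) _ _ join_upper2] cl by blast
    qed
  qed (simp add: cl)
  then show ?case using imp_adjoint cl by simp
next
  case (ImpE \<Gamma> \<phi> \<psi>)
  have "ble B (bval B v \<phi>) a" using ImpE by blast
  then have "bjoin B (bval B v \<phi>) a = a" by (simp add: ble_def)
  moreover have "ble B (bval B v (Imp \<phi> \<psi>)) a" using ImpE by blast
  ultimately show ?case using imp_adjoint[of "bval B v \<phi>" "bval B v \<psi>" a] bval_closed[OF v] ImpE.prems(1) by simp
qed simp

lemma IPC_subset_Th: "IPC \<subseteq> Th B"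
proof
  fix \<phi> assume "\<phi> \<in> IPC"
  then have "{} \<turnstile>\<^sub>i \<phi>" by (simp add: IPC_def)
  have "bval B v \<phi> = bbot B" if v: "range v \<subseteq> bcarrier B" for v
    using int_entails_sound[OF v \<open>{} \<turnstile>\<^sub>i \<phi>\<close> bot_closed] bot_least ble_antisym bval_closed[OF v] bot_closed
    by blast
  then show "\<phi> \<in> Th B" by (simp add: Th_def)
qed

end

section \<open>Finite Kripke completeness\<close>

lemma int_cut: "\<Gamma> \<turnstile>\<^sub>i \<phi> \<Longrightarrow> insert \<phi> \<Gamma> \<turnstile>\<^sub>i \<psi> \<Longrightarrow> \<Gamma> \<turnstile>\<^sub>i \<psi>"
  by (rule int_entails.ImpE[OF int_entails.ImpI])

primrec subforms :: "form \<Rightarrow> form set" where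
  "subforms (Var p) = {Var p}"
| "subforms Bot = {Bot}"
| "subforms (And \<phi> \<psi>) = insert (And \<phi> \<psi>) (subforms \<phi> \<union> subforms \<psi>)"
| "subforms (Or \<phi> \<psi>) = insert (Or \<phi> \<psi>) (subforms \<phi> \<union> subforms \<psi>)"
| "subforms (Imp \<phi> \<psi>) = insert (Imp \<phi> \<psi>) (subforms \<phi> \<union> subforms \<psi>)"

lemma finite_subforms: "finite (subforms \<phi>)"
  by (induction \<phi>) auto

lemma self_subforms [simp]: "\<phi> \<in> subforms \<phi>"
  by (cases \<phi>) auto

definition subform_closed :: "form set \<Rightarrow> bool" where
  "subform_closed \<Sigma> \<longleftrightarrow> (\<forall>\<phi>\<in>\<Sigma>. subforms \<phi> \<subseteq> \<Sigma>)"

lemma subform_closed_subforms: "subform_closed (subforms \<phi>)"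
  unfolding subform_closed_def
proof
  show "subforms \<psi> \<subseteq> subforms \<phi>" if "\<psi> \<in> subforms \<phi>" for \<psi>
    using that by (induction \<phi>) auto
qed

lemma subform_closedD:
  assumes "subform_closed \<Sigma>"
  shows "And \<phi> \<psi> \<in> \<Sigma> \<Longrightarrow> \<phi> \<in> \<Sigma> \<and> \<psi> \<in> \<Sigma>" "Or \<phi> \<psi> \<in> \<Sigma> \<Longrightarrow> \<phi> \<in> \<Sigma> \<and> \<psi> \<in> \<Sigma>"
    "Imp \<phi> \<psi> \<in> \<Sigma> \<Longrightarrow> \<phi> \<in> \<Sigma> \<and> \<psi> \<in> \<Sigma>"
  using assms unfolding subform_closed_def by force+

text \<open>Closure under derivation is asked for only within \<open>\<Sigma>\<close>; for finite
  \<open>\<Sigma>\<close> this leaves finitely many worlds.\<close>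

definition prime_theory :: "form set \<Rightarrow> form set \<Rightarrow> bool" where
  "prime_theory \<Sigma> \<Gamma> \<longleftrightarrow> \<Gamma> \<subseteq> \<Sigma> \<and> (\<forall>\<chi>\<in>\<Sigma>. \<Gamma> \<turnstile>\<^sub>i \<chi> \<longrightarrow> \<chi> \<in> \<Gamma>) \<and> \<not> \<Gamma> \<turnstile>\<^sub>i Bot \<and>
     (\<forall>\<phi> \<psi>. Or \<phi> \<psi> \<in> \<Gamma> \<longrightarrow> \<phi> \<in> \<Gamma> \<or> \<psi> \<in> \<Gamma>)"

text \<open>A maximal subset of \<open>\<Sigma>\<close> not deriving \<open>\<chi>\<close> derives
  it as soon as any further formula of \<open>\<Sigma>\<close> is added. Hence it contains all of
  its consequences in \<open>\<Sigma>\<close>, and a disjunction with both disjuncts missing would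
  yield \<open>\<chi>\<close> by case distinction.\<close>

lemma prime_extension:
  assumes \<Sigma>: "finite \<Sigma>" "subform_closed \<Sigma>" and \<Gamma>: "\<Gamma> \<subseteq> \<Sigma>" "\<not> \<Gamma> \<turnstile>\<^sub>i \<chi>"
  obtains \<Delta> where "\<Gamma> \<subseteq> \<Delta>" "prime_theory \<Sigma> \<Delta>" "\<not> \<Delta> \<turnstile>\<^sub>i \<chi>"
proof -
  define S where "S = {\<Delta>. \<Delta> \<subseteq> \<Sigma> \<and> \<Gamma> \<subseteq> \<Delta> \<and> \<not> \<Delta> \<turnstile>\<^sub>i \<chi>}"
  have "S \<subseteq> Pow \<Sigma>" unfolding S_def by auto
  then have "finite S" using \<Sigma>(1) finite_subset by auto
  moreover have "\<Gamma> \<in> S" using \<Gamma> unfolding S_def by simp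
  ultimately have "\<exists>\<Delta>\<in>S. \<Gamma> \<subseteq> \<Delta> \<and> (\<forall>\<Delta>'\<in>S. \<Delta> \<subseteq> \<Delta>' \<longrightarrow> \<Delta> = \<Delta>')"
    by (rule finite_has_maximal2)
  then obtain \<Delta> where "\<Delta> \<in> S" and max: "\<And>\<Delta>'. \<Delta>' \<in> S \<Longrightarrow> \<Delta> \<subseteq> \<Delta>' \<Longrightarrow> \<Delta> = \<Delta>'"
    by auto
  then have \<Delta>: "\<Delta> \<subseteq> \<Sigma>" "\<Gamma> \<subseteq> \<Delta>" "\<not> \<Delta> \<turnstile>\<^sub>i \<chi>" unfolding S_def by auto
  have ins: "insert \<phi> \<Delta> \<turnstile>\<^sub>i \<chi>" if "\<phi> \<in> \<Sigma>" "\<phi> \<notin> \<Delta>" for \<phi>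
  proof (rule ccontr)
    assume "\<not> insert \<phi> \<Delta> \<turnstile>\<^sub>i \<chi>"
    then have "insert \<phi> \<Delta> \<in> S" using \<Delta> that(1) unfolding S_def by auto
    then show False using max[of "insert \<phi> \<Delta>"] that(2) by blast
  qed
  have "prime_theory \<Sigma> \<Delta>" unfolding prime_theory_def
  proof (intro conjI ballI allI impI)
    show "\<Delta> \<subseteq> \<Sigma>" using \<Delta> by simp
    show "\<psi> \<in> \<Delta>" if "\<psi> \<in> \<Sigma>" "\<Delta> \<turnstile>\<^sub>i \<psi>" for \<psi>
      using ins[OF that(1)] int_cut[OF that(2), of \<chi>] \<Delta>(3) by blast
    show "\<not> \<Delta> \<turnstile>\<^sub>i Bot" using \<Delta>(3) int_entails.BotE[of \<Delta> \<chi>] by blast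
    fix \<phi> \<psi> assume or: "Or \<phi> \<psi> \<in> \<Delta>"
    then have "\<phi> \<in> \<Sigma>" "\<psi> \<in> \<Sigma>" using \<Delta>(1) subform_closedD(2)[OF \<Sigma>(2)] by blast+
    then show "\<phi> \<in> \<Delta> \<or> \<psi> \<in> \<Delta>"
      using ins int_entails.OrE[OF int_entails.Hyp[OF or], of \<chi>] \<Delta>(3) by blast
  qed
  then show thesis using that \<Delta>(2,3) by blast
qed

lemma prime_theory_mem_iff: "prime_theory \<Sigma> \<Gamma> \<Longrightarrow> \<chi> \<in> \<Sigma> \<Longrightarrow> \<chi> \<in> \<Gamma> \<longleftrightarrow> \<Gamma> \<turnstile>\<^sub>i \<chi>"
  unfolding prime_theory_def using int_entails.Hyp by blast

lemma prime_theory_And: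
  assumes "prime_theory \<Sigma> \<Gamma>" "subform_closed \<Sigma>" "And \<phi> \<psi> \<in> \<Sigma>"
  shows "And \<phi> \<psi> \<in> \<Gamma> \<longleftrightarrow> \<phi> \<in> \<Gamma> \<and> \<psi> \<in> \<Gamma>"
proof -
  have \<Sigma>: "\<phi> \<in> \<Sigma>" "\<psi> \<in> \<Sigma>" using subform_closedD(1)[OF assms(2,3)] by simp_all
  show ?thesis unfolding prime_theory_mem_iff[OF assms(1) \<Sigma>(1)]
      prime_theory_mem_iff[OF assms(1) \<Sigma>(2)] prime_theory_mem_iff[OF assms(1,3)]
    by (blast intro: int_entails.AndI int_entails.AndE1 int_entails.AndE2)
qed

lemma prime_theory_Or:
  assumes "prime_theory \<Sigma> \<Gamma>" "subform_closed \<Sigma>" "Or \<phi> \<psi> \<in> \<Sigma>"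
  shows "Or \<phi> \<psi> \<in> \<Gamma> \<longleftrightarrow> \<phi> \<in> \<Gamma> \<or> \<psi> \<in> \<Gamma>"
proof
  assume "\<phi> \<in> \<Gamma> \<or> \<psi> \<in> \<Gamma>"
  then have "\<Gamma> \<turnstile>\<^sub>i Or \<phi> \<psi>"
    using int_entails.OrI1[OF int_entails.Hyp] int_entails.OrI2[OF int_entails.Hyp] by blast
  then show "Or \<phi> \<psi> \<in> \<Gamma>" using prime_theory_mem_iff[OF assms(1,3)] by blast
qed (use assms(1) in \<open>auto simp: prime_theory_def\<close>)

lemma prime_theory_Imp:
  assumes p: "prime_theory \<Sigma> \<Gamma>" and \<Sigma>: "finite \<Sigma>" "subform_closed \<Sigma>" and imp: "Imp \<phi> \<psi> \<in> \<Sigma>"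
  shows "Imp \<phi> \<psi> \<in> \<Gamma> \<longleftrightarrow> (\<forall>\<Delta>. prime_theory \<Sigma> \<Delta> \<and> \<Gamma> \<subseteq> \<Delta> \<and> \<phi> \<in> \<Delta> \<longrightarrow> \<psi> \<in> \<Delta>)"
proof
  have in\<Sigma>: "\<phi> \<in> \<Sigma>" "\<psi> \<in> \<Sigma>" using subform_closedD(3)[OF \<Sigma>(2) imp] by simp_all
  show "\<forall>\<Delta>. prime_theory \<Sigma> \<Delta> \<and> \<Gamma> \<subseteq> \<Delta> \<and> \<phi> \<in> \<Delta> \<longrightarrow> \<psi> \<in> \<Delta>" if "Imp \<phi> \<psi> \<in> \<Gamma>"
  proof (intro allI impI)
    fix \<Delta> assume \<Delta>: "prime_theory \<Sigma> \<Delta> \<and> \<Gamma> \<subseteq> \<Delta> \<and> \<phi> \<in> \<Delta>"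
    then have "\<Delta> \<turnstile>\<^sub>i \<psi>" using that int_entails.ImpE[OF int_entails.Hyp int_entails.Hyp] by blast
    then show "\<psi> \<in> \<Delta>" using prime_theory_mem_iff in\<Sigma>(2) \<Delta> by blast
  qed
  assume all: "\<forall>\<Delta>. prime_theory \<Sigma> \<Delta> \<and> \<Gamma> \<subseteq> \<Delta> \<and> \<phi> \<in> \<Delta> \<longrightarrow> \<psi> \<in> \<Delta>"
  have "insert \<phi> \<Gamma> \<turnstile>\<^sub>i \<psi>"
  proof (rule ccontr)
    assume no: "\<not> insert \<phi> \<Gamma> \<turnstile>\<^sub>i \<psi>"
    have "insert \<phi> \<Gamma> \<subseteq> \<Sigma>" using in\<Sigma> p unfolding prime_theory_def by blast
    from prime_extension[OF \<Sigma> this no] obtain \<Delta>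
      where "insert \<phi> \<Gamma> \<subseteq> \<Delta>" "prime_theory \<Sigma> \<Delta>" "\<not> \<Delta> \<turnstile>\<^sub>i \<psi>" .
    then show False using all int_entails.Hyp by blast
  qed
  then have "\<Gamma> \<turnstile>\<^sub>i Imp \<phi> \<psi>" by (rule int_entails.ImpI)
  then show "Imp \<phi> \<psi> \<in> \<Gamma>" using prime_theory_mem_iff[OF p imp] by blast
qed

section \<open>A join theorem\<close>

text \<open>A number \<open>t\<close> codes the finite sequence of length \<^term>\<open>pfst t\<close> with entries \<open>seq_nth t i\<close>.\<close>

definition seq_nth :: "nat \<Rightarrow> nat \<Rightarrow> nat" where
  "seq_nth t i = (if i < pfst t then snth (psnd t) i else 0)"

definition agree :: "(nat \<Rightarrow> nat) \<Rightarrow> nat \<Rightarrow> bool" where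
  "agree G t \<longleftrightarrow> (\<forall>i<pfst t. seq_nth t i = G i)"

lemma seq_exists: "\<exists>t. pfst t = n \<and> (\<forall>i<n. seq_nth t i = f i)"
proof -
  obtain s where "\<forall>i<length (map f [0..<n]). snth s i = map f [0..<n] ! i" using snth_exists by blast
  then show ?thesis by (intro exI[of _ "npair n s"]) (simp add: seq_nth_def)
qed

lemma comp_on_seq_nth [comp_intros]:
  assumes "comp_on D F" "comp_on D G" shows "comp_on D (\<lambda>g x. seq_nth (F g x) (G g x))"
  unfolding seq_nth_def by (intro comp_intros assms)

lemma dec_on_agree [comp_intros]:
  assumes G: "comp_on D (\<lambda>g z. G g (pfst z) (psnd z))" and T: "comp_on D T"
  shows "dec_on D (\<lambda>g x. agree (G g x) (T g x))"
  unfolding agree_def by (intro comp_intros G comp_on_comp[OF T])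

text \<open>A computation whose oracle is \<open>h\<close> joined with a finite sequence. The
  certificate lies below the length of \<open>t\<close>, so its queries never reach the padding
  zeros of \<open>seq_nth\<close> and the result persists in all functions that agree with
  \<open>t\<close>.\<close>

definition conv :: "(nat \<Rightarrow> nat) \<Rightarrow> nat \<Rightarrow> nat \<Rightarrow> nat \<Rightarrow> nat \<Rightarrow> bool" where
  "conv h t e x y \<longleftrightarrow> (\<exists>c<pfst t. cert (fjoin h (seq_nth t)) c \<and> fact_in c e x y)"

lemma dec_on_conv [comp_intros]:
  assumes H: "comp_on D (\<lambda>g z. H g (pfst z) (psnd z))"
    and T: "comp_on D T" and E: "comp_on D E" and X: "comp_on D X" and Y: "comp_on D Y"
  shows "dec_on D (\<lambda>g x. conv (H g x) (T g x) (E g x) (X g x) (Y g x))"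
proof -
  have H': "comp_on D (\<lambda>g z. H g (A g z) (B g z))" if "comp_on D A" "comp_on D B" for A B
    using comp_on_comp[OF H comp_on_pair[OF that]] by simp
  show ?thesis unfolding conv_def
    by (intro comp_intros assms H' comp_on_comp[OF T] comp_on_comp[OF E] comp_on_comp[OF X] comp_on_comp[OF Y])
qed

lemma conv_sound:
  assumes "conv h t e x y" "agree G t" shows "Phi e (fjoin h G) x = Some y"
proof -
  obtain c where c: "c < pfst t" "cert (fjoin h (seq_nth t)) c" "fact_in c e x y"
    using assms(1) unfolding conv_def by blast
  have "cert (fjoin h G) c"
  proof (rule cert_use[OF c(2)])
    fix z assume "z \<le> c"
    then have "z div 2 < pfst t" using c(1) by linarith
    then show "fjoin h G z = fjoin h (seq_nth t) z" using assms(2) unfolding agree_def fjoin_def by simp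
  qed
  then show ?thesis unfolding Phi_cert using c(3) by blast
qed

lemma conv_complete:
  assumes "Phi e (fjoin h G) x = Some y"
  obtains m where "\<And>t. agree G t \<Longrightarrow> m < pfst t \<Longrightarrow> conv h t e x y"
proof -
  obtain c where c: "cert (fjoin h G) c" "fact_in c e x y" using assms unfolding Phi_cert by blast
  have "conv h t e x y" if t: "agree G t" "c < pfst t" for t
  proof -
    have "cert (fjoin h (seq_nth t)) c"
    proof (rule cert_use[OF c(1)])
      fix z assume "z \<le> c"
      then have "z div 2 < pfst t" using t(2) by linarith
      then show "fjoin h (seq_nth t) z = fjoin h G z" using t(1) unfolding agree_def fjoin_def by simp
    qed
    then show ?thesis unfolding conv_def using c(2) t(2) by blast
  qed
  then show thesis by (rule that)
qed

lemma conv_le: "conv h t e x y \<Longrightarrow> y \<le> t"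
proof -
  assume "conv h t e x y"
  then obtain c where "c < pfst t" "y \<le> c" unfolding conv_def using fact_in_le(3) by blast
  moreover have "pfst t \<le> t" using le_prod_encode_1[of "pfst t" "psnd t"] by simp
  ultimately show ?thesis by linarith
qed

text \<open>An \<open>e\<close>-splitting above a stem of length \<open>l\<close>: \<open>w\<close>
  consists of two finite extensions and an argument at which they force different values. The bounds
  on these values, automatic by \<open>conv_le\<close>, keep the notion decidable in
  \<open>h\<close>.\<close>

definition split_at :: "(nat \<Rightarrow> nat) \<Rightarrow> nat \<Rightarrow> (nat \<Rightarrow> nat) \<Rightarrow> nat \<Rightarrow> nat \<Rightarrow> bool" where
  "split_at h e f l w \<longleftrightarrow>
     l \<le> pfst (pfst w) \<and> l \<le> pfst (pfst (psnd w)) \<and>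
     (\<forall>i<l. seq_nth (pfst w) i = f i \<and> seq_nth (pfst (psnd w)) i = f i) \<and>
     (\<exists>y\<le>pfst w. \<exists>y'\<le>pfst (psnd w). y \<noteq> y' \<and>
        conv h (pfst w) e (psnd (psnd w)) y \<and> conv h (pfst (psnd w)) e (psnd (psnd w)) y')"

lemma split_at_cong: "(\<And>i. i < l \<Longrightarrow> f i = f' i) \<Longrightarrow> split_at h e f l w \<longleftrightarrow> split_at h e f' l w"
  unfolding split_at_def by simp

lemma split_atI:
  assumes "l \<le> pfst t" "l \<le> pfst t'" "\<And>i. i < l \<Longrightarrow> seq_nth t i = f i" "\<And>i. i < l \<Longrightarrow> seq_nth t' i = f i"
    "conv h t e x y" "conv h t' e x y'" "y \<noteq> y'"
  shows "split_at h e f l (npair t (npair t' x))"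
  unfolding split_at_def using assms conv_le[OF assms(5)] conv_le[OF assms(6)] by auto

lemma dec_on_split_at [comp_intros]:
  assumes H: "comp_on D (\<lambda>g z. H g (pfst z) (psnd z))" and F: "comp_on D (\<lambda>g z. F g (pfst z) (psnd z))"
    and E: "comp_on D E" and L: "comp_on D L" and W: "comp_on D W"
  shows "dec_on D (\<lambda>g x. split_at (H g x) (E g x) (F g x) (L g x) (W g x))"
proof -
  have H': "comp_on D (\<lambda>g z. H g (A g z) (B g z))" if "comp_on D A" "comp_on D B" for A B
    using comp_on_comp[OF H comp_on_pair[OF that]] by simp
  have F': "comp_on D (\<lambda>g z. F g (A g z) (B g z))" if "comp_on D A" "comp_on D B" for A B
    using comp_on_comp[OF F comp_on_pair[OF that]] by simp
  show ?thesis unfolding split_at_def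
    by (intro comp_intros assms H' F' comp_on_comp[OF E] comp_on_comp[OF L] comp_on_comp[OF W])
qed

text \<open>
  In stage \<open>e\<close> of the construction of \<open>G\<close>, starting at length \<open>l\<close>, the entry \<open>n = G l\<close> tells a
  reader who can decide \<open>P n\<close> whether \<open>G\<close> takes one of the two sides of the least splitting.
  Exactly the negative answers to \<open>P\<close> correspond to a splitting, so such a reader finds the length
  \<open>l'\<close> at which the stage ends.
\<close>

definition stage :: "(nat \<Rightarrow> nat) \<Rightarrow> (nat \<Rightarrow> bool) \<Rightarrow> nat \<Rightarrow> (nat \<Rightarrow> nat) \<Rightarrow> nat \<Rightarrow> nat \<Rightarrow> nat \<Rightarrow> bool" where
  "stage h P e G l u l' \<longleftrightarrow>
     P (G l) \<and> l' = Suc (Suc l) \<or>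
     \<not> P (G l) \<and> split_at h e G (Suc l) u \<and> (\<forall>v<u. \<not> split_at h e G (Suc l) v) \<and>
     (agree G (pfst u) \<and> l' = Suc (pfst (pfst u)) \<or>
      \<not> agree G (pfst u) \<and> l' = Suc (pfst (pfst (psnd u))))"

text \<open>The decoding rests on this: whatever witness a search finds, it has to be the least
  splitting, so it shows the end of the stage that the construction used.\<close>

lemma stage_det: "stage h P e G l u l' \<Longrightarrow> stage h P e G l v l'' \<Longrightarrow> l' = l''"
proof -
  assume st: "stage h P e G l u l'" "stage h P e G l v l''"
  show ?thesis
  proof (cases "P (G l)")
    case False
    then have "u = v" using st unfolding stage_def by (metis linorder_neqE_nat)
    then show ?thesis using st False unfolding stage_def by auto
  qed (use st in \<open>simp add: stage_def\<close>)
qed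

text \<open>Post's theorem relative to \<open>h\<close>: if a set and its complement are both
  enumerable from \<open>h\<close>, running the two searches until one succeeds decides the
  set.\<close>

lemma turing_le_two_searches:
  assumes R: "dec_on {h} (\<lambda>_ z. R (pfst z) (psnd z))" and R': "dec_on {h} (\<lambda>_ z. R' (pfst z) (psnd z))"
    and iff: "\<And>n. key n \<noteq> 0 \<longleftrightarrow> (\<exists>w. R n w)" "\<And>n. key n = 0 \<longleftrightarrow> (\<exists>w. R' n w)"
    and range: "\<And>n. key n \<le> (1::nat)"
  shows "key \<le>\<^sub>T h"
proof -
  let ?W = "\<lambda>n. LEAST w. R n w \<or> R' n w"
  have ex: "\<exists>w. R n w \<or> R' n w" for n using iff[of n] by blast
  have W: "comp_on {h} (\<lambda>_. ?W)" by (intro comp_intros R R' ex)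
  have "dec_on {h} (\<lambda>g n. R n (?W n))"
    using dec_on_comp[OF R comp_on_pair[OF comp_on_id W]] by simp
  then have "comp_on {h} (\<lambda>g n. if R n (?W n) then 1 else 0)" by (simp add: dec_on_def)
  moreover have "(if R n (?W n) then 1 else 0) = key n" for n
    using LeastI_ex[OF ex[of n]] iff[of n] range[of n] by (auto simp: le_Suc_eq)
  ultimately show ?thesis unfolding turing_le_iff by simp
qed

text \<open>Without a splitting above the stem, all converging finite extensions agree at each
  argument, and initial segments of \<open>G\<close> are among them. Any convergence found by a
  search over finite sequences thus gives \<open>B x\<close>, and the search does not consult
  \<open>G\<close>.\<close>

lemma no_splitting_computes:
  assumes no: "\<not> (\<exists>w. split_at h e f l w)" and f: "\<And>i. i < l \<Longrightarrow> G i = f i"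
    and fc: "comp_on {h} (\<lambda>_. f)"
    and B: "\<And>x. Phi e (fjoin h G) x = Some (B x)"
  shows "B \<le>\<^sub>T h"
proof -
  let ?Q = "\<lambda>x w. l \<le> pfst (pfst w) \<and> (\<forall>i<l. seq_nth (pfst w) i = f i) \<and> conv h (pfst w) e x (psnd w)"
  have hc: "comp_on {h} (\<lambda>_ z. h (psnd z))"
    by (rule comp_on_cong[THEN iffD1, of "{h}" "\<lambda>g z. g (psnd z)"]) (simp, intro comp_intros)
  have ex: "\<exists>t. ?Q x (npair t (B x)) \<and> agree G t" for x
  proof -
    obtain m where m: "\<And>t. agree G t \<Longrightarrow> m < pfst t \<Longrightarrow> conv h t e x (B x)"
      using conv_complete[OF B] by blast
    obtain t where t: "pfst t = max (Suc m) l" "\<forall>i<max (Suc m) l. seq_nth t i = G i"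
      using seq_exists by blast
    have "agree G t" unfolding agree_def using t by simp
    moreover from this have "conv h t e x (B x)" using m t(1) by simp
    ultimately show ?thesis using t f by (intro exI[of _ t]) simp
  qed
  have uniq: "psnd w = B x" if w: "?Q x w" for x w
  proof (rule ccontr)
    assume ne: "psnd w \<noteq> B x"
    obtain t where t: "?Q x (npair t (B x))" using ex by blast
    have "split_at h e f l (npair (pfst w) (npair t x))"
      by (rule split_atI[of l _ _ f h e x "psnd w" "B x"]) (use w t ne in simp_all)
    then show False using no by blast
  qed
  have "comp_on {h} (\<lambda>_ x. psnd (LEAST w. ?Q x w))"
  proof (rule comp_on_psnd[OF comp_on_Least])
    show "dec_on {h} (\<lambda>g z. ?Q (pfst z) (psnd z))"
      by (intro comp_intros hc comp_on_comp[OF fc])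
    show "\<exists>w. ?Q x w" for x using ex by blast
  qed
  moreover have "psnd (LEAST w. ?Q x w) = B x" for x
    by (rule uniq[OF LeastI_ex]) (use ex in blast)
  ultimately show ?thesis unfolding turing_le_iff by simp
qed

text \<open>The numbers \<open>n\<close> after which a splitting exists are enumerable from
  \<open>h\<close>, so they are not exactly those with \<open>P n\<close>; the next entry is an
  \<open>n\<close> where the two differ. If no splitting exists, computing \<open>B\<close> would
  put \<open>B\<close> below \<open>h\<close>; if one exists, one of its sides differs from
  \<open>B\<close>. The final entry \<open>v\<close> is left free for coding.\<close>

lemma stage_exists:
  assumes P: "\<And>R. dec_on {h} (\<lambda>_ z. R (pfst z) (psnd z)) \<Longrightarrow> \<exists>n. P n \<noteq> (\<exists>w. R n w)"
    and B: "\<not> B \<le>\<^sub>T h"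
  shows "\<exists>t'. pfst t < pfst t' \<and> agree (seq_nth t') t \<and>
    (\<forall>G. agree G t' \<longrightarrow> (\<exists>u. stage h P e G (pfst t) u (pfst t')) \<and> G (pfst t' - 1) = v \<and>
       \<not> (\<forall>x. Phi e (fjoin h G) x = Some (B x)))"
proof -
  let ?l = "pfst t"
  let ?f = "\<lambda>n i. if i < ?l then seq_nth t i else n"
  have hc: "comp_on {h} (\<lambda>_ z. h (psnd z))"
    by (rule comp_on_cong[THEN iffD1, of "{h}" "\<lambda>g z. g (psnd z)"]) (simp, intro comp_intros)
  have "dec_on {h} (\<lambda>_ z. split_at h e (?f (pfst z)) (Suc ?l) (psnd z))"
    by (intro comp_intros hc)
  from P[OF this] obtain n where n: "P n \<noteq> (\<exists>w. split_at h e (?f n) (Suc ?l) w)" by blast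
  have append: "\<exists>t'. pfst t' = Suc (pfst s) \<and> agree (seq_nth t') s \<and> seq_nth t' (pfst s) = a" for s a
  proof -
    obtain t' where "pfst t' = Suc (pfst s)"
      "\<forall>i<Suc (pfst s). seq_nth t' i = (if i < pfst s then seq_nth s i else a)"
      using seq_exists[of "Suc (pfst s)" "\<lambda>i. if i < pfst s then seq_nth s i else a"] by auto
    then show ?thesis unfolding agree_def by (intro exI[of _ t']) simp
  qed
  show ?thesis
  proof (cases "P n")
    case True
    then have no: "\<not> (\<exists>w. split_at h e (?f n) (Suc ?l) w)" using n by blast
    obtain t1 where t1: "pfst t1 = Suc ?l" "agree (seq_nth t1) t" "seq_nth t1 ?l = n" using append by blast
    obtain t' where t': "pfst t' = Suc (pfst t1)" "agree (seq_nth t') t1" "seq_nth t' (pfst t1) = v"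
      using append by blast
    have tt': "agree (seq_nth t') t" using t1 t' unfolding agree_def by simp
    show ?thesis
    proof (rule exI[of _ t'], intro conjI allI impI)
      show "pfst t < pfst t'" using t1 t' by simp
      show "agree (seq_nth t') t" by (rule tt')
      fix G assume G: "agree G t'"
      have Gf: "G i = ?f n i" if "i < Suc ?l" for i
        using G t1 t' tt' that unfolding agree_def by (auto simp: less_Suc_eq)
      have "stage h P e G ?l 0 (pfst t')" using Gf[of ?l] True t1 t' unfolding stage_def by simp
      then show "\<exists>u. stage h P e G ?l u (pfst t')" by blast
      show "G (pfst t' - 1) = v" using G t' unfolding agree_def by simp
      show "\<not> (\<forall>x. Phi e (fjoin h G) x = Some (B x))"
      proof
        assume all: "\<forall>x. Phi e (fjoin h G) x = Some (B x)"
        have fc: "comp_on {h} (\<lambda>_. ?f n)" by (intro comp_intros)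
        have "B \<le>\<^sub>T h" by (rule no_splitting_computes[OF no Gf fc]) (use all in simp_all)
        then show False using B by blast
      qed
    qed
  next
    case False
    then have ex: "\<exists>w. split_at h e (?f n) (Suc ?l) w" using n by blast
    define u where "u = (LEAST w. split_at h e (?f n) (Suc ?l) w)"
    have u: "split_at h e (?f n) (Suc ?l) u" unfolding u_def using ex by (rule LeastI_ex)
    have least: "\<not> split_at h e (?f n) (Suc ?l) w" if "w < u" for w
      using that unfolding u_def by (rule not_less_Least)
    obtain y y' where y: "y \<noteq> y'" "conv h (pfst u) e (psnd (psnd u)) y"
      "conv h (pfst (psnd u)) e (psnd (psnd u)) y'"
      using u unfolding split_at_def by blast
    define s where "s = (if y \<noteq> B (psnd (psnd u)) then pfst u else pfst (psnd u))"
    have s: "Suc ?l \<le> pfst s" "\<And>i. i < Suc ?l \<Longrightarrow> seq_nth s i = ?f n i"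
      using u unfolding s_def split_at_def by auto
    obtain t' where t': "pfst t' = Suc (pfst s)" "agree (seq_nth t') s" "seq_nth t' (pfst s) = v"
      using append by blast
    have t's: "seq_nth t' i = ?f n i" if "i < Suc ?l" for i
      using t' s that unfolding agree_def by auto
    show ?thesis
    proof (rule exI[of _ t'], intro conjI allI impI)
      show "pfst t < pfst t'" using t' s by simp
      show "agree (seq_nth t') t" unfolding agree_def using t's by simp
      fix G assume G: "agree G t'"
      have Gs: "agree G s" using G t' unfolding agree_def by simp
      have Gf: "G i = ?f n i" if "i < Suc ?l" for i
        using G t' s t's[OF that] that unfolding agree_def by auto
      \<comment> \<open>The two sides force different values at the same argument, so no function
        agrees with both; testing the first side tells which one was taken.\<close>
      have other: "\<not> agree G (pfst u)" if "s \<noteq> pfst u"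
      proof
        assume "agree G (pfst u)"
        then have "Phi e (fjoin h G) (psnd (psnd u)) = Some y" by (rule conv_sound[OF y(2)])
        moreover have "Phi e (fjoin h G) (psnd (psnd u)) = Some y'"
          using conv_sound[OF y(3)] Gs that unfolding s_def by (simp split: if_splits)
        ultimately show False using y(1) by simp
      qed
      have cong: "split_at h e G (Suc ?l) w \<longleftrightarrow> split_at h e (?f n) (Suc ?l) w" for w
        by (rule split_at_cong) (rule Gf)
      have "stage h P e G ?l u (pfst t')"
      proof (cases "s = pfst u")
        case True
        then show ?thesis unfolding stage_def cong using Gf[of ?l] False u least Gs t'(1) by auto
      next
        case ne: False
        then have "s = pfst (psnd u)" unfolding s_def by (simp split: if_splits)
        then show ?thesis
          unfolding stage_def cong using Gf[of ?l] False u least other[OF ne] t'(1) by auto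
      qed
      then show "\<exists>u. stage h P e G ?l u (pfst t')" by blast
      show "G (pfst t' - 1) = v" using G t' unfolding agree_def by simp
      show "\<not> (\<forall>x. Phi e (fjoin h G) x = Some (B x))"
      proof
        assume all: "\<forall>x. Phi e (fjoin h G) x = Some (B x)"
        show False
        proof (cases "y \<noteq> B (psnd (psnd u))")
          case True
          then have "Phi e (fjoin h G) (psnd (psnd u)) = Some y"
            using conv_sound[OF y(2)] Gs unfolding s_def by simp
          then show False using all True by simp
        next
          case False
          then have "Phi e (fjoin h G) (psnd (psnd u)) = Some y'"
            using conv_sound[OF y(3)] Gs unfolding s_def by simp
          then show False using all False y(1) by simp
        qed
      qed
    qed
  qed
qed

text \<open>As \<open>key\<close> is not computable from \<open>h\<close>, its zeros and its
  nonzeros are not both enumerable from \<open>h\<close>; \<open>b\<close> selects a side that is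
  not. Stage \<open>s\<close> deals with program \<open>pfst s\<close> and function
  \<open>B (psnd s)\<close>, and stores \<open>z s\<close> in its last entry.\<close>

theorem join_avoiding:
  fixes h key z :: "nat \<Rightarrow> nat" and B :: "nat \<Rightarrow> nat \<Rightarrow> nat"
  assumes key: "\<not> key \<le>\<^sub>T h" "\<And>n. key n \<le> 1" and B: "\<And>k. \<not> B k \<le>\<^sub>T h"
  obtains G where "z \<le>\<^sub>T fjoin (fjoin h G) key" "\<And>k. \<not> B k \<le>\<^sub>T fjoin h G"
proof -
  have "\<exists>b. \<forall>R. dec_on {h} (\<lambda>_ z. R (pfst z) (psnd z)) \<longrightarrow> (\<exists>n. ((key n = 0) = b) \<noteq> (\<exists>w. R n w))"
  proof (rule ccontr)
    assume "\<not> ?thesis"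
    then have ce: "\<exists>R. dec_on {h} (\<lambda>_ z. R (pfst z) (psnd z)) \<and> (\<forall>n. ((key n = 0) = b) = (\<exists>w. R n w))" for b
      by simp
    obtain R where R: "dec_on {h} (\<lambda>_ z. R (pfst z) (psnd z))" "\<And>n. ((key n = 0) = False) = (\<exists>w. R n w)"
      using ce by blast
    obtain R' where R': "dec_on {h} (\<lambda>_ z. R' (pfst z) (psnd z))" "\<And>n. ((key n = 0) = True) = (\<exists>w. R' n w)"
      using ce by blast
    have "key \<le>\<^sub>T h"
      by (rule turing_le_two_searches[OF R(1) R'(1)]) (use R(2) R'(2) key(2) in \<open>auto simp only: simp_thms\<close>)
    then show False using key(1) by blast
  qed
  then obtain b where b: "\<And>R. dec_on {h} (\<lambda>_ z. R (pfst z) (psnd z)) \<Longrightarrow> \<exists>n. ((key n = 0) = b) \<noteq> (\<exists>w. R n w)"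
    by blast
  let ?P = "\<lambda>n. (key n = 0) = b"
  define Q where "Q s t t' \<longleftrightarrow> pfst t < pfst t' \<and> agree (seq_nth t') t \<and>
    (\<forall>G. agree G t' \<longrightarrow> (\<exists>u. stage h ?P (pfst s) G (pfst t) u (pfst t')) \<and> G (pfst t' - 1) = z s \<and>
       \<not> (\<forall>x. Phi (pfst s) (fjoin h G) x = Some (B (psnd s) x)))" for s t t'
  have "\<exists>t'. Q s t t'" for s t
    unfolding Q_def by (rule stage_exists[OF b B])
  then obtain nxt where Q: "\<And>s t. Q s t (nxt s t)" by metis
  note nxt = Q[unfolded Q_def]
  define T where "T = rec_nat (npair 0 0) nxt"
  have T0: "pfst (T 0) = 0" and TS: "T (Suc s) = nxt s (T s)" for s unfolding T_def by simp_all
  have incr: "pfst (T m) < pfst (T (Suc m))" for m using nxt[of "T m" m] TS by simp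
  have mono: "agree (seq_nth (T m)) (T s)" if "s \<le> m" for s m
    using that
  proof (induction m rule: dec_induct)
    case (step m)
    have le: "pfst (T s) \<le> pfst (T m)" if "s \<le> m" for s m
      by (rule lift_Suc_mono_le[OF _ that, of "\<lambda>m. pfst (T m)"]) (use incr in \<open>simp add: less_imp_le\<close>)
    have "agree (seq_nth (T (Suc m))) (T m)" using nxt TS by metis
    then show ?case using step.IH le[OF step.hyps(1)] unfolding agree_def by simp
  qed (simp add: agree_def)
  have len: "s \<le> pfst (T s)" for s
  proof (induction s)
    case (Suc s)
    then show ?case using nxt[of "T s" s] unfolding TS by linarith
  qed simp
  \<comment> \<open>Each stage adds at least one entry, so entry \<open>i\<close> is settled after
    \<open>Suc i\<close> stages.\<close>
  define G where "G i = seq_nth (T (Suc i)) i" for i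
  have G: "agree G (T s)" for s
    unfolding agree_def
  proof (intro allI impI)
    fix i assume i: "i < pfst (T s)"
    show "seq_nth (T s) i = G i"
    proof (cases "s \<le> Suc i")
      case True
      then show ?thesis using mono[OF True] i unfolding agree_def G_def by simp
    next
      case False
      then have "Suc i \<le> s" by simp
      from mono[OF this] show ?thesis using len[of "Suc i"] unfolding agree_def G_def by simp
    qed
  qed
  have st: "\<exists>u. stage h ?P (pfst s) G (pfst (T s)) u (pfst (T (Suc s)))"
    and val: "G (pfst (T (Suc s)) - 1) = z s"
    and avoid: "\<not> (\<forall>x. Phi (pfst s) (fjoin h G) x = Some (B (psnd s) x))" for s
    using nxt[of "T s" s] G[of "Suc s"] unfolding TS by blast+
  have "\<not> B k \<le>\<^sub>T fjoin h G" for k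
  proof
    assume "B k \<le>\<^sub>T fjoin h G"
    then obtain e where "\<forall>x. Phi e (fjoin h G) x = Some (B k x)" unfolding turing_le_def by blast
    then show False using avoid[of "npair e k"] by simp
  qed
  moreover have "z \<le>\<^sub>T fjoin (fjoin h G) key"
  proof -
    let ?U = "fjoin (fjoin h G) key"
    \<comment> \<open>\<open>w\<close> lists the lengths reached by the stages together with their
      splittings. As \<open>key\<close> decides the predicate of \<open>stage\<close>, such a list
      can be found by search, and determinism forces its lengths.\<close>
    let ?run = "\<lambda>h G key s w. pfst (snth w 0) = 0 \<and> (\<forall>i<Suc s. stage h (\<lambda>n. (key n = 0) = b) (pfst i) G
      (pfst (snth w i)) (psnd (snth w i)) (pfst (snth w (Suc i))))"
    have run_T: "pfst (snth w i) = pfst (T i)" if w: "?run h G key s w" and i: "i \<le> Suc s" for s w i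
      using i
    proof (induction i)
      case 0
      then show ?case using w T0 by simp
    next
      case (Suc i)
      then have "stage h ?P (pfst i) G (pfst (T i)) (psnd (snth w i)) (pfst (snth w (Suc i)))"
        using w[THEN conjunct2, rule_format, of i] by simp
      then show ?case using st[of i] stage_det by blast
    qed
    have ex: "\<exists>w. ?run h G key s w" for s
    proof -
      obtain u where u: "\<And>i. stage h ?P (pfst i) G (pfst (T i)) (u i) (pfst (T (Suc i)))" using st by metis
      let ?xs = "map (\<lambda>i. npair (pfst (T i)) (u i)) [0..<Suc (Suc s)]"
      obtain w where w: "\<forall>i<length ?xs. snth w i = ?xs ! i" using snth_exists by blast
      have "snth w i = npair (pfst (T i)) (u i)" if "i \<le> Suc s" for i
        using w[rule_format, of i] that by (simp del: upt_Suc)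
      then show ?thesis using u T0 by (intro exI[of _ w]) simp
    qed
    \<comment> \<open>\<open>h\<close> sits at the positions 4i, \<open>G\<close> at 4i + 2 and
      \<open>key\<close> at the odd ones. The case distinction on \<open>b\<close> turns the
      equivalence into an equation or its negation.\<close>
    have dec: "dec_on {?U} (\<lambda>U z. ?run (\<lambda>i. U (2 * (2 * i))) (\<lambda>i. U (2 * Suc (2 * i))) (\<lambda>i. U (Suc (2 * i))) (pfst z) (psnd z))"
      unfolding stage_def by (intro comp_intros) (cases b; simp; intro comp_intros)+
    have "comp_on {?U} (\<lambda>U s. U (2 * Suc (2 * (pfst (snth (LEAST w. ?run (\<lambda>i. U (2 * (2 * i)))
        (\<lambda>i. U (2 * Suc (2 * i))) (\<lambda>i. U (Suc (2 * i))) s w) (Suc s)) - 1))))"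
      by (intro comp_on_oracle comp_on_times comp_on_Suc comp_on_const comp_on_minus comp_on_pfst
          comp_on_snth comp_on_id comp_on_Least[OF dec])
        (use ex in \<open>simp only: singleton_iff fjoin_simps\<close>)
    then have "(\<lambda>s. G (pfst (snth (LEAST w. ?run h G key s w) (Suc s)) - 1)) \<le>\<^sub>T ?U"
      unfolding turing_le_iff
      by (rule comp_on_cong[THEN iffD1, rotated]) (simp only: singleton_iff fjoin_simps)
    moreover have "G (pfst (snth (LEAST w. ?run h G key s w) (Suc s)) - 1) = z s" for s
      using run_T[OF LeastI_ex[OF ex[of s]], of "Suc s"] val[of s] by simp
    ultimately show ?thesis by simp
  qed
  ultimately show thesis using that by blast
qed

lemma turing_join_mono: "f \<le>\<^sub>T f' \<Longrightarrow> g \<le>\<^sub>T g' \<Longrightarrow> fjoin f g \<le>\<^sub>T fjoin f' g'"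
  unfolding turing_join_iff by (intro conjI turing_trans[OF _ turing_join1] turing_trans[OF _ turing_join2])

text \<open>\<open>h\<close> collects the columns outside \<open>E\<close>, so independence keeps
  every column in \<open>E\<close> out of its reach. For each pair from \<open>E\<close> the join
  theorem is applied once: column \<open>i\<close> is the key, column \<open>j\<close> the coded
  function, and all columns in \<open>E\<close> are avoided. Later joins preserve what was achieved
  for earlier pairs.\<close>

lemma join_avoiding_columns:
  assumes A: "computably_independent A" and E: "finite E"
  obtains g where "\<And>i. i \<notin> E \<Longrightarrow> column A i \<le>\<^sub>T g" "\<And>i. i \<in> E \<Longrightarrow> \<not> column A i \<le>\<^sub>T g"
    "\<And>i j. i \<in> E \<Longrightarrow> j \<in> E \<Longrightarrow> column A j \<le>\<^sub>T fjoin g (column A i)"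
proof -
  define h where "h m = (if pfst m \<in> E then 0 else column A (pfst m) (psnd m))" for m
  have h1: "column A j \<le>\<^sub>T h" if "j \<notin> E" for j
    by (rule turing_leI[where F = "\<lambda>g x. g (npair j x)" and D = UNIV], intro comp_intros)
      (use that in \<open>simp_all add: h_def\<close>)
  have h2: "\<not> column A i \<le>\<^sub>T h" if i: "i \<in> E" for i
  proof
    assume "column A i \<le>\<^sub>T h"
    moreover have "h \<le>\<^sub>T other_columns A i"
    proof (rule turing_leI[where F = "\<lambda>g x. if pfst x \<in> E then 0 else g x" and D = UNIV])
      show "comp_on UNIV (\<lambda>g x. if pfst x \<in> E then 0 else g x)"
        by (intro comp_intros dec_on_comp[OF dec_on_finite[OF E]])
      show "(\<lambda>x. if pfst x \<in> E then 0 else other_columns A i x) = h"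
        using i by (auto simp: h_def other_columns_def case_prod_beta)
    qed simp
    ultimately show False using A turing_trans unfolding computably_independent_def by blast
  qed
  have "\<exists>g. h \<le>\<^sub>T g \<and> (\<forall>i\<in>E. \<not> column A i \<le>\<^sub>T g) \<and>
      (\<forall>(i, j)\<in>S. column A j \<le>\<^sub>T fjoin g (column A i))"
    if "finite S" "S \<subseteq> E \<times> E" for S
    using that
  proof (induction S rule: finite_induct)
    case empty
    show ?case by (rule exI[of _ h]) (use h2 turing_refl in simp)
  next
    case (insert ij S)
    obtain i j where ij: "ij = (i, j)" "i \<in> E" "j \<in> E" using insert.prems by auto
    obtain g where g: "h \<le>\<^sub>T g" "\<forall>i\<in>E. \<not> column A i \<le>\<^sub>T g"
      "\<forall>(i, j)\<in>S. column A j \<le>\<^sub>T fjoin g (column A i)"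
      using insert.IH insert.prems by blast
    \<comment> \<open>The avoided family is indexed by all numbers; indices outside \<open>E\<close>
      repeat column \<open>i\<close>.\<close>
    obtain G where G: "column A j \<le>\<^sub>T fjoin (fjoin g G) (column A i)"
      "\<And>k. \<not> (if k \<in> E then column A k else column A i) \<le>\<^sub>T fjoin g G"
    proof (rule join_avoiding[of "column A i" g "\<lambda>k. if k \<in> E then column A k else column A i" "column A j"])
      show "\<not> column A i \<le>\<^sub>T g" using g(2) ij by blast
      show "column A i n \<le> 1" for n by (simp add: column_def char_fun_def)
      show "\<not> (if k \<in> E then column A k else column A i) \<le>\<^sub>T g" for k using g(2) ij by simp
    qed blast
    have "\<not> column A k \<le>\<^sub>T fjoin g G" if "k \<in> E" for k using G(2)[of k] that by simp
    moreover have "h \<le>\<^sub>T fjoin g G" using turing_trans[OF g(1) turing_join1] .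
    moreover have "column A j' \<le>\<^sub>T fjoin (fjoin g G) (column A i')" if "(i', j') \<in> S" for i' j'
    proof -
      have "column A j' \<le>\<^sub>T fjoin g (column A i')" using g(3) that by blast
      from turing_trans[OF this turing_join_mono[OF turing_join1 turing_refl]] show ?thesis .
    qed
    ultimately show ?case using G(1) ij(1) by (intro exI[of _ "fjoin g G"]) auto
  qed
  from this[of "E \<times> E"] obtain g where g: "h \<le>\<^sub>T g" "\<forall>i\<in>E. \<not> column A i \<le>\<^sub>T g"
      "\<forall>(i, j)\<in>E \<times> E. column A j \<le>\<^sub>T fjoin g (column A i)" using E by auto
  show thesis
  proof (rule that)
    show "column A i \<le>\<^sub>T g" if "i \<notin> E" for i using turing_trans[OF h1[OF that] g(1)] .
  qed (use g in auto)
qed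

section \<open>Embedding simplicial complexes\<close>

text \<open>
  The vertices \<open>v\<close> lying in some \<open>H i\<close> span a simplicial complex whose minimal non-faces are among
  the sets \<open>H i\<close>. The enumeration \<open>K\<close> lists the finitely many faces and then the sets \<open>H i\<close>.
\<close>

locale vertex_system =
  fixes a :: "nat \<Rightarrow> nat \<Rightarrow> nat" and H :: "nat \<Rightarrow> 'v set" and g :: "'v \<Rightarrow> nat \<Rightarrow> nat"
    and M :: nat and K :: "nat \<Rightarrow> 'v set"
  assumes g_above: "v \<in> (\<Union>i. H i) \<Longrightarrow> v \<notin> H i \<Longrightarrow> a i \<le>\<^sub>T g v"
    and g_avoids: "v \<in> H i \<Longrightarrow> \<not> a i \<le>\<^sub>T g v"
    and g_join: "v \<in> H i \<Longrightarrow> v \<in> H j \<Longrightarrow> a j \<le>\<^sub>T fjoin (g v) (a i)"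
    and H_nonempty: "H i \<noteq> {}"
    and finite_occurrences: "v \<in> H j \<Longrightarrow> finite {i. v \<in> H i}"
    and separated: "v \<in> (\<Union>i. H i) \<Longrightarrow> w \<in> (\<Union>i. H i) \<Longrightarrow> v \<noteq> w \<Longrightarrow> \<exists>i. (v \<in> H i) \<noteq> (w \<in> H i)"
    and K_faces: "K ` {..<M} = {L. L \<subseteq> (\<Union>i. H i) \<and> (\<forall>i. \<not> H i \<subseteq> L)}"
    and finite_face: "k < M \<Longrightarrow> finite (K k)"
    and K_nonfaces: "K (M + i) = H i"
begin

section \<open>The pieces \<open>r v\<close> and their separation by the functions
  \<open>g v\<close>\<close>

definition V :: "'v set" where "V = (\<Union>i. H i)"

definition nonface :: "'v set \<Rightarrow> bool" where "nonface L \<longleftrightarrow> (\<exists>i. H i \<subseteq> L)"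

definition r :: "'v \<Rightarrow> mass_problem" where
  "r v = {f. \<forall>i. a i \<le>\<^sub>T fjoin f (g v)}"

definition Y :: mass_problem where
  "Y = {f. \<forall>i x. (\<forall>v\<in>H i. x \<in> r v) \<longrightarrow> a i \<le>\<^sub>T fjoin f x}"

definition X :: "'v set \<Rightarrow> mass_problem" where
  "X L = {f \<in> Y. \<forall>v\<in>L. f \<in> r v}"

lemma r_up: "f \<in> r v \<Longrightarrow> f \<le>\<^sub>T f' \<Longrightarrow> f' \<in> r v"
  unfolding r_def using turing_trans[OF _ turing_join_mono[OF _ turing_refl]] by blast

lemma Y_up: "f \<in> Y \<Longrightarrow> f \<le>\<^sub>T f' \<Longrightarrow> f' \<in> Y"
  unfolding Y_def using turing_trans[OF _ turing_join_mono[OF _ turing_refl]] by blast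

lemma X_up: "f \<in> X L \<Longrightarrow> f \<le>\<^sub>T f' \<Longrightarrow> f' \<in> X L"
  unfolding X_def using r_up Y_up by blast

lemma X_antimono: "L \<subseteq> L' \<Longrightarrow> X L' \<subseteq> X L"
  unfolding X_def by blast

lemma H_subset_V: "H i \<subseteq> V"
  unfolding V_def by blast

text \<open>A column that \<open>g v\<close> avoids unlocks it: by \<open>g_join\<close> it yields
  the other avoided columns, and the remaining ones are below \<open>g v\<close> anyway.\<close>

lemma r_if_above: assumes v: "v \<in> H i" and x: "a i \<le>\<^sub>T x" shows "x \<in> r v"
proof -
  have "a j \<le>\<^sub>T fjoin x (g v)" for j
  proof (cases "v \<in> H j")
    case True
    have "fjoin (g v) (a i) \<le>\<^sub>T fjoin x (g v)"
      unfolding turing_join_iff using turing_join2 turing_trans[OF x turing_join1] by blast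
    then show ?thesis using turing_trans[OF g_join[OF v True]] by blast
  next
    case False
    then show ?thesis using turing_trans[OF g_above turing_join2] v by blast
  qed
  then show ?thesis unfolding r_def by blast
qed

text \<open>If \<open>w\<close> lies in \<open>H i\<close>, the assumption on \<open>x\<close> at
  the vertex \<open>w\<close> itself already gives column \<open>i\<close>; otherwise
  \<open>g w\<close> computes this column alone.\<close>

lemma g_in_Y: assumes "w \<in> V" shows "g w \<in> Y"
proof -
  have "a i \<le>\<^sub>T fjoin (g w) x" if x: "\<forall>v\<in>H i. x \<in> r v" for i x
  proof (cases "w \<in> H i")
    case True
    then have "a i \<le>\<^sub>T fjoin x (g w)" using x unfolding r_def by blast
    moreover have "fjoin x (g w) \<le>\<^sub>T fjoin (g w) x"
      unfolding turing_join_iff using turing_join1 turing_join2 by blast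
    ultimately show ?thesis by (rule turing_trans)
  next
    case False
    then show ?thesis using turing_trans[OF g_above turing_join1] assms unfolding V_def by blast
  qed
  then show ?thesis unfolding Y_def by blast
qed

text \<open>For distinct vertices some column is below exactly one of \<open>g v\<close> and
  \<open>g w\<close> and unlocks the other, so their join computes all columns. Joining
  \<open>g v\<close> with itself, however, adds nothing.\<close>

lemma g_in_r_iff: assumes v: "v \<in> V" and w: "w \<in> V" shows "g w \<in> r v \<longleftrightarrow> w \<noteq> v"
proof
  assume gw: "g w \<in> r v"
  show "w \<noteq> v"
  proof
    assume "w = v"
    obtain i where i: "v \<in> H i" using v unfolding V_def by blast
    have "a i \<le>\<^sub>T fjoin (g v) (g v)" using gw \<open>w = v\<close> unfolding r_def by blast
    moreover have "fjoin (g v) (g v) \<le>\<^sub>T g v" unfolding turing_join_iff using turing_refl by blast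
    ultimately show False using g_avoids[OF i] turing_trans by blast
  qed
next
  assume "w \<noteq> v"
  then obtain i where i: "(v \<in> H i) \<noteq> (w \<in> H i)"
    using separated[of v w] v w unfolding V_def by blast
  have all: "a j \<le>\<^sub>T fjoin (g p) (g q)" if p: "p \<in> V" and i: "p \<in> H i" "a i \<le>\<^sub>T g q" for p q j
  proof (cases "p \<in> H j")
    case True
    then show ?thesis
      using turing_trans[OF g_join[OF i(1) True] turing_join_mono[OF turing_refl i(2)]] by blast
  next
    case False
    then show ?thesis using turing_trans[OF g_above turing_join1] p unfolding V_def by blast
  qed
  have swap: "fjoin (g v) (g w) \<le>\<^sub>T fjoin (g w) (g v)"
    unfolding turing_join_iff using turing_join1 turing_join2 by blast
  show "g w \<in> r v"
  proof (cases "w \<in> H i")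
    case True
    then have "a i \<le>\<^sub>T g v" using i g_above v unfolding V_def by blast
    then show ?thesis unfolding r_def using all[OF w True] by blast
  next
    case False
    then have "v \<in> H i" "a i \<le>\<^sub>T g w" using i g_above w unfolding V_def by blast+
    then show ?thesis unfolding r_def using turing_trans[OF all[OF v] swap] by blast
  qed
qed

lemma g_in_X: assumes "v \<in> V" "L \<subseteq> V" "v \<notin> L" shows "g v \<in> X L"
  unfolding X_def using g_in_Y[OF assms(1)] g_in_r_iff[OF _ assms(1)] assms(2,3) by blast

text \<open>One test point suffices: \<open>g v\<close> lies in \<open>X L\<close>, and joining it
  to \<open>f\<close> has no effect, since the definition of \<open>r v\<close> joins
  \<open>g v\<close> anyway.\<close>

lemma r_residual:
  assumes v: "v \<in> V" "v \<notin> L" "L \<subseteq> V" and f: "\<And>x. x \<in> X L \<Longrightarrow> fjoin x f \<in> r v"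
  shows "f \<in> r v"
proof -
  have "fjoin (g v) f \<in> r v" using f g_in_X v by blast
  then have "a i \<le>\<^sub>T fjoin (fjoin (g v) f) (g v)" for i unfolding r_def by blast
  moreover have "fjoin (fjoin (g v) f) (g v) \<le>\<^sub>T fjoin f (g v)"
    unfolding turing_join_iff using turing_join1 turing_join2 by blast
  ultimately show ?thesis unfolding r_def using turing_trans by blast
qed

lemma X_H_iff: "f \<in> X (H i) \<longleftrightarrow> f \<in> Y \<and> a i \<le>\<^sub>T f"
proof
  assume f: "f \<in> X (H i)"
  \<comment> \<open>The definition of \<open>Y\<close> is applied with \<open>f\<close> itself as
    \<open>x\<close>.\<close>
  then have "a i \<le>\<^sub>T fjoin f f" unfolding X_def Y_def by blast
  moreover have "fjoin f f \<le>\<^sub>T f" unfolding turing_join_iff using turing_refl by blast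
  ultimately have "a i \<le>\<^sub>T f" by (rule turing_trans)
  then show "f \<in> Y \<and> a i \<le>\<^sub>T f" using f unfolding X_def by blast
next
  assume "f \<in> Y \<and> a i \<le>\<^sub>T f"
  then show "f \<in> X (H i)" unfolding X_def using r_if_above by blast
qed

section \<open>Indices of vertex sets and upward closed predicates\<close>

lemma K_subset_V: "K k \<subseteq> V"
proof (cases "k < M")
  case True
  then have "K k \<in> K ` {..<M}" by blast
  then show ?thesis unfolding K_faces V_def by blast
next
  case False
  then show ?thesis using K_nonfaces[of "k - M"] H_subset_V by simp
qed

lemma nonface_K_iff: "nonface (K k) \<longleftrightarrow> M \<le> k"
proof (cases "k < M")
  case True
  then have "K k \<in> K ` {..<M}" by blast
  then show ?thesis using True unfolding K_faces nonface_def by auto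
next
  case False
  then have "K k = H (k - M)" using K_nonfaces[of "k - M"] by simp
  then show ?thesis using False unfolding nonface_def by auto
qed

lemma face_index: assumes "L \<subseteq> V" "\<not> nonface L" obtains k where "k < M" "K k = L"
proof -
  have "L \<in> K ` {..<M}" using assms unfolding K_faces V_def nonface_def by blast
  then show thesis using that by blast
qed

lemma not_nonface_empty: "\<not> nonface {}"
  unfolding nonface_def using H_nonempty by blast

text \<open>Non-faces stand for an inconsistent world, so an admissible proposition holds at all of
  them and is determined within \<open>V\<close> by the finitely many faces.\<close>

definition up_closed :: "('v set \<Rightarrow> bool) \<Rightarrow> bool" where
  "up_closed Q \<longleftrightarrow> (\<forall>L L'. L \<subseteq> L' \<longrightarrow> Q L \<longrightarrow> Q L') \<and> (\<forall>i. Q (H i))"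

lemma up_closedI:
  "(\<And>L L'. L \<subseteq> L' \<Longrightarrow> Q L \<Longrightarrow> Q L') \<Longrightarrow> (\<And>i. Q (H i)) \<Longrightarrow> up_closed Q"
  unfolding up_closed_def by simp

lemma up_closed_H: "up_closed Q \<Longrightarrow> Q (H i)"
  unfolding up_closed_def by simp

lemma up_closedD: "up_closed Q \<Longrightarrow> L \<subseteq> L' \<Longrightarrow> Q L \<Longrightarrow> Q L'"
  unfolding up_closed_def by blast

lemma up_closed_nonface: "up_closed Q \<Longrightarrow> nonface L \<Longrightarrow> Q L"
  unfolding up_closed_def nonface_def by blast

text \<open>Only faces and the sets \<open>H i\<close> have indices. A non-face is replaced by some
  \<open>H i\<close> inside it, where every admissible proposition holds anyway.\<close>

lemma index_exists:
  assumes "L \<subseteq> V" shows "\<exists>k. K k \<subseteq> L \<and> (\<forall>Q. up_closed Q \<longrightarrow> Q L \<longrightarrow> Q (K k))"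
proof (cases "nonface L")
  case True
  then obtain i where "H i \<subseteq> L" unfolding nonface_def by blast
  then show ?thesis using K_nonfaces[of i] unfolding up_closed_def by (intro exI[of _ "M + i"]) simp
next
  case False
  from face_index[OF assms this] obtain k where "k < M" "K k = L" .
  then show ?thesis by (intro exI[of _ k]) simp
qed

text \<open>The meet of the problems \<open>X (K k)\<close> with \<open>Q (K k)\<close>, as a
  disjoint union tagged by \<open>k\<close>, since it may range over infinitely many sets
  \<open>H i\<close>.\<close>

definition D :: "('v set \<Rightarrow> bool) \<Rightarrow> mass_problem" where
  "D Q = {k \<frown> f | k f. Q (K k) \<and> f \<in> X (K k)}"

lemma D_iff: "f \<in> D Q \<longleftrightarrow> Q (K (f 0)) \<and> (\<lambda>i. f (Suc i)) \<in> X (K (f 0))"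
proof
  assume "f \<in> D Q"
  then show "Q (K (f 0)) \<and> (\<lambda>i. f (Suc i)) \<in> X (K (f 0))" unfolding D_def by auto
next
  assume "Q (K (f 0)) \<and> (\<lambda>i. f (Suc i)) \<in> X (K (f 0))"
  then show "f \<in> D Q" unfolding D_def using fun_of_fcons[of f] by blast
qed

lemma D_mono: assumes "\<And>k. Q (K k) \<Longrightarrow> Q' (K k)" shows "medvedev_le (D Q') (D Q)"
proof (rule medvedev_leI)
  show "comp_on (D Q) (\<lambda>f x. f x)" by (intro comp_intros)
qed (use assms in \<open>simp add: D_iff\<close>)

lemma Y_le_D: "medvedev_le Y (D Q)"
proof (rule medvedev_leI)
  show "comp_on (D Q) (\<lambda>f x. f (Suc x))" by (intro comp_intros)
qed (auto simp: D_iff X_def)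

lemma D_le_X: assumes "Q (K k)" shows "medvedev_le (D Q) (X (K k))"
proof (rule medvedev_leI)
  show "comp_on (X (K k)) (\<lambda>f x. (k \<frown> f) x)" by (intro comp_intros)
qed (use assms in \<open>simp add: D_iff\<close>)

lemma D_True_le_Y: "medvedev_le (D (\<lambda>_. True)) Y"
proof -
  obtain k where "k < M" "K k = {}" using face_index[OF _ not_nonface_empty] by blast
  moreover have "X {} = Y" unfolding X_def by blast
  ultimately show ?thesis using D_le_X[of "\<lambda>_. True" k] by simp
qed

text \<open>The predicate can fail only at the finitely many indices of faces, so a finite table
  decides it, whatever \<open>Q\<close> is.\<close>

lemma dec_on_index [comp_intros]:
  assumes "up_closed Q" "comp_on E F" shows "dec_on E (\<lambda>g x. Q (K (F g x)))"
proof (rule dec_on_comp[OF _ assms(2)])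
  have "k < M" if "\<not> Q (K k)" for k
    using that up_closed_nonface[OF assms(1), of "K k"] nonface_K_iff[of k] by linarith
  then have "{k. \<not> Q (K k)} \<subseteq> {..<M}" by blast
  then show "dec_on E (\<lambda>g k. Q (K k))" by (intro dec_on_cofinite finite_subset[OF _ finite_lessThan])
qed

text \<open>The join of the two tails lies in \<open>X\<close> of the union of the two vertex sets,
  so only an index for a suitable subset of this union has to be computed. An index of a non-face
  can be kept, which leaves finitely many pairs to be tabulated.\<close>

lemma D_join_le:
  assumes Q: "up_closed Q" "up_closed Q'"
  shows "medvedev_le (D (\<lambda>L. Q L \<and> Q' L)) (mass_join (D Q) (D Q'))"
proof -
  have "\<exists>k. K k \<subseteq> K i \<union> K j \<and> (\<forall>Q. up_closed Q \<longrightarrow> Q (K i \<union> K j) \<longrightarrow> Q (K k))" for i j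
    using index_exists[of "K i \<union> K j"] K_subset_V by blast
  then obtain idx where idx: "\<And>i j. K (idx i j) \<subseteq> K i \<union> K j"
    "\<And>i j Q. up_closed Q \<Longrightarrow> Q (K i \<union> K j) \<Longrightarrow> Q (K (idx i j))" by metis
  define u where "u z = (if M \<le> pfst z then pfst z else if M \<le> psnd z then psnd z
    else idx (pfst z) (psnd z))" for z
  have u1: "K (u (npair i j)) \<subseteq> K i \<union> K j" for i j unfolding u_def using idx(1) by auto
  have u2: "Q (K (u (npair i j)))" if "up_closed Q" "Q (K i \<union> K j)" for i j Q
    unfolding u_def using idx(2)[OF that] up_closed_nonface[OF that(1)] nonface_K_iff by auto
  have "{z. u z \<noteq> (if M \<le> pfst z then pfst z else psnd z)} \<subseteq> prod_encode ` ({..<M} \<times> {..<M})"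
  proof
    fix z assume "z \<in> {z. u z \<noteq> (if M \<le> pfst z then pfst z else psnd z)}"
    then have "pfst z < M" "psnd z < M" unfolding u_def by (auto split: if_splits)
    then have "(pfst z, psnd z) \<in> {..<M} \<times> {..<M}" by (simp add: mem_Times_iff)
    then have "npair (pfst z) (psnd z) \<in> prod_encode ` ({..<M} \<times> {..<M})" by (rule imageI)
    then show "z \<in> prod_encode ` ({..<M} \<times> {..<M})" by simp
  qed
  then have fin: "finite {z. u z \<noteq> (if M \<le> pfst z then pfst z else psnd z)}"
    by (rule finite_subset) simp
  have uc: "comp_on E (\<lambda>_. u)" for E
    by (rule comp_on_finite_change[OF _ fin]) (intro comp_intros)
  show ?thesis
  proof (rule medvedev_leI)
    let ?F = "\<lambda>h. u (npair (h 0) (h 1)) \<frown> fjoin (\<lambda>i. h (2 * Suc i)) (\<lambda>i. h (Suc (2 * Suc i)))"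
    show "comp_on (mass_join (D Q) (D Q')) (\<lambda>h x. ?F h x)"
      by (intro comp_intros comp_on_comp[OF uc])
    fix h assume "h \<in> mass_join (D Q) (D Q')"
    then obtain f f' where h: "h = fjoin f f'" and f: "f \<in> D Q" "f' \<in> D Q'"
      unfolding mass_join_def by blast
    have "h 0 = f 0" "h 1 = f' 0" using fjoin_simps[of f f' 0] unfolding h by simp_all
    then have Fh: "?F h = u (npair (f 0) (f' 0)) \<frown> fjoin (\<lambda>i. f (Suc i)) (\<lambda>i. f' (Suc i))"
      unfolding h fjoin_simps by simp
    let ?f = "fjoin (\<lambda>i. f (Suc i)) (\<lambda>i. f' (Suc i))"
    have "Q (K (f 0))" "Q' (K (f' 0))" using f unfolding D_iff by blast+
    then have "Q (K (f 0) \<union> K (f' 0))" "Q' (K (f 0) \<union> K (f' 0))"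
      using up_closedD[OF Q(1)] up_closedD[OF Q(2)] by (meson sup_ge1 sup_ge2)+
    then have "Q (K (u (npair (f 0) (f' 0))))" "Q' (K (u (npair (f 0) (f' 0))))"
      using u2 Q by blast+
    moreover have "?f \<in> X (K (f 0))" "?f \<in> X (K (f' 0))"
      using f X_up turing_join1 turing_join2 unfolding D_iff by blast+
    then have "?f \<in> X (K (f 0) \<union> K (f' 0))" unfolding X_def by blast
    then have "?f \<in> X (K (u (npair (f 0) (f' 0))))" using X_antimono[OF u1] by blast
    ultimately show "?F h \<in> D (\<lambda>L. Q L \<and> Q' L)" unfolding Fh by (simp add: D_iff)
  qed
qed

lemma D_meet_le:
  assumes "up_closed Q"
  shows "medvedev_le (mass_meet (D Q) (D Q')) (D (\<lambda>L. Q L \<or> Q' L))"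
proof (rule medvedev_leI)
  let ?F = "\<lambda>f. (if Q (K (f 0)) then 0 else 1) \<frown> f"
  show "comp_on (D (\<lambda>L. Q L \<or> Q' L)) (\<lambda>f x. ?F f x)"
    by (intro comp_intros assms)
  show "?F f \<in> mass_meet (D Q) (D Q')" if "f \<in> D (\<lambda>L. Q L \<or> Q' L)" for f
  proof -
    have "f \<in> (if Q (K (f 0)) then D Q else D Q')" using that by (auto simp: D_iff)
    then show ?thesis unfolding mass_meet_def by (auto split: if_splits)
  qed
qed

text \<open>
  \<open>X L\<close> is closed under prepending finite sequences, so \<open>F\<close> commits itself to an index \<open>t\<close> after
  reading a finite part of its first argument, and this part can be found by a search.
\<close>

lemma selection:
  assumes F: "comp_on (mass_join (X L) Z) F" "\<And>h. h \<in> mass_join (X L) Z \<Longrightarrow> F h \<in> D Q"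
    and L: "L \<subseteq> V" "\<not> nonface L"
  obtains t where "comp_on Z (\<lambda>z _. t z)"
    "\<And>z. z \<in> Z \<Longrightarrow> Q (K (t z))" "\<And>z x. z \<in> Z \<Longrightarrow> x \<in> X L \<Longrightarrow> fjoin x z \<in> X (K (t z))"
proof -
  obtain p where "\<forall>h\<in>mass_join (X L) Z. \<forall>n. run h p n = Some (F h n)"
    using F(1) unfolding comp_on_def by blast
  then have p: "run (fjoin x z) p n = Some (F (fjoin x z) n)" if "x \<in> X L" "z \<in> Z" for x z n
    using that unfolding mass_join_def by blast
  let ?Q = "\<lambda>z w. cert (fjoin (seq_nth (pfst w)) z) (psnd w) \<and> (\<exists>y\<le>psnd w. fact_in (psnd w) (prog_num p) 0 y)"
  have ex: "\<exists>w. ?Q z w" if z: "z \<in> Z" for z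
  proof -
    \<comment> \<open>As \<open>L\<close> contains no \<open>H i\<close>, some vertex lies outside
      \<open>L\<close>, and its \<open>g v\<close> ensures that the search succeeds.\<close>
    obtain v where "v \<in> V" "v \<notin> L" using L(2) H_subset_V unfolding nonface_def by blast
    then have x: "g v \<in> X L" using g_in_X L(1) by blast
    obtain c where c: "cert (fjoin (g v) z) c" "fact_in c (prog_num p) 0 (F (fjoin (g v) z) 0)"
      using cert_complete[OF p[OF x z]] by blast
    obtain s where s: "pfst s = Suc c" "\<forall>i<Suc c. seq_nth s i = g v i" using seq_exists by blast
    have "cert (fjoin (seq_nth s) z) c"
      by (rule cert_use[OF c(1)]) (use s in \<open>simp add: fjoin_def\<close>)
    then show ?thesis using c(2) fact_in_le(3)[OF c(2)] by (intro exI[of _ "npair s c"]) auto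
  qed
  define w where "w z = (LEAST w. ?Q z w)" for z
  define t where "t z = (LEAST y. fact_in (psnd (w z)) (prog_num p) 0 y)" for z
  have w: "?Q z (w z)" if "z \<in> Z" for z unfolding w_def by (rule LeastI_ex[OF ex[OF that]])
  have ext: "\<exists>y. fact_in (psnd (w z)) (prog_num p) 0 y" if "z \<in> Z" for z using w[OF that] by blast
  have t: "fact_in (psnd (w z)) (prog_num p) 0 (t z)" if "z \<in> Z" for z
    unfolding t_def by (rule LeastI_ex[OF ext[OF that]])
  have "comp_on Z (\<lambda>z _. t z)"
    unfolding t_def using ext unfolding w_def by (intro comp_intros ex) blast
  moreover have "Q (K (t z)) \<and> fjoin x z \<in> X (K (t z))" if z: "z \<in> Z" and x: "x \<in> X L" for z x
  proof -
    define s c where "s = pfst (w z)" and "c = psnd (w z)"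
    have c: "cert (fjoin (seq_nth s) z) c" "fact_in c (prog_num p) 0 (t z)"
      using w[OF z] t[OF z] unfolding s_def c_def by blast+
    \<comment> \<open>The finite part found by the search followed by all of \<open>x\<close>. This
      does not change the Turing degree, so \<open>x'\<close> stays in \<open>X L\<close>, and
      \<open>F\<close> is bound to choose the index \<open>t z\<close> for it.\<close>
    define x' where "x' i = (if i < Suc c then seq_nth s i else x (i - Suc c))" for i
    have "x \<le>\<^sub>T x'"
      by (rule turing_leI[where F = "\<lambda>g i. g (i + Suc c)" and D = UNIV], intro comp_intros)
        (simp_all add: x'_def)
    then have x': "x' \<in> X L" using x X_up by blast
    have "x' \<le>\<^sub>T x"
      by (rule turing_leI[where F = "\<lambda>g i. if i < Suc c then seq_nth s i else g (i - Suc c)" and D = UNIV],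
          intro comp_intros) (simp_all add: x'_def fun_eq_iff)
    then have le: "fjoin x' z \<le>\<^sub>T fjoin x z" by (rule turing_join_mono[OF _ turing_refl])
    have "cert (fjoin x' z) c"
    proof (rule cert_use[OF c(1)])
      fix i assume "i \<le> c"
      then have "i div 2 < Suc c" by linarith
      then show "fjoin x' z i = fjoin (seq_nth s) z i" by (simp add: fjoin_def x'_def)
    qed
    from cert_sound[OF this c(2)] have F0: "F (fjoin x' z) 0 = t z" using p[OF x' z] by simp
    have mem: "fjoin x' z \<in> mass_join (X L) Z" unfolding mass_join_def using x' z by blast
    have "F (fjoin x' z) \<in> D Q" by (rule F(2)[OF mem])
    then have FD: "Q (K (t z))" "(\<lambda>i. F (fjoin x' z) (Suc i)) \<in> X (K (t z))"
      unfolding D_iff F0 by blast+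
    have "(\<lambda>i. F (fjoin x' z) (Suc i)) \<le>\<^sub>T fjoin x' z"
      by (rule turing_leI[OF comp_on_comp[OF F(1) comp_on_Suc[OF comp_on_id]] mem]) simp
    from turing_trans[OF this le] have "fjoin x z \<in> X (K (t z))" using X_up[OF FD(2)] by blast
    then show ?thesis using FD(1) by blast
  qed
  moreover have "\<exists>x. x \<in> X L"
    using L H_subset_V g_in_X unfolding nonface_def by blast
  ultimately show thesis using that[of t] by blast
qed

text \<open>By \<open>selection\<close> one index \<open>t z\<close> is valid for every
  \<open>x\<close> in \<open>X L\<close>, and \<open>r_residual\<close> then removes
  \<open>x\<close> at the vertices outside \<open>L\<close>. So \<open>z\<close> joined with a
  member of \<open>Y\<close> lies in \<open>X (K (t z) - L)\<close>.\<close>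

lemma residual_X_le:
  assumes Q: "up_closed Q" and L: "L \<subseteq> V" "\<not> nonface L"
    and le: "medvedev_le (D Q) (mass_join (X L) Z)" and YZ: "medvedev_le Y Z"
  shows "medvedev_le (D (\<lambda>L'. Q (L' \<union> L))) Z"
proof -
  obtain F where F: "comp_on (mass_join (X L) Z) F" "\<And>h. h \<in> mass_join (X L) Z \<Longrightarrow> F h \<in> D Q"
    using le unfolding medvedev_le_iff by blast
  obtain y where y: "comp_on Z y" "\<And>z. z \<in> Z \<Longrightarrow> y z \<in> Y" using YZ unfolding medvedev_le_iff by blast
  obtain t where t: "comp_on Z (\<lambda>z _. t z)" "\<And>z. z \<in> Z \<Longrightarrow> Q (K (t z))"
    "\<And>z x. z \<in> Z \<Longrightarrow> x \<in> X L \<Longrightarrow> fjoin x z \<in> X (K (t z))"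
    using selection[OF F L] by blast
  have "\<exists>k. K k \<subseteq> K i - L \<and> (\<forall>Q. up_closed Q \<longrightarrow> Q (K i - L) \<longrightarrow> Q (K k))" for i
    using index_exists[of "K i - L"] K_subset_V by blast
  then obtain idx where idx: "\<And>i. K (idx i) \<subseteq> K i - L"
    "\<And>i Q. up_closed Q \<Longrightarrow> Q (K i - L) \<Longrightarrow> Q (K (idx i))" by metis
  \<comment> \<open>A set \<open>K i\<close> disjoint from \<open>L\<close> keeps its index. As
    \<open>L\<close> is finite and every vertex lies in finitely many \<open>H i\<close>, only
    finitely many indices change.\<close>
  define s where "s i = (if K i \<inter> L = {} then i else idx i)" for i
  have s: "K (s i) \<subseteq> K i - L" "up_closed Q \<Longrightarrow> Q (K i - L) \<Longrightarrow> Q (K (s i))" for i Q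
    unfolding s_def using idx(1)[of i] idx(2)[of Q i] by (auto simp: Diff_triv)
  obtain l where "l < M" "K l = L" using face_index[OF L] .
  then have finL: "finite L" using finite_face by blast
  have "{k. K k \<inter> L \<noteq> {}} \<subseteq> {..<M} \<union> (\<lambda>i. M + i) ` (\<Union>v\<in>L. {i. v \<in> H i})"
  proof
    fix k assume k: "k \<in> {k. K k \<inter> L \<noteq> {}}"
    show "k \<in> {..<M} \<union> (\<lambda>i. M + i) ` (\<Union>v\<in>L. {i. v \<in> H i})"
    proof (cases "k < M")
      case False
      then have "k = M + (k - M)" by simp
      moreover have "k - M \<in> (\<Union>v\<in>L. {i. v \<in> H i})" using k K_nonfaces[of "k - M"] False by auto
      ultimately show ?thesis by blast
    qed simp
  qed
  moreover have "finite (\<Union>v\<in>L. {i. v \<in> H i})"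
    using finL finite_occurrences L(1) unfolding V_def by blast
  ultimately have "finite {k. K k \<inter> L \<noteq> {}}" using finite_subset by blast
  then have "finite {k. s k \<noteq> k}" by (rule rev_finite_subset) (auto simp: s_def)
  then have sc: "comp_on Z (\<lambda>_. s)" by (rule comp_on_finite_change[OF comp_on_id])
  have upL: "up_closed (\<lambda>L'. Q (L' \<union> L))"
    unfolding up_closed_def
  proof (intro conjI allI impI)
    show "Q (L'' \<union> L)" if "L' \<subseteq> L''" "Q (L' \<union> L)" for L' L''
      by (rule up_closedD[OF Q _ that(2)]) (use that(1) in blast)
    show "Q (H i \<union> L)" for i by (rule up_closed_nonface[OF Q]) (auto simp: nonface_def)
  qed
  show ?thesis
  proof (rule medvedev_leI)
    let ?F = "\<lambda>z. s (t z) \<frown> fjoin z (y z)"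
    show "comp_on Z (\<lambda>z x. ?F z x)"
      by (intro comp_intros comp_on_comp[OF sc t(1)] comp_on_comp[OF y(1)])
    fix z assume z: "z \<in> Z"
    have "Q (K (t z) - L \<union> L)" by (rule up_closedD[OF Q _ t(2)[OF z]]) blast
    then have "Q (K (s (t z)) \<union> L)" by (rule s(2)[OF upL])
    moreover have "z \<in> r v" if v: "v \<in> K (t z) - L" for v
    proof (rule r_residual[of v L])
      show "v \<in> V" "v \<notin> L" using v K_subset_V by blast+
      show "fjoin x z \<in> r v" if "x \<in> X L" for x using t(3)[OF z that] v unfolding X_def by blast
    qed (rule L(1))
    then have "fjoin z (y z) \<in> X (K (t z) - L)"
      using r_up[OF _ turing_join1] Y_up[OF y(2)[OF z] turing_join2] unfolding X_def by blast
    then have "fjoin z (y z) \<in> X (K (s (t z)))" using X_antimono[OF s(1)] by blast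
    ultimately show "?F z \<in> D (\<lambda>L'. Q (L' \<union> L))" by (simp add: D_iff)
  qed
qed

section \<open>Implication between upward closed predicates\<close>

definition imp_pred :: "('v set \<Rightarrow> bool) \<Rightarrow> ('v set \<Rightarrow> bool) \<Rightarrow> 'v set \<Rightarrow> bool" where
  "imp_pred Q Q' L \<longleftrightarrow> (\<forall>L'. L \<subseteq> L' \<and> L' \<subseteq> V \<longrightarrow> Q L' \<longrightarrow> Q' L')"

lemma up_closed_imp: "up_closed Q' \<Longrightarrow> up_closed (imp_pred Q Q')"
  unfolding up_closed_def imp_pred_def by (meson order_trans)

lemma up_closed_conj:
  assumes "up_closed Q" "up_closed Q'" shows "up_closed (\<lambda>L. Q L \<and> Q' L)"
proof (rule up_closedI)
  show "Q L' \<and> Q' L'" if "L \<subseteq> L'" "Q L \<and> Q' L" for L L'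
    using up_closedD[OF assms(1) that(1)] up_closedD[OF assms(2) that(1)] that(2) by simp
qed (simp add: up_closed_H assms)

lemma up_closed_disj:
  assumes "up_closed Q" "up_closed Q'" shows "up_closed (\<lambda>L. Q L \<or> Q' L)"
proof (rule up_closedI)
  show "Q L' \<or> Q' L'" if "L \<subseteq> L'" "Q L \<or> Q' L" for L L'
    using up_closedD[OF assms(1) that(1)] up_closedD[OF assms(2) that(1)] that(2) by blast
qed (simp add: up_closed_H assms)

lemma up_closed_nonface_pred: "up_closed nonface"
  by (rule up_closedI) (auto simp: nonface_def)

lemma D_imp_upper:
  assumes "up_closed Q" "up_closed Q'"
  shows "medvedev_le (D Q') (mass_join (D Q) (D (imp_pred Q Q')))"
proof -
  have "medvedev_le (D Q') (D (\<lambda>L. Q L \<and> imp_pred Q Q' L))"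
    by (rule D_mono) (use K_subset_V in \<open>auto simp: imp_pred_def\<close>)
  then show ?thesis using D_join_le[OF assms(1) up_closed_imp[OF assms(2)]] medvedev_le_trans by blast
qed

text \<open>Non-faces impose no condition on an implication, so it is enough to take residuals over
  the finitely many faces satisfying \<open>Q\<close> and to form their conjunction. An empty
  conjunction is covered by \<open>D_True_le_Y\<close>.\<close>

lemma D_imp_least:
  assumes Q: "up_closed Q" "up_closed Q'" and YZ: "medvedev_le Y Z"
    and le: "medvedev_le (D Q') (mass_join (D Q) Z)"
  shows "medvedev_le (D (imp_pred Q Q')) Z"
proof -
  have up: "up_closed (\<lambda>L'. Q' (L' \<union> L))" for L
    unfolding up_closed_def
  proof (intro conjI allI impI)
    show "Q' (L'' \<union> L)" if "L' \<subseteq> L''" "Q' (L' \<union> L)" for L' L''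
      by (rule up_closedD[OF Q(2) _ that(2)]) (use that(1) in blast)
    show "Q' (H i \<union> L)" for i by (rule up_closed_nonface[OF Q(2)]) (auto simp: nonface_def)
  qed
  have one: "medvedev_le (D (\<lambda>L'. Q' (L' \<union> K k))) Z" if k: "k < M" "Q (K k)" for k
  proof (rule residual_X_le[OF Q(2) K_subset_V _ _ YZ])
    show "\<not> nonface (K k)" using nonface_K_iff k by simp
    have "medvedev_le (mass_join (D Q) Z) (mass_join (X (K k)) Z)"
      by (intro mass_join_mono D_le_X k medvedev_le_refl)
    then show "medvedev_le (D Q') (mass_join (X (K k)) Z)" using le medvedev_le_trans by blast
  qed
  have "finite S \<Longrightarrow> S \<subseteq> {k. k < M \<and> Q (K k)} \<Longrightarrow>
    medvedev_le (D (\<lambda>L'. \<forall>k\<in>S. Q' (L' \<union> K k))) Z \<and> up_closed (\<lambda>L'. \<forall>k\<in>S. Q' (L' \<union> K k))" for S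
  proof (induction S rule: finite_induct)
    case empty
    then show ?case
      using medvedev_le_trans[OF D_True_le_Y YZ] by (simp add: up_closed_def)
  next
    case (insert k S)
    let ?P = "\<lambda>L'. \<forall>k\<in>S. Q' (L' \<union> K k)"
    have P: "medvedev_le (D ?P) Z" "up_closed ?P" using insert by blast+
    have "medvedev_le (D (\<lambda>L'. Q' (L' \<union> K k))) Z" using one insert.prems by blast
    then have "medvedev_le (D (\<lambda>L'. Q' (L' \<union> K k) \<and> ?P L')) Z"
      using D_join_le[OF up P(2)] mass_join_least[OF _ P(1)] medvedev_le_trans by blast
    then show ?case using up_closed_conj[OF up[of "K k"] P(2)] by simp
  qed
  from this[of "{k. k < M \<and> Q (K k)}"]
  have fin: "medvedev_le (D (\<lambda>L'. \<forall>k\<in>{k. k < M \<and> Q (K k)}. Q' (L' \<union> K k))) Z" by simp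
  have "medvedev_le (D (imp_pred Q Q')) (D (\<lambda>L'. \<forall>k\<in>{k. k < M \<and> Q (K k)}. Q' (L' \<union> K k)))"
  proof (rule D_mono)
    fix k assume all: "\<forall>j\<in>{k. k < M \<and> Q (K k)}. Q' (K k \<union> K j)"
    show "imp_pred Q Q' (K k)"
      unfolding imp_pred_def
    proof (intro allI impI)
      fix L assume L: "K k \<subseteq> L \<and> L \<subseteq> V" "Q L"
      show "Q' L"
      proof (cases "nonface L")
        case True
        then show ?thesis by (rule up_closed_nonface[OF Q(2)])
      next
        case False
        then obtain j where j: "j < M" "K j = L" using face_index L(1) by blast
        then have "Q' (K k \<union> L)" using all L(2) by blast
        moreover have "K k \<union> L = L" using L(1) by blast
        ultimately show ?thesis by simp
      qed
    qed
  qed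
  then show ?thesis using fin medvedev_le_trans by blast
qed

section \<open>The tagged union of cones compared with falsity\<close>

definition C :: mass_problem where
  "C = {i \<frown> f | i f. a i \<le>\<^sub>T f}"

lemma D_nonface_le: "medvedev_le (D nonface) (mass_join C Y)"
proof (rule medvedev_leI)
  let ?F = "\<lambda>h. (M + h 0) \<frown> fjoin (\<lambda>i. h (2 * Suc i)) (\<lambda>i. h (Suc (2 * i)))"
  show "comp_on (mass_join C Y) (\<lambda>h x. ?F h x)" by (intro comp_intros)
  fix h assume "h \<in> mass_join C Y"
  then obtain i f y where h: "h = fjoin (i \<frown> f) y" and f: "a i \<le>\<^sub>T f" "y \<in> Y"
    unfolding mass_join_def C_def by blast
  have "h 0 = i" using fjoin_simps(1)[of "i \<frown> f" y 0] unfolding h by simp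
  then have Fh: "?F h = (M + i) \<frown> fjoin f y" unfolding h fjoin_simps fcons_simps by simp
  have "fjoin f y \<in> X (H i)"
    unfolding X_H_iff using turing_trans[OF f(1) turing_join1] Y_up[OF f(2) turing_join2] by blast
  then show "?F h \<in> D nonface" unfolding Fh by (simp add: D_iff K_nonfaces nonface_def) blast
qed

lemma C_le_D_nonface: "medvedev_le C (D nonface)"
proof (rule medvedev_leI)
  let ?F = "\<lambda>f::nat \<Rightarrow> nat. (f 0 - M) \<frown> (\<lambda>i. f (Suc i))"
  show "comp_on (D nonface) (\<lambda>f x. ?F f x)" by (intro comp_intros)
  fix f assume f: "f \<in> D nonface"
  then have "M \<le> f 0" by (simp add: D_iff nonface_K_iff)
  then have "K (f 0) = H (f 0 - M)" using K_nonfaces[of "f 0 - M"] by simp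
  then have "a (f 0 - M) \<le>\<^sub>T (\<lambda>i. f (Suc i))" using f by (simp add: D_iff X_H_iff)
  then show "?F f \<in> C" unfolding C_def by blast
qed

text \<open>With a dummy second argument, \<open>selection\<close> yields a single index valid for
  all of \<open>Y\<close>. A vertex \<open>v\<close> in its set would be refuted by
  \<open>g v\<close>, which lies in \<open>Y\<close> but not in \<open>r v\<close>; so the set is
  empty.\<close>

lemma D_le_Y_imp:
  assumes "medvedev_le (D Q) Y" shows "Q {}"
proof -
  have XY: "X {} = Y" unfolding X_def by blast
  define z where "z = (\<lambda>_::nat. 0::nat)"
  have "medvedev_le (D Q) (mass_join (X {}) {z})"
    using assms mass_join_upper1 medvedev_le_trans unfolding XY by blast
  then obtain F where F: "comp_on (mass_join (X {}) {z}) F" "\<And>h. h \<in> mass_join (X {}) {z} \<Longrightarrow> F h \<in> D Q"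
    unfolding medvedev_le_iff by blast
  obtain t where "comp_on {z} (\<lambda>z _. t z)" and t: "\<And>z'. z' \<in> {z} \<Longrightarrow> Q (K (t z'))"
    "\<And>z' x. z' \<in> {z} \<Longrightarrow> x \<in> X {} \<Longrightarrow> fjoin x z' \<in> X (K (t z'))"
    by (rule selection[OF F empty_subsetI not_nonface_empty], assumption) (rule that; simp)
  have "v \<notin> K (t z)" for v
  proof
    assume v: "v \<in> K (t z)"
    then have vV: "v \<in> V" using K_subset_V by blast
    have "fjoin (g v) z \<in> r v" using t(2)[of z "g v"] g_in_Y[OF vV] v unfolding XY X_def by blast
    moreover have "z \<le>\<^sub>T g v"
      by (rule turing_leI[where F = "\<lambda>_ _. 0" and D = UNIV]) (simp_all add: comp_on_const z_def)
    then have "fjoin (g v) z \<le>\<^sub>T g v" using turing_refl unfolding turing_join_iff by blast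
  ultimately have "g v \<in> r v" by (rule r_up)
    then show False using g_in_r_iff[OF vV vV] by blast
  qed
  then have "K (t z) = {}" by blast
  then show ?thesis using t(1)[of z] by simp
qed

end

interpretation med: brouwer_algebra medvedev
  by (rule brouwer_algebra_medvedev)

context vertex_system
begin

text \<open>Kripke forcing on sets of vertices, ordered by inclusion; non-faces force every formula.\<close>

primrec forces :: "(nat \<Rightarrow> 'v set \<Rightarrow> bool) \<Rightarrow> form \<Rightarrow> 'v set \<Rightarrow> bool" where
  "forces w (Var p) = w p"
| "forces w Bot = nonface"
| "forces w (And \<phi> \<psi>) = (\<lambda>L. forces w \<phi> L \<and> forces w \<psi> L)"
| "forces w (Or \<phi> \<psi>) = (\<lambda>L. forces w \<phi> L \<or> forces w \<psi> L)"
| "forces w (Imp \<phi> \<psi>) = imp_pred (forces w \<phi>) (forces w \<psi>)"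

section \<open>Evaluation of formulas in the factor\<close>

lemma up_closed_forces: "(\<And>p. up_closed (w p)) \<Longrightarrow> up_closed (forces w \<phi>)"
  by (induction \<phi>) (simp_all add: up_closed_nonface_pred up_closed_conj up_closed_disj up_closed_imp)

text \<open>Meeting with \<open>C\<close> gives the member of the interval below \<open>C\<close>
  that stands for the class of \<open>Z\<close>; joining with \<open>Y\<close> moves it into the
  interval from \<open>Y\<close> to the join of \<open>C\<close> and \<open>Y\<close>, where the
  problems \<open>D Q\<close> live.\<close>

abbreviation relativize :: "mass_problem \<Rightarrow> mass_problem" where
  "relativize Z \<equiv> mass_join (mass_meet Z C) Y"

abbreviation factor_class :: "mass_problem \<Rightarrow> mdegree set" where
  "factor_class Z \<equiv> med.fclass (mdeg C) (mdeg Z)"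

definition represents :: "mass_problem \<Rightarrow> ('v set \<Rightarrow> bool) \<Rightarrow> bool" where
  "represents Z Q \<longleftrightarrow> medvedev_le (relativize Z) (D Q) \<and> medvedev_le (D Q) (relativize Z)"

lemma relativize_le_iff:
  "medvedev_le (relativize Z) W \<longleftrightarrow> medvedev_le (mass_meet Z C) W \<and> medvedev_le Y W"
  by (rule mass_join_le_iff)

lemma le_relativize_meet: "medvedev_le (mass_meet Z C) (relativize Z)"
  by (rule mass_join_upper1)

lemma le_relativize_Y: "medvedev_le Y (relativize Z)"
  by (rule mass_join_upper2)

text \<open>A case distinction on the meet: joining with \<open>Z\<close> preserves meets because it
  has a residual.\<close>

lemma mass_join_meet_le:
  assumes "medvedev_le W (mass_join X1 Z)" "medvedev_le W (mass_join X2 Z)"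
  shows "medvedev_le W (mass_join (mass_meet X1 X2) Z)"
proof -
  have flip: "medvedev_le (mass_join B E) (mass_join E B)" for B E
    by (rule mass_join_least[OF mass_join_upper2 mass_join_upper1])
  have "medvedev_le (mass_imp Z W) X1" "medvedev_le (mass_imp Z W) X2"
    unfolding mass_imp_le_iff using assms flip medvedev_le_trans by blast+
  then have "medvedev_le (mass_imp Z W) (mass_meet X1 X2)" by (rule mass_meet_greatest)
  then have "medvedev_le W (mass_join Z (mass_meet X1 X2))" unfolding mass_imp_le_iff .
  then show ?thesis using flip medvedev_le_trans by blast
qed

lemma represents_Var:
  assumes Q: "up_closed Q" shows "represents (D Q) Q"
  unfolding represents_def
proof
  show "medvedev_le (relativize (D Q)) (D Q)"
    unfolding relativize_le_iff using mass_meet_lower1 Y_le_D by blast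
  show "medvedev_le (D Q) (relativize (D Q))"
  proof (rule mass_join_meet_le[OF mass_join_upper1])
    have "medvedev_le (D Q) (D nonface)"
      by (rule D_mono) (rule up_closed_nonface[OF Q])
    then show "medvedev_le (D Q) (mass_join C Y)" using D_nonface_le medvedev_le_trans by blast
  qed
qed

lemma represents_Bot: "represents {} nonface"
  unfolding represents_def
proof
  show "medvedev_le (relativize {}) (D nonface)"
    unfolding relativize_le_iff
    using medvedev_le_trans[OF mass_meet_lower2 C_le_D_nonface] Y_le_D by blast
  show "medvedev_le (D nonface) (relativize {})"
  proof (rule mass_join_meet_le[OF _ D_nonface_le])
    show "medvedev_le (D nonface) (mass_join {} Y)"
      by (rule medvedev_le_trans[OF medvedev_le_top mass_join_upper1])
  qed
qed

lemma representsD: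
  assumes "represents Z Q"
  shows "medvedev_le (relativize Z) (D Q)" "medvedev_le (D Q) (relativize Z)"
    "medvedev_le (mass_meet Z C) (D Q)"
  using assms medvedev_le_trans[OF le_relativize_meet[of Z], of "D Q"] unfolding represents_def by simp_all

lemma represents_And:
  assumes Z: "represents Z Q" "represents Z' Q'" and Q: "up_closed Q" "up_closed Q'"
  shows "represents (mass_join Z Z') (\<lambda>L. Q L \<and> Q' L)"
  unfolding represents_def
proof
  let ?Q = "\<lambda>L. Q L \<and> Q' L"
  have le: "medvedev_le (D Q) (D ?Q)" "medvedev_le (D Q') (D ?Q)" by (rule D_mono, simp)+
  have comm: "medvedev_le (mass_meet A B) (mass_meet B A)" for A B
    by (rule mass_meet_greatest[OF mass_meet_lower2 mass_meet_lower1])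
  show "medvedev_le (relativize (mass_join Z Z')) (D ?Q)"
    unfolding relativize_le_iff
  proof
    have "medvedev_le (mass_meet C Z) (D ?Q)" "medvedev_le (mass_meet C Z') (D ?Q)"
      by (rule medvedev_le_trans[OF comm medvedev_le_trans[OF representsD(3)[OF Z(1)] le(1)]],
          rule medvedev_le_trans[OF comm medvedev_le_trans[OF representsD(3)[OF Z(2)] le(2)]])
    then have "medvedev_le (mass_join (mass_meet C Z) (mass_meet C Z')) (D ?Q)"
      by (rule mass_join_least)
    from medvedev_le_trans[OF comm medvedev_le_trans[OF meet_join_distrib_le(1) this]]
    show "medvedev_le (mass_meet (mass_join Z Z') C) (D ?Q)" .
  qed (rule Y_le_D)
  have mono: "medvedev_le (relativize Z) (relativize (mass_join Z Z'))"
    "medvedev_le (relativize Z') (relativize (mass_join Z Z'))"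
    by (intro mass_join_mono mass_meet_mono medvedev_le_refl mass_join_upper1 mass_join_upper2)+
  have "medvedev_le (mass_join (D Q) (D Q')) (relativize (mass_join Z Z'))"
    by (rule mass_join_least[OF medvedev_le_trans[OF representsD(2)[OF Z(1)] mono(1)]
        medvedev_le_trans[OF representsD(2)[OF Z(2)] mono(2)]])
  from medvedev_le_trans[OF D_join_le[OF Q] this]
  show "medvedev_le (D ?Q) (relativize (mass_join Z Z'))" .
qed

lemma represents_Or:
  assumes Z: "represents Z Q" "represents Z' Q'" and Q: "up_closed Q" "up_closed Q'"
  shows "represents (mass_meet Z Z') (\<lambda>L. Q L \<or> Q' L)"
  unfolding represents_def
proof
  let ?Q = "\<lambda>L. Q L \<or> Q' L"
  show "medvedev_le (relativize (mass_meet Z Z')) (D ?Q)"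
    unfolding relativize_le_iff
  proof
    have "medvedev_le (mass_meet (mass_meet Z Z') C) (mass_meet Z C)"
      "medvedev_le (mass_meet (mass_meet Z Z') C) (mass_meet Z' C)"
      by (intro mass_meet_mono medvedev_le_refl mass_meet_lower1 mass_meet_lower2)+
    then have "medvedev_le (mass_meet (mass_meet Z Z') C) (mass_meet (D Q) (D Q'))"
      using medvedev_le_trans[OF _ representsD(3)[OF Z(1)]] medvedev_le_trans[OF _ representsD(3)[OF Z(2)]]
      by (intro mass_meet_greatest) simp_all
    from medvedev_le_trans[OF this D_meet_le[OF Q(1)]]
    show "medvedev_le (mass_meet (mass_meet Z Z') C) (D ?Q)" .
  qed (rule Y_le_D)
  have le: "medvedev_le (D ?Q) (D Q)" "medvedev_le (D ?Q) (D Q')" by (rule D_mono, simp)+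
  have leC: "medvedev_le (D ?Q) (D nonface)"
    by (rule D_mono) (use up_closed_nonface[OF Q(1)] in simp)
  have low: "medvedev_le (relativize W) (mass_join W Y)" for W
    by (intro mass_join_mono mass_meet_lower1 medvedev_le_refl)
  show "medvedev_le (D ?Q) (relativize (mass_meet Z Z'))"
    by (intro mass_join_meet_le medvedev_le_trans[OF leC D_nonface_le]
        medvedev_le_trans[OF medvedev_le_trans[OF le(1) representsD(2)[OF Z(1)]] low]
        medvedev_le_trans[OF medvedev_le_trans[OF le(2) representsD(2)[OF Z(2)]] low])
qed

text \<open>By \<open>factor_imp\<close> this problem represents the implication of the factor. It
  already lies below \<open>C\<close>, so meeting it with \<open>C\<close> changes nothing; the two
  directions then come from \<open>D_imp_upper\<close> and \<open>D_imp_least\<close>.\<close>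

lemma represents_Imp:
  assumes Z: "represents Z Q" "represents Z' Q'" and Q: "up_closed Q" "up_closed Q'"
  shows "represents (mass_imp Z (mass_meet Z' C)) (imp_pred Q Q')"
  unfolding represents_def
proof
  let ?I = "mass_imp Z (mass_meet Z' C)"
  show "medvedev_le (relativize ?I) (D (imp_pred Q Q'))"
    unfolding relativize_le_iff
  proof
    let ?J = "mass_join Z (D (imp_pred Q Q'))"
    have "medvedev_le (relativize Z) ?J"
      unfolding relativize_le_iff
      using medvedev_le_trans[OF mass_meet_lower1 mass_join_upper1]
        medvedev_le_trans[OF Y_le_D mass_join_upper2] by simp
    from medvedev_le_trans[OF representsD(2)[OF Z(1)] this]
    have "medvedev_le (mass_join (D Q) (D (imp_pred Q Q'))) ?J"
      by (rule mass_join_least) (rule mass_join_upper2)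
    from medvedev_le_trans[OF representsD(3)[OF Z(2)] medvedev_le_trans[OF D_imp_upper[OF Q] this]]
    have "medvedev_le ?I (D (imp_pred Q Q'))" by (rule mass_imp_le)
    from medvedev_le_trans[OF mass_meet_lower1 this]
    show "medvedev_le (mass_meet ?I C) (D (imp_pred Q Q'))" .
  qed (rule Y_le_D)
  show "medvedev_le (D (imp_pred Q Q')) (relativize ?I)"
  proof (rule D_imp_least[OF Q le_relativize_Y])
    let ?J = "mass_join (D Q) (relativize ?I)"
    have "medvedev_le ?I C"
      unfolding mass_imp_le_iff by (rule medvedev_le_trans[OF mass_meet_lower2 mass_join_upper2])
    then have "medvedev_le ?I (mass_meet ?I C)" by (rule mass_meet_greatest[OF medvedev_le_refl])
    from medvedev_le_trans[OF medvedev_le_trans[OF this le_relativize_meet] mass_join_upper2]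
    have "medvedev_le (mass_join (mass_meet Z C) ?I) ?J"
      by (rule mass_join_least[OF medvedev_le_trans[OF representsD(3)[OF Z(1)] mass_join_upper1]])
    \<comment> \<open>On the part \<open>Z\<close> of the meet the implication applies; on the part
      \<open>C\<close> the target is reached at once.\<close>
    moreover have "medvedev_le (mass_meet Z' C) (mass_join (mass_meet Z C) ?I)"
      by (rule mass_join_meet_le[OF le_join_mass_imp
            medvedev_le_trans[OF mass_meet_lower2 mass_join_upper1]])
    ultimately have "medvedev_le (mass_meet Z' C) ?J" by (rule medvedev_le_trans[rotated])
    then have "medvedev_le (relativize Z') ?J"
      by (rule mass_join_least[OF _ medvedev_le_trans[OF le_relativize_Y mass_join_upper2]])
    from medvedev_le_trans[OF representsD(2)[OF Z(2)] this] show "medvedev_le (D Q') ?J" .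
  qed
qed

lemma bval_represented:
  assumes w: "\<And>p. up_closed (w p)"
  shows "\<exists>Z. bval (factor medvedev (mdeg C)) (\<lambda>p. factor_class (D (w p))) \<phi> = factor_class Z \<and>
    represents Z (forces w \<phi>)"
proof (induction \<phi>)
  case (Var p)
  show ?case using represents_Var[OF w] by (intro exI[of _ "D (w p)"]) simp
next
  case Bot
  show ?case using represents_Bot
    by (intro exI[of _ "{}"]) (simp add: med.factor_top medvedev_ops)
next
  case (And \<phi> \<psi>)
  then obtain Z Z' where Z: "bval (factor medvedev (mdeg C)) (\<lambda>p. factor_class (D (w p))) \<phi> = factor_class Z"
      "bval (factor medvedev (mdeg C)) (\<lambda>p. factor_class (D (w p))) \<psi> = factor_class Z'"
    and rep: "represents Z (forces w \<phi>)" "represents Z' (forces w \<psi>)" by blast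
  show ?case using represents_And[OF rep up_closed_forces[OF w] up_closed_forces[OF w]] Z
    by (intro exI[of _ "mass_join Z Z'"]) (simp add: med.factor_join medvedev_ops)
next
  case (Or \<phi> \<psi>)
  then obtain Z Z' where Z: "bval (factor medvedev (mdeg C)) (\<lambda>p. factor_class (D (w p))) \<phi> = factor_class Z"
      "bval (factor medvedev (mdeg C)) (\<lambda>p. factor_class (D (w p))) \<psi> = factor_class Z'"
    and rep: "represents Z (forces w \<phi>)" "represents Z' (forces w \<psi>)" by blast
  show ?case using represents_Or[OF rep up_closed_forces[OF w] up_closed_forces[OF w]] Z
    by (intro exI[of _ "mass_meet Z Z'"]) (simp add: med.factor_meet medvedev_ops)
next
  case (Imp \<phi> \<psi>)
  then obtain Z Z' where Z: "bval (factor medvedev (mdeg C)) (\<lambda>p. factor_class (D (w p))) \<phi> = factor_class Z"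
      "bval (factor medvedev (mdeg C)) (\<lambda>p. factor_class (D (w p))) \<psi> = factor_class Z'"
    and rep: "represents Z (forces w \<phi>)" "represents Z' (forces w \<psi>)" by blast
  show ?case using represents_Imp[OF rep up_closed_forces[OF w] up_closed_forces[OF w]] Z
    by (intro exI[of _ "mass_imp Z (mass_meet Z' C)"])
      (simp add: med.factor_imp medvedev_ops medvedev_imp)
qed

text \<open>If the value were the bottom, then \<open>relativize Z\<close> and hence
  \<open>D (forces w \<phi>)\<close> would be below \<open>Y\<close>, which
  \<open>D_le_Y_imp\<close> allows only if the empty face forces \<open>\<phi>\<close>.\<close>

theorem refuted_in_factor:
  assumes w: "\<And>p. up_closed (w p)" and \<phi>: "\<not> forces w \<phi> {}"
  shows "\<phi> \<notin> Th (factor medvedev (mdeg C))"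
proof
  let ?F = "factor medvedev (mdeg C)" and ?v = "\<lambda>p. factor_class (D (w p))"
  assume "\<phi> \<in> Th ?F"
  moreover have "range ?v \<subseteq> bcarrier ?F" by (auto simp: med.factor_carrier medvedev_ops)
  ultimately have "bval ?F ?v \<phi> = bbot ?F" unfolding Th_def by blast
  also have "bbot ?F = factor_class UNIV" by (simp add: med.factor_bot medvedev_ops)
  finally have bot: "bval ?F ?v \<phi> = factor_class UNIV" .
  obtain Z where "bval ?F ?v \<phi> = factor_class Z \<and> represents Z (forces w \<phi>)"
    by (rule exE[OF bval_represented[of w \<phi>, OF w]])
  then have Z: "bval ?F ?v \<phi> = factor_class Z" and rep: "represents Z (forces w \<phi>)" by simp_all
  have "factor_class Z = factor_class UNIV" using bot Z by simp
  then have "mdeg (mass_meet Z C) = mdeg (mass_meet UNIV C)"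
    by (simp add: med.fclass_eq_iff medvedev_ops)
  then have "medvedev_le (mass_meet Z C) (mass_meet UNIV C)" unfolding mdeg_eq_iff by blast
  then have "medvedev_le (mass_meet Z C) Y"
    by (rule medvedev_le_trans[OF _ medvedev_le_trans[OF mass_meet_lower1 medvedev_le_bot]])
  then have "medvedev_le (relativize Z) Y" by (rule mass_join_least) (rule medvedev_le_refl)
  then have "medvedev_le (D (forces w \<phi>)) Y" by (rule medvedev_le_trans[OF representsD(2)[OF rep]])
  then show False using D_le_Y_imp \<phi> by blast
qed

end

section \<open>The factor captures intuitionistic logic\<close>

lemma finite_chain_Union:
  "finite S \<Longrightarrow> S \<noteq> {} \<Longrightarrow> (\<And>x y. x \<in> S \<Longrightarrow> y \<in> S \<Longrightarrow> x \<subseteq> y \<or> y \<subseteq> x) \<Longrightarrow> \<Union>S \<in> S"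
proof (induction S rule: finite_ne_induct)
  case (insert x S)
  then have U: "\<Union>S \<in> S" by simp
  then have "x \<subseteq> \<Union>S \<or> \<Union>S \<subseteq> x" using insert.prems[of x "\<Union>S"] by simp
  then show ?case
  proof
    assume "x \<subseteq> \<Union>S"
    then have "\<Union>(insert x S) = \<Union>S" by auto
    then show ?thesis using U by simp
  next
    assume "\<Union>S \<subseteq> x"
    then have "\<Union>(insert x S) = x" by auto
    then show ?thesis by simp
  qed
qed simp

text \<open>
  The faces of the following complex are the chains of a finite ordered set of worlds, and
  mapping a chain to its greatest element is a p-morphism. The vertex \<open>Inr (npair m m)\<close> and the
  vertices for the remaining columns belong to no face; they serve to make the sets
  \<open>{i. v \<in> chain_nonfaces i}\<close> nonempty and distinct.
\<close>

locale finite_worlds =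
  fixes W :: "nat \<Rightarrow> 'w set" and m :: nat
begin

definition comparable :: "nat \<Rightarrow> nat \<Rightarrow> bool" where
  "comparable p q \<longleftrightarrow> W p \<subseteq> W q \<or> W q \<subseteq> W p"

definition square :: "nat \<Rightarrow> bool" where
  "square i \<longleftrightarrow> pfst i < m \<and> psnd i < m"

text \<open>Columns of comparable pairs need a set as well. It is padded with
  \<open>Inr (npair m m)\<close>, which is a non-face by itself because \<open>npair m m\<close> is
  not a square index, so nothing new is forbidden. The diagonal pairs are of this kind and tell the
  vertices \<open>Inl p\<close> apart.\<close>

definition chain_nonfaces :: "nat \<Rightarrow> (nat + nat) set" where
  "chain_nonfaces i =
     (if square i then {Inl (pfst i), Inl (psnd i)} \<union>
        (if comparable (pfst i) (psnd i) then {Inr (npair m m)} else {})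
      else {Inr i})"

definition vertices :: "(nat + nat) set" where
  "vertices = Inl ` {..<m} \<union> Inr ` {i. \<not> square i}"

lemma not_square_top: "\<not> square (npair m m)"
  by (simp add: square_def)

lemma chain_nonfaces_Inl: "Inl p \<in> chain_nonfaces i \<longleftrightarrow> square i \<and> (p = pfst i \<or> p = psnd i)"
  by (auto simp: chain_nonfaces_def)

lemma chain_nonfaces_Inr: "Inr k \<in> chain_nonfaces i \<longleftrightarrow>
    \<not> square i \<and> k = i \<or> square i \<and> comparable (pfst i) (psnd i) \<and> k = npair m m"
  by (auto simp: chain_nonfaces_def)

lemma chain_nonfaces_diag: "p < m \<Longrightarrow> Inl p \<in> chain_nonfaces (npair p p)"
  by (simp add: chain_nonfaces_Inl square_def)

lemma Union_chain_nonfaces: "(\<Union>i. chain_nonfaces i) = vertices"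
proof (intro set_eqI iffI)
  fix v assume "v \<in> (\<Union>i. chain_nonfaces i)"
  then obtain i where i: "v \<in> chain_nonfaces i" by blast
  show "v \<in> vertices"
  proof (cases v)
    case (Inl p)
    then show ?thesis using i by (auto simp: chain_nonfaces_Inl square_def vertices_def)
  next
    case (Inr k)
    then have "\<not> square k" using i not_square_top by (auto simp: chain_nonfaces_Inr)
    then show ?thesis using Inr by (simp add: vertices_def)
  qed
next
  fix v assume v: "v \<in> vertices"
  show "v \<in> (\<Union>i. chain_nonfaces i)"
  proof (cases v)
    case (Inl p)
    then have "p < m" using v by (auto simp: vertices_def)
    then show ?thesis using chain_nonfaces_diag Inl by blast
  next
    case (Inr k)
    then have "\<not> square k" using v by (auto simp: vertices_def)
    then have "Inr k \<in> chain_nonfaces k" by (simp add: chain_nonfaces_Inr)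
    then show ?thesis using Inr by blast
  qed
qed

lemma finite_square: "finite {i. square i}"
proof -
  have "{i. square i} \<subseteq> prod_encode ` ({..<m} \<times> {..<m})"
  proof
    fix i assume "i \<in> {i. square i}"
    then have "prod_encode (prod_decode i) \<in> prod_encode ` ({..<m} \<times> {..<m})"
      by (intro imageI) (simp add: square_def mem_Times_iff)
    then show "i \<in> prod_encode ` ({..<m} \<times> {..<m})" by simp
  qed
  then show ?thesis by (rule finite_subset) simp
qed

lemma finite_chain_occurrences: "finite {i. v \<in> chain_nonfaces i}"
proof -
  have "{i. v \<in> chain_nonfaces i} \<subseteq> {i. square i} \<union> (case v of Inl p \<Rightarrow> {} | Inr k \<Rightarrow> {k})"
    by (cases v) (auto simp: chain_nonfaces_Inl chain_nonfaces_Inr)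
  moreover have "finite ({i. square i} \<union> (case v of Inl p \<Rightarrow> {} | Inr k \<Rightarrow> {k}))"
    using finite_square by (cases v) simp_all
  ultimately show ?thesis by (rule finite_subset)
qed

lemma chain_separated:
  assumes "v \<in> vertices" "w \<in> vertices" "v \<noteq> w"
  shows "\<exists>i. (v \<in> chain_nonfaces i) \<noteq> (w \<in> chain_nonfaces i)"
proof -
  have sep: "\<exists>i. (v \<in> chain_nonfaces i) \<noteq> (w \<in> chain_nonfaces i)"
    if "Inr k = w" "w \<in> vertices" "v \<noteq> w" for k v w
  proof -
    have "chain_nonfaces k = {w}" using that by (auto simp: vertices_def chain_nonfaces_def)
    then show ?thesis using that(3) by blast
  qed
  show ?thesis
  proof (cases v)
    case v: (Inl p)
    show ?thesis
    proof (cases w)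
      case (Inl q)
      then have "p < m" "p \<noteq> q" using assms v by (auto simp: vertices_def)
      then show ?thesis
        using v Inl by (intro exI[of _ "npair p p"]) (simp add: chain_nonfaces_Inl square_def)
    qed (use sep[of _ w v] assms in blast)
  next
    case (Inr k)
    then have "\<exists>i. (w \<in> chain_nonfaces i) \<noteq> (v \<in> chain_nonfaces i)" using sep[of k v w] assms by blast
    then show ?thesis by blast
  qed
qed

lemma chain_face_iff:
  "L \<subseteq> vertices \<and> (\<forall>i. \<not> chain_nonfaces i \<subseteq> L) \<longleftrightarrow>
   L \<subseteq> Inl ` {..<m} \<and> (\<forall>p q. Inl p \<in> L \<longrightarrow> Inl q \<in> L \<longrightarrow> comparable p q)"
proof (intro iffI conjI allI impI subsetI)
  fix v assume L: "L \<subseteq> vertices \<and> (\<forall>i. \<not> chain_nonfaces i \<subseteq> L)" and v: "v \<in> L"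
  have "v \<noteq> Inr k" for k
  proof
    assume k: "v = Inr k"
    then have "\<not> square k" using L v by (auto simp: vertices_def)
    then have "chain_nonfaces k \<subseteq> L" using v k by (simp add: chain_nonfaces_def)
    then show False using L by blast
  qed
  moreover have "v \<in> vertices" using L v by blast
  ultimately show "v \<in> Inl ` {..<m}" by (auto simp: vertices_def)
next
  fix p q assume L: "L \<subseteq> vertices \<and> (\<forall>i. \<not> chain_nonfaces i \<subseteq> L)" and pq: "Inl p \<in> L" "Inl q \<in> L"
  show "comparable p q"
  proof (rule ccontr)
    assume "\<not> comparable p q"
    moreover have "p < m" "q < m" using L pq by (auto simp: vertices_def)
    ultimately have "chain_nonfaces (npair p q) \<subseteq> L"
      using pq by (simp add: chain_nonfaces_def square_def)
    then show False using L by blast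
  qed
next
  fix v assume "L \<subseteq> Inl ` {..<m} \<and> (\<forall>p q. Inl p \<in> L \<longrightarrow> Inl q \<in> L \<longrightarrow> comparable p q)" "v \<in> L"
  then show "v \<in> vertices" by (auto simp: vertices_def)
next
  fix i assume L: "L \<subseteq> Inl ` {..<m} \<and> (\<forall>p q. Inl p \<in> L \<longrightarrow> Inl q \<in> L \<longrightarrow> comparable p q)"
  show "\<not> chain_nonfaces i \<subseteq> L"
  proof
    assume sub: "chain_nonfaces i \<subseteq> L"
    have no: "Inr k \<notin> L" for k using L by auto
    have sq: "square i" using sub no[of i] by (auto simp: chain_nonfaces_def split: if_splits)
    have "\<not> comparable (pfst i) (psnd i)"
      using sub no[of "npair m m"] sq by (auto simp: chain_nonfaces_def split: if_splits)
    moreover have "Inl (pfst i) \<in> L" "Inl (psnd i) \<in> L" using sub sq by (auto simp: chain_nonfaces_def)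
    ultimately show False using L by blast
  qed
qed

end

section \<open>Refutation of an underivable formula\<close>

lemma not_in_factor_theory:
  assumes A: "computably_independent A" and \<phi>: "\<not> {} \<turnstile>\<^sub>i \<phi>"
  shows "\<phi> \<notin> Th (factor medvedev (mdeg {i \<frown> f | i f. column A i \<le>\<^sub>T f}))"
proof -
  define \<Sigma> where "\<Sigma> = subforms \<phi>"
  have \<Sigma>: "finite \<Sigma>" "subform_closed \<Sigma>" "\<phi> \<in> \<Sigma>"
    unfolding \<Sigma>_def by (simp_all add: finite_subforms subform_closed_subforms)
  obtain \<Delta>0 where \<Delta>0: "prime_theory \<Sigma> \<Delta>0" "\<not> \<Delta>0 \<turnstile>\<^sub>i \<phi>"
    using prime_extension[OF \<Sigma>(1,2) empty_subsetI \<phi>] by blast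
  define P where "P = {\<Delta>. prime_theory \<Sigma> \<Delta> \<and> \<Delta>0 \<subseteq> \<Delta>}"
  have "finite P" by (rule finite_subset[of _ "Pow \<Sigma>"]) (auto simp: P_def prime_theory_def \<Sigma>(1))
  then obtain m W where W: "P = W ` {i::nat. i < m}" using finite_imp_nat_seg_image_inj_on by metis
  interpret finite_worlds W m .
  let ?H = chain_nonfaces
  have "\<exists>g. (\<forall>i. v \<notin> ?H i \<longrightarrow> column A i \<le>\<^sub>T g) \<and> (\<forall>i. v \<in> ?H i \<longrightarrow> \<not> column A i \<le>\<^sub>T g) \<and>
      (\<forall>i j. v \<in> ?H i \<longrightarrow> v \<in> ?H j \<longrightarrow> column A j \<le>\<^sub>T fjoin g (column A i))" for v
  proof -
    obtain g where "\<And>i. i \<notin> {i. v \<in> ?H i} \<Longrightarrow> column A i \<le>\<^sub>T g"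
      "\<And>i. i \<in> {i. v \<in> ?H i} \<Longrightarrow> \<not> column A i \<le>\<^sub>T g"
      "\<And>i j. i \<in> {i. v \<in> ?H i} \<Longrightarrow> j \<in> {i. v \<in> ?H i} \<Longrightarrow> column A j \<le>\<^sub>T fjoin g (column A i)"
      using join_avoiding_columns[OF A finite_chain_occurrences] by blast
    then show ?thesis by (intro exI[of _ g]) simp
  qed
  then obtain g where g: "\<And>v. (\<forall>i. v \<notin> ?H i \<longrightarrow> column A i \<le>\<^sub>T g v) \<and>
      (\<forall>i. v \<in> ?H i \<longrightarrow> \<not> column A i \<le>\<^sub>T g v) \<and>
      (\<forall>i j. v \<in> ?H i \<longrightarrow> v \<in> ?H j \<longrightarrow> column A j \<le>\<^sub>T fjoin (g v) (column A i))"
    by metis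
  let ?faces = "{L. L \<subseteq> (\<Union>i. ?H i) \<and> (\<forall>i. \<not> ?H i \<subseteq> L)}"
  have faces: "?faces = {L. L \<subseteq> Inl ` {..<m} \<and> (\<forall>p q. Inl p \<in> L \<longrightarrow> Inl q \<in> L \<longrightarrow> comparable p q)}"
    unfolding Union_chain_nonfaces by (rule Collect_cong) (rule chain_face_iff)
  then have sub: "?faces \<subseteq> Pow (Inl ` {..<m})" by blast
  have "\<exists>M e. F = e ` {i::nat. i < M}" if "finite F" for F :: "(nat + nat) set set"
    using finite_imp_nat_seg_image_inj_on[OF that] by blast
  from this[OF finite_subset[OF sub]] obtain M e where e: "?faces = e ` {i::nat. i < M}" by auto
  define K where "K k = (if k < M then e k else ?H (k - M))" for k
  interpret vertex_system "column A" ?H g M K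
  proof
    show "K ` {..<M} = ?faces" unfolding e K_def by auto
    show "finite (K k)" if "k < M" for k
    proof -
      have "e k \<in> ?faces" using e that by auto
      then have "e k \<subseteq> Inl ` {..<m}" using sub by auto
      then show ?thesis using that finite_subset[of "e k" "Inl ` {..<m}"] unfolding K_def by simp
    qed
    show "K (M + i) = ?H i" for i unfolding K_def by simp
    show "?H i \<noteq> {}" for i by (simp add: chain_nonfaces_def)
    show "finite {i. v \<in> ?H i}" for v by (rule finite_chain_occurrences)
    show "\<exists>i. (v \<in> ?H i) \<noteq> (w \<in> ?H i)" if "v \<in> (\<Union>i. ?H i)" "w \<in> (\<Union>i. ?H i)" "v \<noteq> w" for v w
      using chain_separated that unfolding Union_chain_nonfaces .
  qed (use g in blast)+
  have face_iff: "L \<subseteq> V \<and> \<not> nonface L \<longleftrightarrow>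
      L \<subseteq> Inl ` {..<m} \<and> (\<forall>p q. Inl p \<in> L \<longrightarrow> Inl q \<in> L \<longrightarrow> comparable p q)" for L
    unfolding V_def nonface_def Union_chain_nonfaces using chain_face_iff by simp
  \<comment> \<open>On a face this is the greatest world of the chain. Adding
    \<open>\<Delta>0\<close>, which lies below all worlds, gives the empty chain the root as its
    value.\<close>
  define \<Theta> where "\<Theta> L = \<Delta>0 \<union> \<Union>{W p | p. Inl p \<in> L}" for L :: "(nat + nat) set"
  have \<Theta>_mono: "\<Theta> L \<subseteq> \<Theta> L'" if "L \<subseteq> L'" for L L' unfolding \<Theta>_def using that by blast
  have \<Theta>_P: "\<Theta> L \<in> P" if L: "L \<subseteq> V" "\<not> nonface L" for L
  proof -
    have ch: "L \<subseteq> Inl ` {..<m}" "\<And>p q. Inl p \<in> L \<Longrightarrow> Inl q \<in> L \<Longrightarrow> comparable p q"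
      using face_iff L by blast+
    let ?S = "insert \<Delta>0 {W p | p. Inl p \<in> L}"
    have SP: "?S \<subseteq> P" using ch(1) \<Delta>0(1) unfolding W using W by (auto simp: P_def)
    have "\<Union>?S \<in> ?S"
    proof (rule finite_chain_Union)
      show "finite ?S" using SP \<open>finite P\<close> by (rule finite_subset)
      show "x \<subseteq> y \<or> y \<subseteq> x" if xy: "x \<in> ?S" "y \<in> ?S" for x y
      proof (cases "x = \<Delta>0 \<or> y = \<Delta>0")
        case True
        then show ?thesis using SP xy unfolding P_def by blast
      next
        case False
        then show ?thesis using xy ch(2) unfolding comparable_def by blast
      qed
    qed simp
    moreover have "\<Union>?S = \<Theta> L" unfolding \<Theta>_def by simp
    ultimately show ?thesis using SP by auto
  qed
  have \<Theta>_prime: "prime_theory \<Sigma> (\<Theta> L)" if "L \<subseteq> V" "\<not> nonface L" for L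
    using \<Theta>_P[OF that] unfolding P_def by blast
  have nonface_mono: "nonface L'" if "nonface L" "L \<subseteq> L'" for L L'
    using that unfolding nonface_def by blast
  define w where "w p L \<longleftrightarrow> nonface L \<or> Var p \<in> \<Theta> L" for p L
  have w: "up_closed (w p)" for p
  proof (rule up_closedI)
    show "w p L'" if "L \<subseteq> L'" "w p L" for L L'
      using that nonface_mono \<Theta>_mono[OF that(1)] unfolding w_def by blast
    show "w p (?H i)" for i unfolding w_def nonface_def by blast
  qed
  have truth: "\<chi> \<in> \<Sigma> \<Longrightarrow> L \<subseteq> V \<Longrightarrow> forces w \<chi> L \<longleftrightarrow> nonface L \<or> \<chi> \<in> \<Theta> L" for \<chi> L
  proof (induction \<chi> arbitrary: L)
    case (Var p)
    show ?case by (simp add: w_def)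
  next
    case Bot
    have "Bot \<notin> \<Theta> L" if "\<not> nonface L"
      using \<Theta>_prime[OF Bot(2) that] int_entails.Hyp[of Bot "\<Theta> L"] unfolding prime_theory_def by blast
    then show ?case by auto
  next
    case (And \<alpha> \<beta>)
    have "\<alpha> \<in> \<Sigma>" "\<beta> \<in> \<Sigma>" using subform_closedD(1)[OF \<Sigma>(2) And.prems(1)] by simp_all
    then show ?case
      using And.IH And.prems(2) prime_theory_And[OF \<Theta>_prime \<Sigma>(2) And.prems(1)] by auto
  next
    case (Or \<alpha> \<beta>)
    have "\<alpha> \<in> \<Sigma>" "\<beta> \<in> \<Sigma>" using subform_closedD(2)[OF \<Sigma>(2) Or.prems(1)] by simp_all
    then show ?case
      using Or.IH Or.prems(2) prime_theory_Or[OF \<Theta>_prime \<Sigma>(2) Or.prems(1)] by auto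
  next
    case (Imp \<alpha> \<beta>)
    have sub: "\<alpha> \<in> \<Sigma>" "\<beta> \<in> \<Sigma>" using subform_closedD(3)[OF \<Sigma>(2) Imp.prems(1)] by simp_all
    show ?case
    proof (cases "nonface L")
      case True
      then show ?thesis using up_closed_nonface[OF up_closed_forces[of w "Imp \<alpha> \<beta>", OF w]] by simp
    next
      case False
      note mem = prime_theory_Imp[OF \<Theta>_prime[OF Imp.prems(2) False] \<Sigma>(1,2) Imp.prems(1)]
      have "forces w (Imp \<alpha> \<beta>) L \<longleftrightarrow>
        (\<forall>L'. L \<subseteq> L' \<and> L' \<subseteq> V \<and> \<not> nonface L' \<and> \<alpha> \<in> \<Theta> L' \<longrightarrow> \<beta> \<in> \<Theta> L')"
        using Imp.IH(1)[OF sub(1)] Imp.IH(2)[OF sub(2)] by (auto simp: imp_pred_def)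
      also have "\<dots> \<longleftrightarrow> Imp \<alpha> \<beta> \<in> \<Theta> L"
      proof
        assume "Imp \<alpha> \<beta> \<in> \<Theta> L"
        then show "\<forall>L'. L \<subseteq> L' \<and> L' \<subseteq> V \<and> \<not> nonface L' \<and> \<alpha> \<in> \<Theta> L' \<longrightarrow> \<beta> \<in> \<Theta> L'"
          unfolding mem using \<Theta>_prime \<Theta>_mono by blast
      next
        assume all: "\<forall>L'. L \<subseteq> L' \<and> L' \<subseteq> V \<and> \<not> nonface L' \<and> \<alpha> \<in> \<Theta> L' \<longrightarrow> \<beta> \<in> \<Theta> L'"
        show "Imp \<alpha> \<beta> \<in> \<Theta> L"
          unfolding mem
        proof (intro allI impI)
          fix \<Delta> assume \<Delta>: "prime_theory \<Sigma> \<Delta> \<and> \<Theta> L \<subseteq> \<Delta> \<and> \<alpha> \<in> \<Delta>"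
          then have "\<Delta> \<in> P" unfolding P_def \<Theta>_def by blast
          then obtain c where c: "c < m" "\<Delta> = W c" unfolding W by blast
          \<comment> \<open>The back condition of the p-morphism: a world above the greatest element
            of the chain can be added to the chain and becomes its new greatest element.\<close>
          let ?L = "insert (Inl c) L"
          have Wp: "W p \<subseteq> \<Delta>" if "Inl p \<in> L" for p using that \<Delta> unfolding \<Theta>_def by blast
          have L: "L \<subseteq> Inl ` {..<m}" "\<And>p q. Inl p \<in> L \<Longrightarrow> Inl q \<in> L \<Longrightarrow> comparable p q"
            using face_iff[of L] Imp.prems(2) False by blast+
          have "?L \<subseteq> V \<and> \<not> nonface ?L"
            unfolding face_iff
          proof (intro conjI allI impI)
            show "?L \<subseteq> Inl ` {..<m}" using L(1) c(1) by auto
            show "comparable p q" if "Inl p \<in> ?L" "Inl q \<in> ?L" for p q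
              using that L(2)[of p q] Wp[of p] Wp[of q] c(2) unfolding comparable_def by auto
          qed
          moreover have "\<Theta> ?L = \<Delta>"
          proof
            show "\<Theta> ?L \<subseteq> \<Delta>" using \<Delta> Wp c(2) unfolding \<Theta>_def by auto
            show "\<Delta> \<subseteq> \<Theta> ?L" using c(2) unfolding \<Theta>_def by auto
          qed
          ultimately show "\<beta> \<in> \<Delta>" using all[rule_format, of ?L] \<Delta> by auto
        qed
      qed
      finally show ?thesis using False by simp
    qed
  qed
  have "\<phi> \<notin> \<Delta>0" using \<Delta>0(2) int_entails.Hyp by blast
  then have "\<not> forces w \<phi> {}"
    using truth[OF \<Sigma>(3) empty_subsetI] not_nonface_empty unfolding \<Theta>_def by simp
  from refuted_in_factor[of w, OF w this] show ?thesis unfolding C_def .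
qed

theorem theorem1p1:
  fixes A :: "nat set"
  assumes "computably_independent A"
  shows "Th (factor medvedev (mdeg {i \<frown> f | i f. column A i \<le>\<^sub>T f})) = IPC"
proof
  let ?x = "mdeg {i \<frown> f | i f. column A i \<le>\<^sub>T f}"
  have "brouwer_algebra (factor medvedev ?x)"
    by (rule med.factor_brouwer_algebra) (simp add: medvedev_ops)
  then show "IPC \<subseteq> Th (factor medvedev ?x)" by (rule brouwer_algebra.IPC_subset_Th)
  show "Th (factor medvedev ?x) \<subseteq> IPC"
  proof
    fix \<phi> assume "\<phi> \<in> Th (factor medvedev ?x)"
    then show "\<phi> \<in> IPC" using not_in_factor_theory[OF assms] unfolding IPC_def by blast
  qed
qed

end
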